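(* Let $\rho$ be a Riemannian metric on the 2-torus $\mathbb{T}^2$ whose geodesic flow $\rho^t$ has a first integral $F_3$ that is a homogeneous polynomial of degree $3$ in the momenta, and let $\Omega_e\subset\mathbb{T}^2$ be an elliptic region for $F_3$. Write $\rho$ in global conformal coordinates $(q_1,q_2)$ as $ds^2=\Lambda(q_1,q_2)(dq_1^2+dq_2^2)$. Then either the metric $\rho$ is flat on $\Omega_e$, or $\Lambda=\Lambda(mq_1+nq_2)$ on $\Omega_e$ for some real numbers $m,n$ (i.e. $\Lambda$ is a function of the single variable $mq_1+nq_2$ there). If in addition $\rho$ is real analytic on $\mathbb{T}^2$, then $\Lambda=\Lambda(mq_1+nq_2)$ everywhere on the whole torus $\mathbb{T}^2$ and the flow $\rho^t$ necessarily has a first integral on the whole torus $\mathbb{T}^2$ that is of first degree (linear) in the momenta.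
   Context: All objects are smooth. $\mathbb{T}^2=\mathbb{R}^2/\Gamma$, $\Gamma$ a lattice; $H:T^*\mathbb{T}^2\to\mathbb{R}$ is half the squared norm of the momentum. A first integral is a function $F$ on the cotangent bundle with $\{F,H\}=0$. Conformal coordinates: global coordinates $(q_1,q_2)$ on the covering plane with $ds^2=\Lambda(q_1,q_2)(dq_1^2+dq_2^2)$, $H=\frac{1}{2\Lambda}(p_1^2+p_2^2)$, where $\Lambda>0$ is periodic with respect to the lattice $\Gamma$. Normalized semi-geodesic coordinates (standing assumption; it is known that they exist): using a regular Liouville torus $L$ of the geodesic flow (a common level set of $F_n$ and $H$ on which $dF_n,dH$ are independent) that projects diffeomorphically onto $\mathbb{T}^2$, one has global coordinates $(t,x)$ on the covering plane, with conjugate momenta $(p_1,p_2)$, such that the curves $\{t=\text{const}\}$ are the geodesics of $L$ and $ds^2=g^2(t,x)\,dt^2+dx^2$, $g>0$, $H=\tfrac12(p_1^2/g^2+p_2^2)$. The integral is written $F_n=\sum_{k=0}^n a_k(t,x)\frac{p_1^{n-k}}{g^{n-k}}p_2^k$, normalized so that $a_{n-1}\equiv g$, $a_n\equiv 1$. For $n=3$, with $U=(a_0,a_1,a_2)^T$, the condition $\{F_3,H\}=0$ becomes $U_t+A(U)U_x=0$ with $$A(U)=\begin{pmatrix}0&0&a_1\\ a_2&0&2a_2-3a_0\\ 0&a_2&3-2a_1\end{pmatrix}.$$ Elliptic region: a (nonempty) connected component $\Omega_e$ of the set of points of $\mathbb{T}^2$ at which the eigenvalues of $A(U)$ are distinct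 and two of them are non-real complex conjugates. *)

theory Defs
  imports "HOL-Analysis.Analysis"
begin

section \<open>Smooth and real analytic functions\<close>

primrec Ck :: "nat \<Rightarrow> ('a::real_normed_vector \<Rightarrow> 'b::real_normed_vector) \<Rightarrow> bool" where
  "Ck 0 f \<longleftrightarrow> continuous_on UNIV f"
| "Ck (Suc k) f \<longleftrightarrow>
     (\<forall>x. f differentiable (at x)) \<and> (\<forall>v. Ck k (\<lambda>x. frechet_derivative f (at x) v))"

definition smooth :: "('a::real_normed_vector \<Rightarrow> 'b::real_normed_vector) \<Rightarrow> bool" where
  "smooth f \<longleftrightarrow> (\<forall>k. Ck k f)"

definition diffeomorphism :: "(real^2 \<Rightarrow> real^2) \<Rightarrow> bool" where
  "diffeomorphism S \<longleftrightarrow> bij S \<and> smooth S \<and> smooth (inv S)"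

definition partial_deriv :: "2 \<Rightarrow> (real^2 \<Rightarrow> real) \<Rightarrow> real^2 \<Rightarrow> real" where
  "partial_deriv i f q = frechet_derivative f (at q) (axis i 1)"

definition real_analytic :: "(real^2 \<Rightarrow> real) \<Rightarrow> bool" where
  "real_analytic f \<longleftrightarrow> (\<forall>q. \<exists>(c::nat \<Rightarrow> nat \<Rightarrow> real) r. r > 0 \<and>
     (\<forall>h::real^2. norm h < r \<longrightarrow>
        ((\<lambda>(i, j). c i j * (h $ 1) ^ i * (h $ 2) ^ j) has_sum f (q + h)) UNIV))"

section \<open>The torus\<close>

definition lattice :: "(real^2) set \<Rightarrow> bool" where
  "lattice \<Gamma> \<longleftrightarrow> (\<exists>u v. u \<noteq> v \<and> independent {u, v} \<and>
     \<Gamma> = {of_int i *\<^sub>R u + of_int j *\<^sub>R v | i j. True})"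

definition lattice_periodic :: "(real^2) set \<Rightarrow> (real^2 \<Rightarrow> 'a) \<Rightarrow> bool" where
  "lattice_periodic \<Gamma> f \<longleftrightarrow> (\<forall>\<gamma>\<in>\<Gamma>. \<forall>q. f (q + \<gamma>) = f q)"

text \<open>Points of the torus are the cosets of \<open>\<Gamma>\<close> in the plane. For a set \<open>V\<close> of torus points,
  \<open>\<Union>V\<close> is therefore its full preimage in the covering plane.\<close>

definition torus_proj :: "(real^2) set \<Rightarrow> real^2 \<Rightarrow> (real^2) set" where
  "torus_proj \<Gamma> q = (\<lambda>\<gamma>. q + \<gamma>) ` \<Gamma>"

definition torus_topology :: "(real^2) set \<Rightarrow> (real^2) set topology" where
  "torus_topology \<Gamma> =
     topology (\<lambda>V. V \<subseteq> range (torus_proj \<Gamma>) \<and> open (torus_proj \<Gamma> -` V))"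

lemma openin_torus_topology:
  "openin (torus_topology \<Gamma>) V \<longleftrightarrow> V \<subseteq> range (torus_proj \<Gamma>) \<and> open (torus_proj \<Gamma> -` V)"
proof -
  have "istopology (\<lambda>V. V \<subseteq> range (torus_proj \<Gamma>) \<and> open (torus_proj \<Gamma> -` V))"
    unfolding istopology_def by (auto simp: vimage_Union intro!: open_Int open_UN)
  then show ?thesis
    unfolding torus_topology_def by (simp add: topology_inverse')
qed

lemma topspace_torus_topology: "topspace (torus_topology \<Gamma>) = range (torus_proj \<Gamma>)"
proof -
  have "openin (torus_topology \<Gamma>) (range (torus_proj \<Gamma>))"
    by (simp add: openin_torus_topology vimage_def)
  then show ?thesis
    by (metis openin_subset openin_topspace openin_torus_topology subset_antisym)
qed

lemma quotient_map_torus_proj: "quotient_map euclidean (torus_topology \<Gamma>) (torus_proj \<Gamma>)"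
  unfolding quotient_map_def
  by (auto simp: topspace_torus_topology openin_torus_topology vimage_def)

section \<open>Riemannian metrics\<close>

text \<open>A metric on the torus is given by its matrix field in the coordinates \<open>(q\<^sub>1, q\<^sub>2)\<close> of the
  covering plane.\<close>

definition riemannian_metric :: "(real^2) set \<Rightarrow> (real^2 \<Rightarrow> real^2^2) \<Rightarrow> bool" where
  "riemannian_metric \<Gamma> \<rho> \<longleftrightarrow> smooth \<rho> \<and> lattice_periodic \<Gamma> \<rho> \<and>
     (\<forall>q. transpose (\<rho> q) = \<rho> q) \<and> (\<forall>q v. v \<noteq> 0 \<longrightarrow> v \<bullet> (\<rho> q *v v) > 0)"

definition analytic_metric :: "(real^2 \<Rightarrow> real^2^2) \<Rightarrow> bool" where
  "analytic_metric \<rho> \<longleftrightarrow> (\<forall>i j. real_analytic (\<lambda>q. \<rho> q $ i $ j))"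

definition conformal_coordinates ::
  "(real^2) set \<Rightarrow> (real^2 \<Rightarrow> real^2^2) \<Rightarrow> (real^2 \<Rightarrow> real) \<Rightarrow> bool" where
  "conformal_coordinates \<Gamma> \<rho> \<Lambda> \<longleftrightarrow> smooth \<Lambda> \<and> lattice_periodic \<Gamma> \<Lambda> \<and>
     (\<forall>q. \<Lambda> q > 0) \<and> (\<forall>q. \<rho> q = \<Lambda> q *\<^sub>R mat 1)"

text \<open>\<open>christoffel \<rho> k i j\<close> is \<open>\<Gamma>\<^sup>k\<^sub>i\<^sub>j\<close>, and \<open>riemann_tensor \<rho> l k i j\<close> is the component
  along \<open>\<partial>\<^sub>l\<close> of \<open>R(\<partial>\<^sub>i, \<partial>\<^sub>j) \<partial>\<^sub>k\<close>.\<close>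

definition christoffel ::
  "(real^2 \<Rightarrow> real^2^2) \<Rightarrow> 2 \<Rightarrow> 2 \<Rightarrow> 2 \<Rightarrow> real^2 \<Rightarrow> real" where
  "christoffel \<rho> k i j q = 1/2 * (\<Sum>l\<in>UNIV. matrix_inv (\<rho> q) $ k $ l *
     (partial_deriv i (\<lambda>y. \<rho> y $ j $ l) q + partial_deriv j (\<lambda>y. \<rho> y $ i $ l) q
      - partial_deriv l (\<lambda>y. \<rho> y $ i $ j) q))"

definition riemann_tensor ::
  "(real^2 \<Rightarrow> real^2^2) \<Rightarrow> 2 \<Rightarrow> 2 \<Rightarrow> 2 \<Rightarrow> 2 \<Rightarrow> real^2 \<Rightarrow> real" where
  "riemann_tensor \<rho> l k i j q =
     partial_deriv i (christoffel \<rho> l j k) q - partial_deriv j (christoffel \<rho> l i k) q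
     + (\<Sum>m\<in>UNIV. christoffel \<rho> l i m q * christoffel \<rho> m j k q
                 - christoffel \<rho> l j m q * christoffel \<rho> m i k q)"

definition flat_on :: "(real^2 \<Rightarrow> real^2^2) \<Rightarrow> (real^2) set \<Rightarrow> bool" where
  "flat_on \<rho> W \<longleftrightarrow> (\<forall>q\<in>W. \<forall>l k i j. riemann_tensor \<rho> l k i j q = 0)"

section \<open>Geodesic flow and integrals\<close>

type_synonym phase = "(real^2) \<times> (real^2)"

definition hamiltonian :: "(real^2 \<Rightarrow> real^2^2) \<Rightarrow> phase \<Rightarrow> real" where
  "hamiltonian \<rho> = (\<lambda>(q, p). 1/2 * (p \<bullet> (matrix_inv (\<rho> q) *v p)))"

definition poisson :: "(phase \<Rightarrow> real) \<Rightarrow> (phase \<Rightarrow> real) \<Rightarrow> phase \<Rightarrow> real" where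
  "poisson F G z = (\<Sum>i\<in>UNIV.
     frechet_derivative F (at z) (axis i 1, 0) * frechet_derivative G (at z) (0, axis i 1)
   - frechet_derivative F (at z) (0, axis i 1) * frechet_derivative G (at z) (axis i 1, 0))"

definition first_integral ::
  "(real^2) set \<Rightarrow> (real^2 \<Rightarrow> real^2^2) \<Rightarrow> (phase \<Rightarrow> real) \<Rightarrow> bool" where
  "first_integral \<Gamma> \<rho> F \<longleftrightarrow> smooth F \<and> (\<forall>p. lattice_periodic \<Gamma> (\<lambda>q. F (q, p))) \<and>
     (\<forall>z. poisson F (hamiltonian \<rho>) z = 0)"

definition homogeneous_in_momenta :: "nat \<Rightarrow> (phase \<Rightarrow> real) \<Rightarrow> bool" where
  "homogeneous_in_momenta n F \<longleftrightarrow> (\<exists>b::nat \<Rightarrow> real^2 \<Rightarrow> real. \<forall>q p.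
     F (q, p) = (\<Sum>k\<le>n. b k q * (p $ 1) ^ (n - k) * (p $ 2) ^ k))"

section \<open>Normalized semi-geodesic coordinates\<close>

text \<open>A regular Liouville torus that projects diffeomorphically onto the base, lifted to the
  cotangent bundle of the covering plane: the graph of a smooth periodic covector field \<open>\<sigma>\<close>
  contained in a common level of \<open>F\<close> and \<open>H\<close>. Since the differentials are independent along it,
  such a graph is (downstairs) open and closed in the level, i.e. a full connected component.\<close>

definition regular_liouville_torus ::
  "(real^2) set \<Rightarrow> (real^2 \<Rightarrow> real^2^2) \<Rightarrow> (phase \<Rightarrow> real) \<Rightarrow> phase set \<Rightarrow> bool" where
  "regular_liouville_torus \<Gamma> \<rho> F L \<longleftrightarrow>
     (\<exists>\<sigma>. smooth \<sigma> \<and> lattice_periodic \<Gamma> \<sigma> \<and> L = range (\<lambda>q. (q, \<sigma> q))) \<and>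
     (\<exists>c h. \<forall>z\<in>L. F z = c \<and> hamiltonian \<rho> z = h) \<and>
     (\<forall>z\<in>L. \<forall>\<alpha> \<beta>. (\<forall>w. \<alpha> * frechet_derivative F (at z) w
                        + \<beta> * frechet_derivative (hamiltonian \<rho>) (at z) w = 0)
                 \<longrightarrow> \<alpha> = 0 \<and> \<beta> = 0)"

text \<open>\<open>S q = (t, x)\<close>. The first differential condition says that the curves \<open>t = const\<close> are
  integral curves of the velocity field \<open>\<rho>\<^sup>-\<^sup>1 p\<close> of \<open>L\<close>, i.e. the geodesics of \<open>L\<close>; the second
  one is \<open>ds\<^sup>2 = g\<^sup>2 dt\<^sup>2 + dx\<^sup>2\<close>.\<close>

definition semigeodesic_coordinates ::
  "(real^2 \<Rightarrow> real^2^2) \<Rightarrow> phase set \<Rightarrow> (real^2 \<Rightarrow> real^2) \<Rightarrow> (real^2 \<Rightarrow> real) \<Rightarrow> bool" where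
  "semigeodesic_coordinates \<rho> L S g \<longleftrightarrow>
     diffeomorphism S \<and> smooth g \<and> (\<forall>y. g y > 0) \<and>
     (\<forall>(q, p)\<in>L. (jacobian S (at q) *v (matrix_inv (\<rho> q) *v p)) $ 1 = 0) \<and>
     (\<forall>q v. v \<bullet> (\<rho> q *v v) = (g (S q))\<^sup>2 * ((jacobian S (at q) *v v) $ 1)\<^sup>2
                            + ((jacobian S (at q) *v v) $ 2)\<^sup>2)"

text \<open>\<open>P = (p\<^sub>1, p\<^sub>2)\<close> are the momenta conjugate to \<open>(t, x)\<close>; the same covector has components
  \<open>(DS)\<^sup>T P\<close> in the coordinates \<open>q\<close>. The constant \<open>c\<close> is the rescaling of the integral that
  achieves \<open>a\<^sub>3 = 1\<close>.\<close>

definition normalized_cubic ::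
  "(phase \<Rightarrow> real) \<Rightarrow> (real^2 \<Rightarrow> real^2) \<Rightarrow> (real^2 \<Rightarrow> real) \<Rightarrow> (nat \<Rightarrow> real^2 \<Rightarrow> real) \<Rightarrow> bool" where
  "normalized_cubic F S g a \<longleftrightarrow>
     (\<forall>k\<le>3. smooth (a k)) \<and> (\<forall>y. a 2 y = g y) \<and> (\<forall>y. a 3 y = 1) \<and>
     (\<exists>c. c \<noteq> 0 \<and> (\<forall>q P. c * F (q, transpose (jacobian S (at q)) *v P) =
        (\<Sum>k\<le>3. a k (S q) * ((P $ 1) ^ (3 - k) / g (S q) ^ (3 - k)) * (P $ 2) ^ k)))"

section \<open>Elliptic regions\<close>

definition A_matrix :: "real^3 \<Rightarrow> real^3^3" where
  "A_matrix U = (let a0 = U $ 1; a1 = U $ 2; a2 = U $ 3 in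
     vector [vector [0,  0,  a1],
             vector [a2, 0,  2 * a2 - 3 * a0],
             vector [0,  a2, 3 - 2 * a1]])"

definition complex_eigenvalues :: "real^'n^'n \<Rightarrow> complex set" where
  "complex_eigenvalues M =
     {\<mu>. \<exists>v::complex^'n. v \<noteq> 0 \<and> map_matrix complex_of_real M *v v = \<mu> *s v}"

definition elliptic_matrix :: "real^3^3 \<Rightarrow> bool" where
  "elliptic_matrix M \<longleftrightarrow> card (complex_eigenvalues M) = 3 \<and>
     (\<exists>\<mu>\<in>complex_eigenvalues M. \<mu> \<notin> \<real> \<and> cnj \<mu> \<in> complex_eigenvalues M)"

definition elliptic_set ::
  "(real^2) set \<Rightarrow> (real^2 \<Rightarrow> real^2) \<Rightarrow> (nat \<Rightarrow> real^2 \<Rightarrow> real) \<Rightarrow> (real^2) set set" where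
  "elliptic_set \<Gamma> S a = torus_proj \<Gamma> `
     {q. elliptic_matrix (A_matrix (vector [a 0 (S q), a 1 (S q), a 2 (S q)]))}"

definition elliptic_region ::
  "(real^2) set \<Rightarrow> (real^2 \<Rightarrow> real^2) \<Rightarrow> (nat \<Rightarrow> real^2 \<Rightarrow> real) \<Rightarrow> (real^2) set set \<Rightarrow> bool" where
  "elliptic_region \<Gamma> S a \<Omega> \<longleftrightarrow>
     \<Omega> \<in> connected_components_of (subtopology (torus_topology \<Gamma>) (elliptic_set \<Gamma> S a))"

definition function_of_linear_form ::
  "(real^2 \<Rightarrow> real) \<Rightarrow> real \<Rightarrow> real \<Rightarrow> (real^2) set \<Rightarrow> bool" where
  "function_of_linear_form \<Lambda> m n W \<longleftrightarrow>
     (\<exists>f::real \<Rightarrow> real. \<forall>q\<in>W. \<Lambda> q = f (m * q $ 1 + n * q $ 2))"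

end

theory Submission
  imports Defs
begin

text \<open>In conformal coordinates put \<open>x = p\<^sub>1 - i p\<^sub>2\<close>. Then \<open>F\<^sub>3\<close> is twice the real part of
  \<open>A x\<^sup>3 + B x\<^sup>2 (cnj x)\<close>, and commutation with \<open>H\<close> forces \<open>A\<close> to be holomorphic, hence constant on
  the torus. If \<open>A = 0\<close>, then \<open>\<Lambda> B\<close> is a constant too, \<open>F\<^sub>3\<close> is \<open>H\<close> times a linear integral, and \<open>\<Lambda>\<close>
  is invariant in the direction \<open>\<Lambda> B\<close>.

  If \<open>A \<noteq> 0\<close>, the critical points of \<open>F\<^sub>3\<close> on the complexified circle \<open>H = const\<close> are the roots
  \<open>s = x / cnj x\<close> of a cubic; at elliptic points these are \<open>s\<close>, \<open>1 / cnj s\<close> with \<open>\<bar>s\<bar> > 1\<close>, and a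
  third one on the unit circle. The squared critical value \<open>R\<close> at \<open>s\<close> solves the Beltrami equation
  \<open>R\<^sub>z + s R\<^sub>z\<^sub>b\<^sub>a\<^sub>r = 0\<close>, so its Jacobian has a sign, and \<open>R\<close> becomes real at the boundary of the elliptic
  set. Cutting off with a function of \<open>Im R\<close> gives a \<open>C\<^sup>1\<close> map on the torus, whose Jacobian has mean
  zero; hence \<open>R\<close> is locally constant. What remains is a simple wave: \<open>\<Lambda>\<close> and \<open>B\<close> are
  constant along straight lines, whose direction is given by the third root. These lines never
  leave the elliptic set, so any two of them are parallel, as they would otherwise intersect. Thus
  \<open>\<Lambda>\<close> is a function of one linear form on the elliptic set. In the
  analytic case the invariance extends to the plane and the conjugate momentum is the linear
  integral.\<close>

section \<open>Jacobians of periodic maps\<close>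

lemma integral_periodic_shift:
  fixes \<phi> :: "real \<Rightarrow> real"
  assumes cont: "continuous_on UNIV \<phi>" and per: "\<And>x. \<phi> (x + 1) = \<phi> x"
  shows "integral {0..1} (\<lambda>x. \<phi> (x + h)) = integral {0..1} \<phi>"
proof -
  have nonneg: "integral {0..1} (\<lambda>x. \<psi> (x + h)) = integral {0..1} \<psi>"
    if cont: "continuous_on UNIV \<psi>" and per: "\<And>x. \<psi> (x + 1) = \<psi> x" and h: "h \<ge> 0"
    for \<psi> :: "real \<Rightarrow> real" and h
  proof -
    have int: "\<psi> integrable_on {a..b}" for a b
      by (rule integrable_continuous_real) (rule continuous_on_subset[OF cont], simp)
    have shift: "integral {a..b} (\<lambda>x. \<psi> (x + c)) = integral {a+c..b+c} \<psi>" for a b c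
      using integral_shift_Icc_real[of a b \<psi> c] by (simp add: o_def add.commute)
    \<comment> \<open>The interval from 0 to 1 + h is cut once at 1 and once at h; by periodicity
      the piece beyond 1 equals the piece before h.\<close>
    have "integral {0..1} \<psi> + integral {1..1+h} \<psi> = integral {0..h} \<psi> + integral {h..1+h} \<psi>"
      using Henstock_Kurzweil_Integration.integral_combine[of 0 1 "1+h" \<psi>]
        Henstock_Kurzweil_Integration.integral_combine[of 0 h "1+h" \<psi>] int h by simp
    moreover have "integral {1..1+h} \<psi> = integral {0..h} \<psi>"
      using shift[of 0 h 1] per by (simp add: add.commute)
    ultimately show ?thesis using shift[of 0 1 h] by simp
  qed
  show ?thesis
  proof (cases "h \<ge> 0")
    case True then show ?thesis using nonneg[OF cont per] by simp
  next
    case False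
    \<comment> \<open>A negative h is undone: the nonnegative case is applied to the translate of
      \<phi> by h, with shift -h.\<close>
    have "integral {0..1} (\<lambda>x. \<phi> (x + -h + h)) = integral {0..1} (\<lambda>x. \<phi> (x + h))"
    proof (rule nonneg[where \<psi> = "\<lambda>x. \<phi> (x + h)"])
      show "continuous_on UNIV (\<lambda>x. \<phi> (x + h))"
        by (intro continuous_intros continuous_on_compose2[OF cont]) auto
      show "\<phi> (x + 1 + h) = \<phi> (x + h)" for x
        using per[of "x + h"] by (simp add: add_ac)
    qed (use False in simp)
    then show ?thesis by simp
  qed
qed

lemma integral_periodic_by_parts:
  fixes f g :: "real \<Rightarrow> real"
  assumes f: "\<And>x. (f has_field_derivative f' x) (at x)"
    and g: "\<And>x. (g has_field_derivative g' x) (at x)"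
    and cont: "continuous_on UNIV f'" "continuous_on UNIV g'"
    and per: "f 1 = f 0" "g 1 = g 0"
  shows "integral {0..1} (\<lambda>x. f x * g' x) = - integral {0..1} (\<lambda>x. f' x * g x)"
proof -
  have cf: "continuous_on UNIV f" "continuous_on UNIV g"
    using f g by (meson DERIV_isCont continuous_at_imp_continuous_on)+
  have c: "continuous_on {0..1} f'" "continuous_on {0..1} g'" "continuous_on {0..1} f" "continuous_on {0..1} g"
    using cont cf continuous_on_subset by blast+
  have "((\<lambda>x. f x * g' x + f' x * g x) has_integral (f 1 * g 1 - f 0 * g 0)) {0..1}"
    by (rule fundamental_theorem_of_calculus)
       (auto intro!: derivative_eq_intros f g simp flip: has_real_derivative_iff_has_vector_derivative
             intro: DERIV_subset)
  then have "integral {0..1} (\<lambda>x. f x * g' x + f' x * g x) = 0"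
    using per by (simp add: integral_unique)
  moreover have "integral {0..1} (\<lambda>x. f x * g' x + f' x * g x) =
      integral {0..1} (\<lambda>x. f x * g' x) + integral {0..1} (\<lambda>x. f' x * g x)"
    by (intro Henstock_Kurzweil_Integration.integral_add integrable_continuous_real continuous_intros c)
  ultimately show ?thesis by simp
qed

text \<open>Differentiating the integral of \<open>f (a + h) b * gb a b\<close> in \<open>h\<close>, before and after moving both the
  \<open>b\<close>-derivative and the shift to the other factor, avoids second derivatives.\<close>

lemma integral_periodic_jacobian:
  fixes f g fa fb ga gb :: "real \<Rightarrow> real \<Rightarrow> real"
  assumes fa: "\<And>a b. ((\<lambda>a. f a b) has_field_derivative fa a b) (at a)"
    and fb: "\<And>a b. ((\<lambda>b. f a b) has_field_derivative fb a b) (at b)"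
    and ga: "\<And>a b. ((\<lambda>a. g a b) has_field_derivative ga a b) (at a)"
    and gb: "\<And>a b. ((\<lambda>b. g a b) has_field_derivative gb a b) (at b)"
    and cont: "continuous_on UNIV (\<lambda>(a, b). f a b)" "continuous_on UNIV (\<lambda>(a, b). g a b)"
      "continuous_on UNIV (\<lambda>(a, b). fa a b)" "continuous_on UNIV (\<lambda>(a, b). fb a b)"
      "continuous_on UNIV (\<lambda>(a, b). ga a b)" "continuous_on UNIV (\<lambda>(a, b). gb a b)"
    and per: "\<And>a b. f (a + 1) b = f a b" "\<And>a b. f a (b + 1) = f a b"
      "\<And>a b. g (a + 1) b = g a b" "\<And>a b. g a (b + 1) = g a b"
  shows "integral (cbox (0, 0) (1, 1)) (\<lambda>(a, b). fa a b * gb a b) =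
         integral (cbox (0, 0) (1, 1)) (\<lambda>(a, b). fb a b * ga a b)"
proof -
  have C: "continuous_on S (\<lambda>x. k (u x) (v x))"
    if "continuous_on UNIV (\<lambda>(a, b). k a b)" "continuous_on S u" "continuous_on S v"
    for k :: "real \<Rightarrow> real \<Rightarrow> real" and S :: "'z::topological_space set" and u v
    using continuous_on_compose2[OF that(1) continuous_on_Pair[OF that(2,3)]] by simp
  note C' = cont[THEN C]
  have iter: "integral (cbox (0, 0) (1, 1)) (\<lambda>(a, b). k a b) = integral {0..1} (\<lambda>a. integral {0..1} (k a))"
    and swap: "integral {0..1} (\<lambda>a. integral {0..1} (k a)) = integral {0..1} (\<lambda>b. integral {0..1} (\<lambda>a. k a b))"
    if "continuous_on UNIV (\<lambda>(a, b). k a b)" for k :: "real \<Rightarrow> real \<Rightarrow> real"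
    using integral_prod_continuous[OF continuous_on_subset[OF that], of 0 0 1 1]
      integral_swap_continuous[OF continuous_on_subset[OF that], of 0 0 1 1] by simp_all
  have cont_a: "continuous_on UNIV (\<lambda>(a, b). f (a + h) b * gb a b)"
    and cont_b: "continuous_on UNIV (\<lambda>(a, b). fb (a + h) b * g a b)"
    and cont_c: "continuous_on UNIV (\<lambda>(a, b). fb a b * g (a - h) b)" for h
    unfolding split_beta by (intro continuous_intros C')+
  have fb_per: "fb (a + 1) b = fb a b" for a b
    using DERIV_unique[OF fb[of "a + 1" b]] fb[of a b] per(1) by simp
  define K1 where "K1 h = integral (cbox (0, 0) (1, 1)) (\<lambda>(a, b). f (a + h) b * gb a b)" for h
  define K2 where "K2 h = integral (cbox (0, 0) (1, 1)) (\<lambda>(a, b). fb a b * g (a - h) b)" for h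
  \<comment> \<open>Integration by parts in b for fixed a produces the sign; after exchanging the
    order of integration, the periodic shift in a moves h from \<open>fb\<close> to
    \<open>g\<close>.\<close>
  have eq: "K1 h = - K2 h" for h
  proof -
    have "K1 h = integral {0..1} (\<lambda>a. integral {0..1} (\<lambda>b. f (a + h) b * gb a b))"
      unfolding K1_def by (rule iter[OF cont_a])
    also have "\<dots> = integral {0..1} (\<lambda>a. - integral {0..1} (\<lambda>b. fb (a + h) b * g a b))"
    proof -
      have "integral {0..1} (\<lambda>b. f (a + h) b * gb a b) = - integral {0..1} (\<lambda>b. fb (a + h) b * g a b)" for a
        using per(2)[of "a + h" 0] per(4)[of a 0]
        by (intro integral_periodic_by_parts fb gb C' continuous_intros) auto
      then show ?thesis by simp
    qed
    also have "\<dots> = - integral {0..1} (\<lambda>a. integral {0..1} (\<lambda>b. fb (a + h) b * g a b))"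
      by simp
    also have "integral {0..1} (\<lambda>a. integral {0..1} (\<lambda>b. fb (a + h) b * g a b)) =
        integral {0..1} (\<lambda>b. integral {0..1} (\<lambda>a. fb (a + h) b * g a b))"
      by (rule swap[OF cont_b])
    also have "\<dots> = integral {0..1} (\<lambda>b. integral {0..1} (\<lambda>a. fb a b * g (a - h) b))"
    proof -
      have "integral {0..1} (\<lambda>a. fb (a + h) b * g (a + h - h) b) = integral {0..1} (\<lambda>a. fb a b * g (a - h) b)" for b
      proof (rule integral_periodic_shift[where \<phi> = "\<lambda>a. fb a b * g (a - h) b"])
        show "continuous_on UNIV (\<lambda>a. fb a b * g (a - h) b)"
          by (intro C' continuous_intros)
        show "fb (a + 1) b * g (a + 1 - h) b = fb a b * g (a - h) b" for a
          using per(3)[of "a - h"] fb_per[of a] by (simp add: diff_add_eq[symmetric])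
      qed
      then show ?thesis by simp
    qed
    also have "\<dots> = integral {0..1} (\<lambda>a. integral {0..1} (\<lambda>b. fb a b * g (a - h) b))"
      by (rule swap[OF cont_c, symmetric])
    also have "\<dots> = K2 h"
      unfolding K2_def by (rule iter[OF cont_c, symmetric])
    finally show ?thesis .
  qed
  have K1': "(K1 has_field_derivative
      integral (cbox (0, 0) (1, 1)) (\<lambda>(a, b). fa (a + 0) b * gb a b)) (at 0 within UNIV)"
    unfolding K1_def
  proof (rule leibniz_rule_field_derivative[where fx = "\<lambda>h (a, b). fa (a + h) b * gb a b"])
    fix h and x :: "real \<times> real"
    have "((\<lambda>h. f (fst x + h) (snd x)) has_field_derivative fa (fst x + h) (snd x) * 1) (at h)"
      by (rule DERIV_chain2[OF fa]) (auto intro!: derivative_eq_intros)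
    then show "((\<lambda>h. case x of (a, b) \<Rightarrow> f (a + h) b * gb a b) has_field_derivative
        (case x of (a, b) \<Rightarrow> fa (a + h) b * gb a b)) (at h within UNIV)"
      by (simp add: split_beta DERIV_cmult_right)
    show "(\<lambda>(a, b). f (a + h) b * gb a b) integrable_on cbox (0, 0) (1, 1)"
      by (rule integrable_continuous) (rule continuous_on_subset[OF cont_a], simp)
  qed (auto simp: split_beta intro!: C' continuous_intros)
  have K2': "(K2 has_field_derivative
      integral (cbox (0, 0) (1, 1)) (\<lambda>(a, b). - (fb a b * ga (a - 0) b))) (at 0 within UNIV)"
    unfolding K2_def
  proof (rule leibniz_rule_field_derivative[where fx = "\<lambda>h (a, b). - (fb a b * ga (a - h) b)"])
    fix h and x :: "real \<times> real"
    have "((\<lambda>h. g (fst x - h) (snd x)) has_field_derivative ga (fst x - h) (snd x) * (- 1)) (at h)"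
      by (rule DERIV_chain2[OF ga]) (auto intro!: derivative_eq_intros)
    from DERIV_cmult[OF this, of "fb (fst x) (snd x)"]
    show "((\<lambda>h. case x of (a, b) \<Rightarrow> fb a b * g (a - h) b) has_field_derivative
        (case x of (a, b) \<Rightarrow> - (fb a b * ga (a - h) b))) (at h within UNIV)"
      by (simp add: split_beta)
    show "(\<lambda>(a, b). fb a b * g (a - h) b) integrable_on cbox (0, 0) (1, 1)"
      by (rule integrable_continuous) (rule continuous_on_subset[OF cont_c], simp)
  qed (auto simp: split_beta intro!: C' continuous_intros)
  \<comment> \<open>At h = 0 the derivative of \<open>K1\<close> involves only \<open>fa\<close>,
    that of \<open>K2\<close> only \<open>ga\<close>, so \<open>eq\<close> differentiates to the two
    products to be compared.\<close>
  have "K1 = (\<lambda>h. - K2 h)" using eq by blast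
  from DERIV_unique[OF K1'[unfolded this] DERIV_minus[OF K2']]
  have "integral (cbox (0, 0) (1, 1)) (\<lambda>x. fa (fst x) (snd x) * gb (fst x) (snd x)) =
     - integral (cbox (0, 0) (1, 1)) (\<lambda>x. - (fb (fst x) (snd x) * ga (fst x) (snd x)))"
    by (simp add: case_prod_unfold)
  then show ?thesis by (simp add: case_prod_unfold)
qed

text \<open>A nonnegative Jacobian vanishes since its mean over the torus does.\<close>

lemma periodic_jacobian_zero:
  fixes P Q :: "'a::real_normed_vector \<Rightarrow> real" and u v :: 'a
  assumes P: "\<And>q. (P has_derivative P' q) (at q)" and Q: "\<And>q. (Q has_derivative Q' q) (at q)"
    and contP: "\<And>w. continuous_on UNIV (\<lambda>q. P' q w)" and contQ: "\<And>w. continuous_on UNIV (\<lambda>q. Q' q w)"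
    and perP: "\<And>q. P (q + u) = P q" "\<And>q. P (q + v) = P q"
    and perQ: "\<And>q. Q (q + u) = Q q" "\<And>q. Q (q + v) = Q q"
    and nonneg: "\<And>q. P' q u * Q' q v - P' q v * Q' q u \<ge> 0"
  shows "P' q u * Q' q v - P' q v * Q' q u = 0"
proof -
  \<comment> \<open>The period parallelogram is based at q itself, so the point of interest is the
    corner (0, 0) of the unit square.\<close>
  define \<gamma> where "\<gamma> a b = q + a *\<^sub>R u + b *\<^sub>R v" for a b
  have cP: "continuous_on UNIV P" and cQ: "continuous_on UNIV Q"
    using P Q by (meson continuous_at_imp_continuous_on has_derivative_continuous)+
  have \<gamma>a: "((\<lambda>a. \<gamma> a b) has_derivative (\<lambda>t. t *\<^sub>R u)) (at a)" for a b
    unfolding \<gamma>_def by (auto intro!: derivative_eq_intros)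
  have \<gamma>b: "((\<lambda>b. \<gamma> a b) has_derivative (\<lambda>t. t *\<^sub>R v)) (at b)" for a b
    unfolding \<gamma>_def by (auto intro!: derivative_eq_intros)
  have D: "((\<lambda>t. F (c t)) has_field_derivative F' (c t) w) (at t)"
    if "\<And>q. (F has_derivative F' q) (at q)" "(c has_derivative (\<lambda>t. t *\<^sub>R w)) (at t)"
    for F :: "'a \<Rightarrow> real" and F' c t w
  proof -
    interpret bounded_linear "F' (c t)" using that(1) by (rule has_derivative_bounded_linear)
    show ?thesis
      using has_derivative_compose[OF that(2) that(1)]
      by (simp add: has_field_derivative_def scaleR mult_commute_abs)
  qed
  have \<gamma>_cont: "continuous_on UNIV (\<lambda>(a, b). \<gamma> a b)"
    unfolding \<gamma>_def split_beta by (intro continuous_intros)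
  have C: "continuous_on UNIV (\<lambda>(a, b). F (\<gamma> a b))" if "continuous_on UNIV F" for F :: "'a \<Rightarrow> real"
    using continuous_on_compose2[OF that \<gamma>_cont] by (simp add: split_beta)
  have per: "\<gamma> (a + 1) b = \<gamma> a b + u" "\<gamma> a (b + 1) = \<gamma> a b + v" for a b
    by (auto simp: \<gamma>_def algebra_simps)
  let ?J = "\<lambda>(a, b). P' (\<gamma> a b) u * Q' (\<gamma> a b) v - P' (\<gamma> a b) v * Q' (\<gamma> a b) u"
  have "integral (cbox (0, 0) (1, 1)) (\<lambda>(a, b). P' (\<gamma> a b) u * Q' (\<gamma> a b) v) =
      integral (cbox (0, 0) (1, 1)) (\<lambda>(a, b). P' (\<gamma> a b) v * Q' (\<gamma> a b) u)"
    by (rule integral_periodic_jacobian[where f = "\<lambda>a b. P (\<gamma> a b)" and g = "\<lambda>a b. Q (\<gamma> a b)"])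
       (auto intro!: D P Q \<gamma>a \<gamma>b C cP cQ contP contQ simp: per perP perQ)
  moreover have cJ: "continuous_on S (\<lambda>(a, b). P' (\<gamma> a b) w * Q' (\<gamma> a b) w')" for w w' S
    using continuous_on_mult[OF C[OF contP[of w]] C[OF contQ[of w']]]
    by (auto simp: split_beta intro: continuous_on_subset)
  moreover have "integral (cbox (0, 0) (1, 1)) ?J =
      integral (cbox (0, 0) (1, 1)) (\<lambda>(a, b). P' (\<gamma> a b) u * Q' (\<gamma> a b) v) -
      integral (cbox (0, 0) (1, 1)) (\<lambda>(a, b). P' (\<gamma> a b) v * Q' (\<gamma> a b) u)"
    using Henstock_Kurzweil_Integration.integral_diff[OF integrable_continuous[OF cJ] integrable_continuous[OF cJ]]
    by (simp add: case_prod_unfold)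
  moreover have contJ: "continuous_on S ?J" for S
    using continuous_on_diff[OF cJ[of S u v] cJ[of S v u]] by (simp add: split_beta)
  ultimately have zero: "integral (cbox (0, 0) (1, 1)) ?J = 0" by linarith
  \<comment> \<open>A continuous nonnegative function with zero integral vanishes on the whole
    closed square, hence also at the corner.\<close>
  have "(?J has_integral 0) (cbox (0, 0) (1, 1))"
    using integrable_integral[OF integrable_continuous[OF contJ], of "(0, 0)" "(1, 1)"] unfolding zero .
  moreover have "?J z \<ge> 0" for z using nonneg by (simp add: split_beta)
  moreover have "box (0, 0) (1, 1) \<noteq> ({} :: (real \<times> real) set)"
    by (auto simp: box_ne_empty Basis_prod_def)
  ultimately have "?J (0, 0) = 0"
    by (intro has_integral_0_cbox_imp_0[OF contJ, of "(0, 0)" "(1, 1)" "(0, 0)"])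
       (auto simp: mem_box Basis_prod_def)
  then show ?thesis by (simp add: \<gamma>_def)
qed

section \<open>The cubic of critical points\<close>

text \<open>For \<open>s = x / cnj x\<close>, \<open>(cnj x)\<^sup>3\<close> times \<open>fib_poly\<close> is \<open>A x\<^sup>3 + B x\<^sup>2 (cnj x)\<close> plus its
  conjugate, and \<open>i (cnj x)\<^sup>3\<close> times \<open>crit_poly\<close> is its derivative in the argument of \<open>x\<close>.\<close>

definition crit_poly :: "complex \<Rightarrow> complex \<Rightarrow> complex \<Rightarrow> complex" where
  "crit_poly A B s = 3 * A * s^3 + B * s^2 - cnj B * s - 3 * cnj A"

definition fib_poly :: "complex \<Rightarrow> complex \<Rightarrow> complex \<Rightarrow> complex" where
  "fib_poly A B s = A * s^3 + B * s^2 + cnj B * s + cnj A"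

text \<open>By Vieta the roots of \<open>crit_poly\<close> have product \<open>cnj A / A\<close>;
  dividing by s and by its mirror image \<open>1 / cnj s\<close> leaves this value.\<close>

definition third_root :: "complex \<Rightarrow> complex \<Rightarrow> complex" where
  "third_root A s = cnj A * cnj s / (A * s)"

text \<open>Vieta again: the sum of the roots is -B / (3 A).\<close>

definition coeff_of_root :: "complex \<Rightarrow> complex \<Rightarrow> complex" where
  "coeff_of_root A s = - 3 * A * (s + 1 / cnj s + third_root A s)"

lemma norm_third_root: "A \<noteq> 0 \<Longrightarrow> s \<noteq> 0 \<Longrightarrow> norm (third_root A s) = 1"
  by (simp add: third_root_def norm_divide norm_mult)

text \<open>Conjugating and reversing the coefficients only changes their sign, so reflection in the
  unit circle permutes the nonzero roots.\<close>

lemma crit_poly_reciprocal: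
  assumes "s \<noteq> 0"
  shows "crit_poly A B (1 / cnj s) = - cnj (crit_poly A B s) / cnj s ^ 3"
  using assms unfolding crit_poly_def by (simp add: field_simps power2_eq_square power3_eq_cube)

lemma fib_poly_reciprocal:
  assumes "s \<noteq> 0"
  shows "fib_poly A B (1 / cnj s) = cnj (fib_poly A B s) / cnj s ^ 3"
  using assms unfolding fib_poly_def by (simp add: field_simps power2_eq_square power3_eq_cube)

lemma mult_cnj_ne_1: "norm s \<noteq> 1 \<Longrightarrow> s * cnj s \<noteq> 1"
  by (metis abs_norm_cancel complex_mod_mult_cnj norm_one power2_eq_1_iff abs_1 abs_minus_cancel)

text \<open>The equation and its conjugate are linear in B and \<open>cnj B\<close>. Eliminating
  \<open>cnj B\<close> leaves a factor \<open>s * cnj s - 1\<close>, nonzero off the unit circle, so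
  s determines B.\<close>

lemma coeff_of_root_eq:
  assumes "crit_poly A B s = 0" "A \<noteq> 0" "s \<noteq> 0" "norm s \<noteq> 1"
  shows "B = coeff_of_root A s"
proof -
  define a b t where "a = cnj A" and "b = cnj B" and "t = cnj s"
  have "t \<noteq> 0" using assms by (simp add: t_def)
  have 1: "3 * A * s^3 + B * s^2 - b * s - 3 * a = 0"
    using assms(1) by (simp add: crit_poly_def a_def b_def)
  have 2: "3 * a * t^3 + b * t^2 - B * t - 3 * A = 0"
    using arg_cong[OF assms(1), of cnj] by (simp add: crit_poly_def a_def b_def t_def)
  have "(s * t - 1) * (B * s * t + 3 * A * (s^2 * t + s) + 3 * a * t^2) =
      t^2 * (3 * A * s^3 + B * s^2 - b * s - 3 * a) + s * (3 * a * t^3 + b * t^2 - B * t - 3 * A)"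
    by (simp add: algebra_simps power2_eq_square power3_eq_cube)
  then have "(s * t - 1) * (B * s * t + 3 * A * (s^2 * t + s) + 3 * a * t^2) = 0"
    by (simp only: 1 2) simp
  then have "B * s * t + 3 * A * (s^2 * t + s) + 3 * a * t^2 = 0"
    using mult_cnj_ne_1[OF assms(4)] by (simp add: t_def)
  then have "B * (s * t) = - (3 * A * (s^2 * t + s) + 3 * a * t^2)"
    by algebra
  then have "B = - (3 * A * (s^2 * t + s) + 3 * a * t^2) / (s * t)"
    using \<open>t \<noteq> 0\<close> \<open>s \<noteq> 0\<close> by (simp add: field_simps)
  also have "\<dots> = coeff_of_root A s"
    using \<open>t \<noteq> 0\<close> \<open>s \<noteq> 0\<close> \<open>A \<noteq> 0\<close>
    unfolding coeff_of_root_def third_root_def a_def[symmetric] t_def[symmetric]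
    by (simp add: field_simps power2_eq_square)
  finally show ?thesis .
qed

lemma crit_poly_factor:
  assumes "A \<noteq> 0" "s \<noteq> 0"
  shows "crit_poly A (coeff_of_root A s) x = 3 * A * (x - s) * (x - 1 / cnj s) * (x - third_root A s)"
proof -
  define a t where "a = cnj A" and "t = cnj s"
  have nz: "t \<noteq> 0" "a \<noteq> 0" using assms by (auto simp: t_def a_def)
  have B: "coeff_of_root A s = - 3 * A * (s + 1 / t + a * t / (A * s))"
    by (simp add: coeff_of_root_def third_root_def a_def t_def)
  have b: "cnj (coeff_of_root A s) = - 3 * a * (t + 1 / s + A * s / (a * t))"
    by (simp add: coeff_of_root_def third_root_def a_def t_def)
  show ?thesis
    unfolding crit_poly_def b unfolding B third_root_def a_def[symmetric] t_def[symmetric]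
    using nz assms by (simp add: field_simps power2_eq_square power3_eq_cube)
qed

text \<open>Of the other two roots one has norm below 1 and one has norm 1.\<close>

lemma crit_poly_root_unique:
  assumes "A \<noteq> 0" "norm s > 1" "norm s' > 1" "crit_poly A B s = 0" "crit_poly A B s' = 0"
  shows "s' = s"
proof -
  have nz: "s \<noteq> 0" "s' \<noteq> 0" using assms by auto
  have "B = coeff_of_root A s" using coeff_of_root_eq assms nz by auto
  with assms have "3 * A * (s' - s) * (s' - 1 / cnj s) * (s' - third_root A s) = 0"
    using crit_poly_factor[OF assms(1) nz(1)] by metis
  moreover have "norm (1 / cnj s) < 1" using assms nz by (simp add: norm_divide divide_less_eq)
  then have "s' \<noteq> 1 / cnj s" using assms by auto
  moreover have "s' \<noteq> third_root A s" using norm_third_root[OF assms(1) nz(1)] assms by auto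
  ultimately show ?thesis using assms by simp
qed

lemma crit_poly_coeff_of_root [simp]:
  "A \<noteq> 0 \<Longrightarrow> s \<noteq> 0 \<Longrightarrow> crit_poly A (coeff_of_root A s) s = 0"
  by (simp add: crit_poly_factor)

lemma crit_poly_other_roots:
  assumes "crit_poly A B s = 0" "A \<noteq> 0" "norm s > 1"
  shows "crit_poly A B (1 / cnj s) = 0" "crit_poly A B (third_root A s) = 0"
    "s \<noteq> 1 / cnj s" "s \<noteq> third_root A s" "1 / cnj s \<noteq> third_root A s"
proof -
  have nz: "s \<noteq> 0" "norm s \<noteq> 1" using assms by auto
  have B: "B = coeff_of_root A s" using coeff_of_root_eq assms(1,2) nz by auto
  show "crit_poly A B (1 / cnj s) = 0" "crit_poly A B (third_root A s) = 0"
    using crit_poly_factor[OF assms(2) nz(1)] B by auto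
  have n: "norm (1 / cnj s) < 1" "norm (third_root A s) = 1"
    using assms nz by (auto simp: norm_divide norm_third_root)
  show "s \<noteq> 1 / cnj s" "s \<noteq> third_root A s" "1 / cnj s \<noteq> third_root A s"
    using n assms(3) by auto
qed

text \<open>Keeps the outer roots in a compact set while B stays bounded, so that they have limits
  at the boundary of the elliptic set.\<close>

lemma norm_crit_root_bound:
  assumes "crit_poly A B s = 0" "A \<noteq> 0" "norm s > 1"
  shows "norm s \<le> (2 * norm B + 3 * norm A) / (3 * norm A)"
proof -
  have "3 * A * s^3 = cnj B * s - B * s^2 + 3 * cnj A"
    using assms(1) unfolding crit_poly_def by algebra
  then have "norm (3 * A * s^3) \<le> norm B * norm s + norm B * norm s^2 + 3 * norm A"
    using norm_triangle_ineq[of "cnj B * s - B * s^2" "3 * cnj A"]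
      norm_triangle_ineq4[of "cnj B * s" "B * s^2"]
    by (simp add: norm_mult norm_power)
  moreover have "norm s \<le> norm s ^ 2" "1 \<le> norm s ^ 2"
    using assms(3) power_increasing[of 1 2 "norm s"] by (auto simp: one_le_power)
  ultimately have "3 * norm A * norm s * norm s^2 \<le> (2 * norm B + 3 * norm A) * norm s^2"
    using mult_left_mono[of "norm s" "norm s^2" "norm B"] mult_left_mono[of 1 "norm s^2" "3 * norm A"]
    by (simp add: norm_mult norm_power power3_eq_cube power2_eq_square algebra_simps)
  then have "3 * norm A * norm s \<le> 2 * norm B + 3 * norm A"
    by (rule mult_right_le_imp_le) (use assms(3) in \<open>auto intro: zero_less_power\<close>)
  then show ?thesis using assms(2) by (simp add: field_simps)
qed

text \<open>Since \<open>crit_poly\<close> is 2 s times the derivative of \<open>fib_poly\<close>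
  minus 3 times \<open>fib_poly\<close>, a common zero would be a double zero of the cubic
  \<open>fib_poly\<close>, and so would its mirror image: too many zeros.\<close>

lemma fib_poly_ne_0_at_root:
  assumes "crit_poly A B s = 0" "A \<noteq> 0" "norm s > 1"
  shows "fib_poly A B s \<noteq> 0"
proof
  assume h: "fib_poly A B s = 0"
  define a b t where "a = cnj A" and "b = cnj B" and "t = cnj s"
  have nz: "s \<noteq> 0" "t \<noteq> 0" using assms by (auto simp: t_def)
  have k1: "3 * A * s^3 + B * s^2 - b * s - 3 * a = 0" and h1: "A * s^3 + B * s^2 + b * s + a = 0"
    using assms(1) h by (auto simp: crit_poly_def fib_poly_def a_def b_def)
  have k2: "3 * a * t^3 + b * t^2 - B * t - 3 * A = 0" and h2: "a * t^3 + b * t^2 + B * t + A = 0"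
    using arg_cong[OF assms(1), of cnj] arg_cong[OF h, of cnj]
    by (auto simp: crit_poly_def fib_poly_def a_def b_def t_def)
  \<comment> \<open>\<open>B\<close> and \<open>cnj B\<close> are solved for separately and
    eliminated; taking norms in what remains ends in \<open>(norm s - 1)^2 = 0\<close>.\<close>
  have B: "B * s^2 = a - 2 * A * s^3" using k1 h1 by algebra
  have b: "B * t = a * t^3 - 2 * A" using k2 h2 by algebra
  have "(a - 2 * A * s^3) * t = (a * t^3 - 2 * A) * s^2" using B b by algebra
  then have "(s * t - 1) * (2 * A * s^2 + a * t * (s * t + 1)) = 0"
    by (simp add: algebra_simps power2_eq_square power3_eq_cube)
  then have "2 * A * s^2 = - (a * t * (s * t + 1))"
    using mult_cnj_ne_1[of s] assms(3) by (auto simp: t_def eq_neg_iff_add_eq_0)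
  then have "norm (2 * A * s^2) = norm (a * t * (s * t + 1))" by simp
  then have "2 * norm A * norm s * norm s = norm A * norm s * norm (s * t + 1)"
    by (simp add: norm_mult norm_power a_def t_def power2_eq_square)
  then have "2 * norm s = norm (s * t + 1)" using assms nz by simp
  also have "s * t + 1 = of_real ((norm s)\<^sup>2 + 1)"
    using complex_norm_square[of s] by (simp add: t_def)
  also have "norm \<dots> = (norm s)\<^sup>2 + 1" by (simp only: norm_of_real) simp
  finally have "(norm s - 1)\<^sup>2 = 0" by (simp add: power2_eq_square algebra_simps)
  then show False using assms(3) by simp
qed

text \<open>On the unit circle \<open>1 / cnj s = s\<close>, so \<open>fib_poly_reciprocal\<close>
  reads h = cnj h * s^3 for the value h, and h^2 / s^3 = h * cnj h.\<close>

lemma critical_value_real: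
  assumes "norm s = 1"
  shows "Im ((fib_poly A B s)\<^sup>2 / s^3) = 0"
proof -
  have nz: "s \<noteq> 0" using assms by auto
  have inv: "1 / cnj s = s" using assms nz
    by (metis complex_div_cnj mult_1 of_real_1 one_power2 div_by_1 complex_cnj_divide complex_cnj_one complex_cnj_cnj divide_divide_eq_right)
  have c: "cnj s = 1 / s" using inv nz by (metis divide_divide_eq_right mult_1 div_by_1 complex_cnj_cnj complex_cnj_divide complex_cnj_one)
  have "fib_poly A B s = cnj (fib_poly A B s) * s ^ 3"
    using fib_poly_reciprocal[OF nz, of A B] unfolding inv c by (simp add: power_divide)
  then have "(fib_poly A B s)\<^sup>2 / s^3 = fib_poly A B s * cnj (fib_poly A B s)"
    using nz by (metis nonzero_mult_div_cancel_right power2_eq_square power_not_zero times_divide_eq_right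
        mult.assoc)
  then show ?thesis by (simp add: complex_mult_cnj)
qed

lemma quadratic_three_roots:
  fixes c2 c1 c0 :: complex
  assumes "c2 * x^2 + c1 * x + c0 = 0" "c2 * y^2 + c1 * y + c0 = 0" "c2 * z^2 + c1 * z + c0 = 0"
    and "x \<noteq> y" "x \<noteq> z" "y \<noteq> z"
  shows "c2 = 0" "c1 = 0" "c0 = 0"
proof -
  have "(x - y) * (c2 * (x + y) + c1) = 0" "(x - z) * (c2 * (x + z) + c1) = 0"
    using assms(1-3) by algebra+
  then have 1: "c2 * (x + y) + c1 = 0" and 2: "c2 * (x + z) + c1 = 0" using assms by auto
  then have "c2 * (y - z) = 0" by algebra
  then show "c2 = 0" using assms by auto
  then show "c1 = 0" using 1 by simp
  then show "c0 = 0" using assms(1) \<open>c2 = 0\<close> by simp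
qed

section \<open>The outer root as a function of the coefficient B\<close>

definition elliptic_coeffs :: "complex \<Rightarrow> complex set" where
  "elliptic_coeffs A = coeff_of_root A ` {s. norm s > 1}"

definition outer_root :: "complex \<Rightarrow> complex \<Rightarrow> complex" where
  "outer_root A B = (THE s. norm s > 1 \<and> crit_poly A B s = 0)"

lemma mem_elliptic_coeffs_iff:
  assumes "A \<noteq> 0"
  shows "B \<in> elliptic_coeffs A \<longleftrightarrow> (\<exists>s. norm s > 1 \<and> crit_poly A B s = 0)"
proof
  assume "B \<in> elliptic_coeffs A"
  then obtain s where "norm s > 1" "B = coeff_of_root A s" by (auto simp: elliptic_coeffs_def)
  then show "\<exists>s. norm s > 1 \<and> crit_poly A B s = 0"
    using assms by (intro exI[of _ s]) (auto intro!: crit_poly_coeff_of_root)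
next
  assume "\<exists>s. norm s > 1 \<and> crit_poly A B s = 0"
  then obtain s where s: "norm s > 1" "crit_poly A B s = 0" by blast
  then have "B = coeff_of_root A s" by (intro coeff_of_root_eq assms) auto
  then show "B \<in> elliptic_coeffs A" using s by (auto simp: elliptic_coeffs_def)
qed

lemma outer_root:
  assumes "A \<noteq> 0" "B \<in> elliptic_coeffs A"
  shows "norm (outer_root A B) > 1" "crit_poly A B (outer_root A B) = 0"
proof -
  have "\<exists>!s. norm s > 1 \<and> crit_poly A B s = 0"
    using assms(2) crit_poly_root_unique[OF assms(1)]
    unfolding mem_elliptic_coeffs_iff[OF assms(1)] by blast
  from theI'[OF this] show "norm (outer_root A B) > 1" "crit_poly A B (outer_root A B) = 0"
    by (auto simp: outer_root_def)
qed

lemma outer_root_ne_0: "A \<noteq> 0 \<Longrightarrow> B \<in> elliptic_coeffs A \<Longrightarrow> outer_root A B \<noteq> 0"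
  using outer_root(1)[of A B] by auto

lemma coeff_of_outer_root:
  "A \<noteq> 0 \<Longrightarrow> B \<in> elliptic_coeffs A \<Longrightarrow> coeff_of_root A (outer_root A B) = B"
  using coeff_of_root_eq[of A B "outer_root A B"] outer_root[of A B] outer_root_ne_0[of A B] by auto

lemma outer_root_coeff:
  assumes "A \<noteq> 0" "norm s > 1"
  shows "outer_root A (coeff_of_root A s) = s"
proof -
  have "coeff_of_root A s \<in> elliptic_coeffs A" using assms by (auto simp: elliptic_coeffs_def)
  moreover have "s \<noteq> 0" using assms by auto
  ultimately show ?thesis
    using outer_root[OF assms(1)] assms
    by (intro crit_poly_root_unique[OF assms(1,2)]) (auto intro: crit_poly_coeff_of_root)
qed

lemma open_norm_greater: "open {s :: complex. norm s > r}"
  by (intro open_Collect_less continuous_intros)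

lemma continuous_on_coeff_of_root:
  "A \<noteq> 0 \<Longrightarrow> continuous_on {s. norm s > 1} (coeff_of_root A)"
  unfolding coeff_of_root_def third_root_def
  by (intro continuous_intros) auto

text \<open>The set is the image of an open set under a continuous injection with left inverse
  \<open>outer_root\<close>; invariance of domain applies.\<close>

lemma open_elliptic_coeffs: "A \<noteq> 0 \<Longrightarrow> open (elliptic_coeffs A)"
  unfolding elliptic_coeffs_def
  by (rule invariance_of_domain_gen)
     (auto intro!: continuous_on_coeff_of_root open_norm_greater inj_on_inverseI[where g = "outer_root A"]
        simp: outer_root_coeff)

lemma continuous_on_outer_root: "A \<noteq> 0 \<Longrightarrow> continuous_on (elliptic_coeffs A) (outer_root A)"
  unfolding elliptic_coeffs_def
  by (rule continuous_on_inverse_open)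
     (auto intro!: continuous_on_coeff_of_root open_norm_greater simp: outer_root_coeff)

text \<open>Implicit differentiation of \<open>crit_poly A B s = 0\<close>: the numerator is minus
  the variation of the coefficients, the denominator the derivative of the cubic at s, expressed
  through its roots.\<close>

definition outer_root_deriv :: "complex \<Rightarrow> complex \<Rightarrow> complex \<Rightarrow> complex" where
  "outer_root_deriv A s \<delta> = - (s\<^sup>2 * \<delta> - s * cnj \<delta>) / (3 * A * (s - 1 / cnj s) * (s - third_root A s))"

lemma outer_root_has_derivative:
  assumes "A \<noteq> 0" "B \<in> elliptic_coeffs A"
  shows "(outer_root A has_derivative outer_root_deriv A (outer_root A B)) (at B)"
proof -
  define s where "s = outer_root A B"
  define f' where "f' \<delta> = - 3 * A * (\<delta> - cnj \<delta> / (cnj s)^2 + (cnj A * cnj \<delta> / (A * s) - cnj A * cnj s * \<delta> / (A * s^2)))" for \<delta>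
  have s: "s \<noteq> 0" "norm s > 1" "crit_poly A B s = 0"
    using outer_root[OF assms] outer_root_ne_0[OF assms] by (auto simp: s_def)
  show ?thesis
  proof (rule has_derivative_inverse_basic)
    show "(coeff_of_root A has_derivative f') (at (outer_root A B))"
      unfolding s_def[symmetric] coeff_of_root_def third_root_def f'_def
      using s assms(1)
      by (auto intro!: derivative_eq_intros bounded_linear.has_derivative[OF bounded_linear_cnj] ext
          simp: field_simps power2_eq_square)
    show "bounded_linear (outer_root_deriv A (outer_root A B))"
      unfolding outer_root_deriv_def divide_inverse
      by (intro bounded_linear_mult_const bounded_linear_const_mult bounded_linear_minus
          bounded_linear_sub bounded_linear_cnj bounded_linear_ident)
    show "outer_root_deriv A (outer_root A B) \<circ> f' = id"
    proof
      fix \<delta>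
      define a t d where "a = cnj A" and "t = cnj s" and "d = cnj \<delta>"
      have nz: "t \<noteq> 0" "a \<noteq> 0" "s \<noteq> 0" "A \<noteq> 0" using s assms by (auto simp: t_def a_def)
      have f: "f' \<delta> = - 3 * A * (\<delta> - d / t^2 + (a * d / (A * s) - a * t * \<delta> / (A * s^2)))"
        by (simp add: f'_def a_def t_def d_def)
      have cf: "cnj (f' \<delta>) = - 3 * a * (d - \<delta> / s^2 + (A * \<delta> / (a * t) - A * s * d / (a * t^2)))"
        by (simp add: f'_def a_def t_def d_def)
      have "s - 1 / cnj s \<noteq> 0" "s - third_root A s \<noteq> 0"
        using crit_poly_other_roots[OF s(3) assms(1) s(2)] by auto
      moreover have "- (s\<^sup>2 * f' \<delta> - s * cnj (f' \<delta>)) = \<delta> * (3 * A * (s - 1 / cnj s) * (s - third_root A s))"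
        unfolding cf unfolding f third_root_def a_def[symmetric] t_def[symmetric]
        using nz by (simp add: field_simps power2_eq_square power3_eq_cube)
      ultimately show "(outer_root_deriv A (outer_root A B) \<circ> f') \<delta> = id \<delta>"
        using assms(1) by (simp add: outer_root_deriv_def s_def)
    qed
    show "continuous (at B) (outer_root A)"
      using continuous_on_outer_root[OF assms(1)] open_elliptic_coeffs[OF assms(1)] assms(2)
      by (simp add: continuous_on_eq_continuous_at)
    show "open (elliptic_coeffs A)" "B \<in> elliptic_coeffs A"
      using assms open_elliptic_coeffs by auto
    show "coeff_of_root A (outer_root A z) = z" if "z \<in> elliptic_coeffs A" for z
      using coeff_of_outer_root[OF assms(1) that] .
  qed
qed

section \<open>The critical value in the elliptic set\<close>

definition vec_complex :: "real^2 \<Rightarrow> complex" where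
  "vec_complex w = Complex (w $ 1) (w $ 2)"

definition dz :: "(real^2 \<Rightarrow> complex) \<Rightarrow> complex" where
  "dz D = (D (axis 1 1) - \<i> * D (axis 2 1)) / 2"

definition dzbar :: "(real^2 \<Rightarrow> complex) \<Rightarrow> complex" where
  "dzbar D = (D (axis 1 1) + \<i> * D (axis 2 1)) / 2"

lemma vec2_expand: "(w :: real^2) = (w $ 1) *\<^sub>R axis 1 1 + (w $ 2) *\<^sub>R axis 2 1"
  by (simp add: vec_eq_iff forall_2 axis_def)

lemma linear_wirtinger:
  assumes "linear D"
  shows "D w = vec_complex w * dz D + cnj (vec_complex w) * dzbar D"
proof -
  have "D w = (w $ 1) *\<^sub>R D (axis 1 1) + (w $ 2) *\<^sub>R D (axis 2 1)"
    by (subst vec2_expand[of w]) (simp only: linear_add[OF assms] linear_cmul[OF assms])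
  then show ?thesis
    by (simp add: vec_complex_def dz_def dzbar_def complex_eq_iff field_simps)
qed

lemma linear_eq_0_iff_wirtinger:
  assumes "linear D"
  shows "D = (\<lambda>w. 0) \<longleftrightarrow> dz D = 0 \<and> dzbar D = 0"
proof
  show "dz D = 0 \<and> dzbar D = 0" if "D = (\<lambda>w. 0)"
    using that by (simp add: dz_def dzbar_def)
  show "D = (\<lambda>w. 0)" if "dz D = 0 \<and> dzbar D = 0"
    using that linear_wirtinger[OF assms] by auto
qed

text \<open>Reads the sign of a Jacobian off a comparison of the two Wirtinger coefficients; the
  first factor is the oriented area spanned by u and v.\<close>

lemma linear_jacobian:
  assumes "linear D"
  shows "Re (D u) * Im (D v) - Re (D v) * Im (D u) =
    (u $ 1 * v $ 2 - u $ 2 * v $ 1) * ((norm (dz D))\<^sup>2 - (norm (dzbar D))\<^sup>2)"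
proof -
  obtain a b c d where ax: "D (axis 1 1) = Complex a b" "D (axis 2 1) = Complex c d"
    by (metis complex.exhaust)
  have D: "D w = (w $ 1) *\<^sub>R Complex a b + (w $ 2) *\<^sub>R Complex c d" for w
    unfolding ax[symmetric]
    by (subst vec2_expand[of w]) (simp only: linear_add[OF assms] linear_cmul[OF assms])
  show ?thesis
    unfolding dz_def dzbar_def ax unfolding D
    by (simp add: norm_divide power_divide cmod_power2) (simp add: power2_eq_square field_simps)
qed

text \<open>The setting once \<open>A\<close> is known to be a nonzero constant. With x = p1 - i p2,
  \<open>pde1\<close> and \<open>pde2\<close> are, up to factors, the coefficients of x^3 (cnj x)
  and x^2 (cnj x)^2 in the Poisson bracket. The orientation in \<open>basis\<close> fixes the sign
  of the Jacobians.\<close>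

locale cubic_pde =
  fixes \<Lambda> :: "real^2 \<Rightarrow> real" and \<Lambda>' :: "real^2 \<Rightarrow> real^2 \<Rightarrow> real"
    and A :: complex and B :: "real^2 \<Rightarrow> complex" and B' :: "real^2 \<Rightarrow> real^2 \<Rightarrow> complex"
    and u v :: "real^2"
  assumes \<Lambda>_deriv: "\<And>q. (\<Lambda> has_derivative \<Lambda>' q) (at q)"
    and \<Lambda>'_cont: "\<And>w. continuous_on UNIV (\<lambda>q. \<Lambda>' q w)"
    and \<Lambda>_pos: "\<And>q. \<Lambda> q > 0"
    and \<Lambda>_per: "\<And>q. \<Lambda> (q + u) = \<Lambda> q" "\<And>q. \<Lambda> (q + v) = \<Lambda> q"
    and B_deriv: "\<And>q. (B has_derivative B' q) (at q)"
    and B'_cont: "\<And>w. continuous_on UNIV (\<lambda>q. B' q w)"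
    and B_per: "\<And>q. B (q + u) = B q" "\<And>q. B (q + v) = B q"
    and A_ne_0: "A \<noteq> 0"
    and basis: "u $ 1 * v $ 2 - u $ 2 * v $ 1 > 0"
    and pde1: "\<And>q. dzbar (B' q) * \<Lambda> q + B q * dzbar (\<lambda>w. \<Lambda>' q w) + 3 * A * dz (\<lambda>w. \<Lambda>' q w) = 0"
    and pde2: "\<And>q. Re (\<Lambda> q * dz (B' q) + 2 * B q * dz (\<lambda>w. \<Lambda>' q w)) = 0"
begin

lemma linear_B': "linear (B' q)" and linear_\<Lambda>': "linear (\<Lambda>' q)"
  by (rule has_derivative_linear[OF B_deriv]) (rule has_derivative_linear[OF \<Lambda>_deriv])

lemma cont_\<Lambda>: "continuous_on S \<Lambda>" and cont_B: "continuous_on S B"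
  by (auto intro!: continuous_at_imp_continuous_on has_derivative_continuous \<Lambda>_deriv B_deriv)

text \<open>Up to the factor 2 / sqrt \<Lambda> this is the derivative along w, at fixed s, of
  \<Lambda>^(3/2) times \<open>fib_poly A (B q) s\<close>, which represents the integral on a level
  of H.\<close>

definition fib_deriv :: "real^2 \<Rightarrow> complex \<Rightarrow> real^2 \<Rightarrow> complex" where
  "fib_deriv q s w = 3 * \<Lambda>' q w * fib_poly A (B q) s + 2 * \<Lambda> q * (B' q w * s\<^sup>2 + cnj (B' q w) * s)"

lemma linear_fib_deriv: "linear (fib_deriv q s)"
proof (rule linearI)
  show "fib_deriv q s (x + y) = fib_deriv q s x + fib_deriv q s y" for x y
    by (simp add: fib_deriv_def linear_add[OF linear_B'] linear_add[OF linear_\<Lambda>'] algebra_simps)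
  show "fib_deriv q s (r *\<^sub>R x) = r *\<^sub>R fib_deriv q s x" for r x
    unfolding fib_deriv_def linear_cmul[OF linear_B'] linear_cmul[OF linear_\<Lambda>']
    by (simp add: algebra_simps scaleR_conv_of_real)
qed

text \<open>Vanishing of the Poisson bracket at a complex momentum where the fibre derivative of the
  integral vanishes.\<close>

lemma fib_deriv_beltrami:
  assumes "crit_poly A (B q) s = 0"
  shows "dz (fib_deriv q s) + s * dzbar (fib_deriv q s) = 0"
proof -
  define l lz lb bz bb b a where "l = complex_of_real (\<Lambda> q)" and "lz = dz (\<lambda>w. \<Lambda>' q w)"
    and "lb = dzbar (\<lambda>w. \<Lambda>' q w)" and "bz = dz (B' q)" and "bb = dzbar (B' q)" and "b = cnj (B q)" and "a = cnj A"
  have lb: "cnj lb = lz" "cnj lz = lb" by (auto simp: lb_def lz_def dz_def dzbar_def)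
  have D1: "dz (fib_deriv q s) = 3 * lz * fib_poly A (B q) s + 2 * l * (bz * s\<^sup>2 + cnj bb * s)"
    by (simp add: fib_deriv_def dz_def l_def lz_def bz_def bb_def dzbar_def field_simps)
  have D2: "dzbar (fib_deriv q s) = 3 * lb * fib_poly A (B q) s + 2 * l * (bb * s\<^sup>2 + cnj bz * s)"
    by (simp add: fib_deriv_def dz_def l_def lb_def bz_def bb_def dzbar_def field_simps)
  have p1: "bb * l + B q * lb + 3 * A * lz = 0"
    using pde1[of q] by (simp add: l_def lz_def lb_def bb_def)
  have p3: "cnj bb * l + b * lz + 3 * a * lb = 0"
    using arg_cong[OF p1, of cnj] by (simp add: lb b_def a_def l_def)
  have "(l * bz + 2 * B q * lz) + cnj (l * bz + 2 * B q * lz) = 0"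
    using pde2[of q] unfolding complex_add_cnj l_def bz_def lz_def by simp
  then have p2: "l * (bz + cnj bz) + 2 * B q * lz + 2 * b * lb = 0"
    by (simp add: lb b_def l_def algebra_simps)
  have k: "3 * A * s^3 + B q * s^2 - b * s - 3 * a = 0"
    using assms by (simp add: crit_poly_def b_def a_def)
  \<comment> \<open>The equations and their conjugates enter with weights s^3, s^2 and s; the
    remainder is a multiple of the cubic and vanishes because s is critical.\<close>
  have "dz (fib_deriv q s) + s * dzbar (fib_deriv q s) =
    2 * s^3 * (bb * l + B q * lb + 3 * A * lz) + 2 * s^2 * (l * (bz + cnj bz) + 2 * B q * lz + 2 * b * lb)
    + 2 * s * (cnj bb * l + b * lz + 3 * a * lb)
    + (s * lb - lz) * (3 * A * s^3 + B q * s^2 - b * s - 3 * a)"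
    unfolding D1 D2 fib_poly_def a_def[symmetric] b_def[symmetric]
    by (simp add: algebra_simps power2_eq_square power3_eq_cube)
  then show ?thesis by (simp only: p1 p2 p3 k) simp
qed

definition ell :: "(real^2) set" where "ell = {q. B q \<in> elliptic_coeffs A}"

definition elliptic_root :: "real^2 \<Rightarrow> complex" where "elliptic_root q = outer_root A (B q)"

lemma elliptic_root: "q \<in> ell \<Longrightarrow> norm (elliptic_root q) > 1" "q \<in> ell \<Longrightarrow> crit_poly A (B q) (elliptic_root q) = 0"
  "q \<in> ell \<Longrightarrow> elliptic_root q \<noteq> 0"
  using outer_root[OF A_ne_0] outer_root_ne_0[OF A_ne_0] by (auto simp: ell_def elliptic_root_def)

lemma open_ell: "open ell"
  unfolding ell_def using open_vimage[OF open_elliptic_coeffs[OF A_ne_0] cont_B] by (simp add: vimage_def)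

lemma cont_elliptic_root: "continuous_on ell elliptic_root"
  unfolding elliptic_root_def
  by (rule continuous_on_compose2[OF continuous_on_outer_root[OF A_ne_0] cont_B]) (auto simp: ell_def)

definition elliptic_root_deriv :: "real^2 \<Rightarrow> real^2 \<Rightarrow> complex" where
  "elliptic_root_deriv q w = outer_root_deriv A (elliptic_root q) (B' q w)"

lemma elliptic_root_deriv: "q \<in> ell \<Longrightarrow> (elliptic_root has_derivative elliptic_root_deriv q) (at q)"
  using has_derivative_compose[OF B_deriv outer_root_has_derivative[OF A_ne_0]]
  by (simp add: ell_def elliptic_root_def[abs_def] elliptic_root_deriv_def[abs_def])

text \<open>The critical value itself is only defined up to sign, hence the square.\<close>

definition crit_value :: "real^2 \<Rightarrow> complex" where
  "crit_value q = \<Lambda> q ^ 3 * (fib_poly A (B q) (elliptic_root q))\<^sup>2 / elliptic_root q ^ 3"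

definition crit_value_deriv :: "real^2 \<Rightarrow> real^2 \<Rightarrow> complex" where
  "crit_value_deriv q w = (\<Lambda> q)\<^sup>2 * fib_poly A (B q) (elliptic_root q) / elliptic_root q ^ 3 * fib_deriv q (elliptic_root q) w"

text \<open>Envelope principle: the value is stationary in s at a critical root, so the derivative
  of \<open>elliptic_root\<close> drops out and only the dependence at fixed s remains.\<close>

lemma crit_value_deriv:
  assumes "q \<in> ell"
  shows "(crit_value has_derivative crit_value_deriv q) (at q)"
proof -
  define s h where "s = elliptic_root q" and "h = fib_poly A (B q) s"
  have nz: "s \<noteq> 0" using elliptic_root[OF assms] by (simp add: s_def)
  have k: "crit_poly A (B q) s = 0" using elliptic_root[OF assms] by (simp add: s_def)
  define h' where "h' w = A * (3 * s\<^sup>2 * elliptic_root_deriv q w) + (B' q w * s\<^sup>2 + B q * (2 * s * elliptic_root_deriv q w))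
    + (cnj (B' q w) * s + cnj (B q) * elliptic_root_deriv q w)" for w
  note [derivative_intros] = elliptic_root_deriv[OF assms] B_deriv \<Lambda>_deriv
    bounded_linear.has_derivative[OF bounded_linear_cnj] bounded_linear.has_derivative[OF bounded_linear_of_real]
  have h: "((\<lambda>q. fib_poly A (B q) (elliptic_root q)) has_derivative h') (at q)"
    unfolding fib_poly_def h'_def
    by (auto intro!: derivative_eq_intros ext simp: s_def algebra_simps)
  have N: "((\<lambda>q. of_real (\<Lambda> q)^3 * (fib_poly A (B q) (elliptic_root q))\<^sup>2) has_derivative
      (\<lambda>w. of_real (\<Lambda> q)^3 * (2 * h * h' w) + 3 * of_real (\<Lambda> q)^2 * of_real (\<Lambda>' q w) * h^2)) (at q)"
    by (auto intro!: derivative_eq_intros h ext simp: s_def[symmetric] h_def[symmetric] algebra_simps)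
  have M: "((\<lambda>q. elliptic_root q ^ 3) has_derivative (\<lambda>w. 3 * s^2 * elliptic_root_deriv q w)) (at q)"
    by (auto intro!: derivative_eq_intros ext simp: s_def)
  have "elliptic_root q ^ 3 \<noteq> 0" using nz by (simp add: s_def)
  note has_derivative_divide'[OF N M this]
  then have "(crit_value has_derivative (\<lambda>w. ((of_real (\<Lambda> q)^3 * (2 * h * h' w) +
      3 * of_real (\<Lambda> q)^2 * of_real (\<Lambda>' q w) * h^2) * s^3
      - of_real (\<Lambda> q)^3 * h^2 * (3 * s^2 * elliptic_root_deriv q w)) / (s^3 * s^3))) (at q)"
    by (simp only: crit_value_def[abs_def] s_def h_def of_real_power)
  moreover have "((of_real (\<Lambda> q)^3 * (2 * h * h' w) + 3 * of_real (\<Lambda> q)^2 * of_real (\<Lambda>' q w) * h^2) * s^3 - of_real (\<Lambda> q)^3 * h^2 * (3 * s^2 * elliptic_root_deriv q w)) / (s^3 * s^3)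
    = crit_value_deriv q w" for w
  proof -
    \<comment> \<open>The terms with \<open>elliptic_root_deriv\<close> collect to a multiple of
      \<open>crit_poly\<close>, which is zero here.\<close>
    have "2 * h' w * s - 3 * h * elliptic_root_deriv q w =
        2 * (B' q w * s\<^sup>2 + cnj (B' q w) * s) * s + elliptic_root_deriv q w * crit_poly A (B q) s"
      by (simp add: h'_def h_def fib_poly_def crit_poly_def algebra_simps power2_eq_square power3_eq_cube)
    then have e: "2 * h' w * s = 3 * h * elliptic_root_deriv q w + 2 * (B' q w * s\<^sup>2 + cnj (B' q w) * s) * s"
      using k by (simp add: algebra_simps)
    have "(of_real (\<Lambda> q)^3 * (2 * h * h' w) + 3 * of_real (\<Lambda> q)^2 * of_real (\<Lambda>' q w) * h^2) * s^3 - of_real (\<Lambda> q)^3 * h^2 * (3 * s^2 * elliptic_root_deriv q w) =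
      s^2 * (3 * of_real (\<Lambda> q)^2 * of_real (\<Lambda>' q w) * h^2 * s
      + of_real (\<Lambda> q)^3 * h * (2 * h' w * s) - of_real (\<Lambda> q)^3 * h^2 * 3 * elliptic_root_deriv q w)"
      by (simp add: algebra_simps power2_eq_square power3_eq_cube)
    also have "\<dots> = s^3 * (of_real (\<Lambda> q)^2 * h * fib_deriv q s w)"
      unfolding e fib_deriv_def h_def[symmetric]
      by (simp add: algebra_simps power2_eq_square power3_eq_cube)
    finally show ?thesis
      using nz by (simp add: crit_value_deriv_def s_def[symmetric] h_def[symmetric] divide_simps
          flip: power_add)
  qed
  ultimately show ?thesis by simp
qed

lemma crit_value_deriv_eq_0_iff:
  assumes "q \<in> ell"
  shows "crit_value_deriv q w = 0 \<longleftrightarrow> fib_deriv q (elliptic_root q) w = 0"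
proof -
  have "fib_poly A (B q) (elliptic_root q) \<noteq> 0"
    using elliptic_root[OF assms] fib_poly_ne_0_at_root[OF _ A_ne_0] by blast
  then show ?thesis
    using elliptic_root(3)[OF assms] \<Lambda>_pos[of q] by (simp add: crit_value_deriv_def)
qed

text \<open>\<open>crit_value_deriv\<close> is a complex scalar times \<open>fib_deriv\<close>, and
  the Wirtinger coefficients are complex linear, so the relation is inherited.\<close>

lemma crit_value_beltrami:
  assumes "q \<in> ell"
  shows "dz (crit_value_deriv q) = - elliptic_root q * dzbar (crit_value_deriv q)"
proof -
  define c where "c = (\<Lambda> q)\<^sup>2 * fib_poly A (B q) (elliptic_root q) / elliptic_root q ^ 3"
  have "dz (crit_value_deriv q) = c * dz (fib_deriv q (elliptic_root q))"
    "dzbar (crit_value_deriv q) = c * dzbar (fib_deriv q (elliptic_root q))"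
    by (simp_all add: dz_def dzbar_def crit_value_deriv_def c_def algebra_simps)
  moreover have "c * (dz (fib_deriv q (elliptic_root q)) + elliptic_root q * dzbar (fib_deriv q (elliptic_root q))) = 0"
    by (simp only: fib_deriv_beltrami[OF elliptic_root(2)[OF assms]] mult_zero_right)
  ultimately have "dz (crit_value_deriv q) + elliptic_root q * dzbar (crit_value_deriv q) = 0"
    by (simp only: distrib_left mult.left_commute)
  then show ?thesis unfolding mult_minus_left by (rule eq_neg_iff_add_eq_0[THEN iffD2])
qed

end

section \<open>A cutoff in the imaginary part of the critical value\<close>

definition bump :: "real \<Rightarrow> real \<Rightarrow> real" where
  "bump e y = (max 0 (y\<^sup>2 - e\<^sup>2))\<^sup>2"

definition bump_deriv :: "real \<Rightarrow> real \<Rightarrow> real" where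
  "bump_deriv e y = 4 * y * max 0 (y\<^sup>2 - e\<^sup>2)"

text \<open>Squaring the positive part removes its kink: at 0 the difference quotient of
  \<open>(max 0 t)\<^sup>2\<close> is bounded by \<bar>t\<bar>.\<close>

lemma bump_has_derivative: "(bump e has_field_derivative bump_deriv e y) (at y)"
proof -
  have sq: "((\<lambda>t. (max 0 t)\<^sup>2) has_field_derivative 2 * max 0 x) (at x)" for x :: real
  proof (cases "x = 0")
    case True
    have "(\<lambda>h. (max 0 h)\<^sup>2 / h) \<midarrow>0\<rightarrow> (0::real)"
    proof (rule Lim_null_comparison[where g = "\<lambda>h. \<bar>h\<bar>"])
      show "\<forall>\<^sub>F h in at 0. norm ((max 0 h)\<^sup>2 / h) \<le> \<bar>h\<bar>"
        by (auto simp: max_def power2_eq_square intro!: always_eventually)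
      show "(\<lambda>h::real. \<bar>h\<bar>) \<midarrow>0\<rightarrow> 0"
        using tendsto_rabs[OF tendsto_ident_at, of 0 UNIV] by simp
    qed
    then show ?thesis using True by (simp add: DERIV_def)
  next
    case False
    show ?thesis
    proof (cases "x > 0")
      case True
      then have "((\<lambda>t. (max 0 t)\<^sup>2) has_field_derivative 2 * max 0 x) (at x) \<longleftrightarrow>
          ((\<lambda>t. t\<^sup>2) has_field_derivative 2 * max 0 x) (at x)"
        by (intro DERIV_cong_ev refl eventually_mono[OF eventually_nhds_in_open[of "{0<..}"]]) auto
      then show ?thesis using True by (auto intro!: derivative_eq_intros)
    next
      case F: False
      then have "((\<lambda>t. (max 0 t)\<^sup>2) has_field_derivative 2 * max 0 x) (at x) \<longleftrightarrow>
          ((\<lambda>t. 0) has_field_derivative 2 * max 0 x) (at x)"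
        using False
        by (intro DERIV_cong_ev refl eventually_mono[OF eventually_nhds_in_open[of "{..<0}"]]) auto
      then show ?thesis using F by auto
    qed
  qed
  have "((\<lambda>y. (max 0 (y\<^sup>2 - e\<^sup>2))\<^sup>2) has_field_derivative 2 * max 0 (y\<^sup>2 - e\<^sup>2) * (2 * y)) (at y)"
    by (rule DERIV_chain2[OF sq]) (auto intro!: derivative_eq_intros)
  then show ?thesis by (simp add: bump_def[abs_def] bump_deriv_def algebra_simps)
qed

lemma bump_nonneg: "bump e y \<ge> 0" and bump_deriv_nonneg: "y * bump_deriv e y \<ge> 0"
proof -
  have "y * bump_deriv e y = 4 * y\<^sup>2 * max 0 (y\<^sup>2 - e\<^sup>2)"
    by (simp add: bump_deriv_def power2_eq_square)
  then show "y * bump_deriv e y \<ge> 0" by simp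
qed (simp add: bump_def)

lemma bump_eq_0: "\<bar>y\<bar> \<le> \<bar>e\<bar> \<Longrightarrow> bump e y = 0" "\<bar>y\<bar> \<le> \<bar>e\<bar> \<Longrightarrow> bump_deriv e y = 0"
  using abs_le_square_iff[of y e] by (simp_all add: bump_def bump_deriv_def max_def)

lemma bump_pos: "\<bar>e\<bar> < \<bar>y\<bar> \<Longrightarrow> bump e y > 0"
  using power_strict_mono[of "\<bar>e\<bar>" "\<bar>y\<bar>" 2] by (simp add: bump_def max_def)

context cubic_pde
begin

lemma linear_crit_value_deriv: "q \<in> ell \<Longrightarrow> linear (crit_value_deriv q)"
  by (rule has_derivative_linear[OF crit_value_deriv])

lemma cont_crit_value: "continuous_on ell crit_value"
  by (intro continuous_at_imp_continuous_on ballI) (rule has_derivative_continuous[OF crit_value_deriv])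

lemma cont_crit_value_deriv: "continuous_on ell (\<lambda>q. crit_value_deriv q w)"
  unfolding crit_value_deriv_def fib_deriv_def fib_poly_def
  by (intro continuous_intros continuous_on_subset[OF \<Lambda>'_cont] continuous_on_subset[OF B'_cont]
      cont_\<Lambda> cont_B cont_elliptic_root) (simp_all add: elliptic_root(3))

lemma ell_per: "q + u \<in> ell \<longleftrightarrow> q \<in> ell" "q + v \<in> ell \<longleftrightarrow> q \<in> ell"
  by (auto simp: ell_def B_per)

lemma crit_value_per: "crit_value (q + u) = crit_value q" "crit_value (q + v) = crit_value q"
  by (auto simp: crit_value_def elliptic_root_def B_per \<Lambda>_per)

text \<open>At the boundary of the elliptic set the outer root reaches the unit circle, where the
  critical value is real.\<close>

lemma closed_nonreal_crit_value:
  assumes e: "e > 0"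
  shows "closed {q \<in> ell. \<bar>Im (crit_value q)\<bar> \<ge> e}"
  unfolding closed_sequential_limits
proof (intro allI impI, elim conjE)
  fix X q assume X: "\<forall>n. X n \<in> {q \<in> ell. \<bar>Im (crit_value q)\<bar> \<ge> e}" and lim: "X \<longlonglongrightarrow> q"
  have iB: "isCont B q" and i\<Lambda>: "isCont \<Lambda> q"
    by (rule has_derivative_continuous[OF B_deriv]) (rule has_derivative_continuous[OF \<Lambda>_deriv])
  have BX: "(\<lambda>n. B (X n)) \<longlonglongrightarrow> B q" and \<Lambda>X: "(\<lambda>n. \<Lambda> (X n)) \<longlonglongrightarrow> \<Lambda> q"
    using isCont_tendsto_compose[OF iB lim] isCont_tendsto_compose[OF i\<Lambda> lim] by auto
  have "Bseq (\<lambda>n. B (X n))" using BX by (simp add: convergentI convergent_imp_Bseq)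
  then obtain M where M: "\<And>n. norm (B (X n)) \<le> M" by (auto simp: Bseq_def)
  \<comment> \<open>Bounded coefficients bound the outer roots, so a subsequence of them converges;
    a priori its limit s only has norm at least 1.\<close>
  have "norm (elliptic_root (X n)) \<le> (2 * M + 3 * norm A) / (3 * norm A)" for n
  proof -
    have "norm (elliptic_root (X n)) \<le> (2 * norm (B (X n)) + 3 * norm A) / (3 * norm A)"
      using X elliptic_root[of "X n"] by (intro norm_crit_root_bound A_ne_0) auto
    also have "\<dots> \<le> (2 * M + 3 * norm A) / (3 * norm A)"
      using M[of n] by (intro divide_right_mono) auto
    finally show ?thesis .
  qed
  then have "bounded (range (\<lambda>n. elliptic_root (X n)))" by (auto simp: bounded_iff)
  then obtain s r where r: "strict_mono (r :: nat \<Rightarrow> nat)" and s: "((\<lambda>n. elliptic_root (X n)) \<circ> r) \<longlonglongrightarrow> s"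
    using bounded_imp_convergent_subsequence by blast
  have s: "(\<lambda>n. elliptic_root (X (r n))) \<longlonglongrightarrow> s" using s by (simp add: o_def)
  have BX: "(\<lambda>n. B (X (r n))) \<longlonglongrightarrow> B q" and \<Lambda>X: "(\<lambda>n. \<Lambda> (X (r n))) \<longlonglongrightarrow> \<Lambda> q"
    using LIMSEQ_subseq_LIMSEQ[OF BX r] LIMSEQ_subseq_LIMSEQ[OF \<Lambda>X r] by (auto simp: o_def)
  have rX: "X (r n) \<in> ell" for n using X by auto
  have s1: "norm s \<ge> 1"
    by (rule LIMSEQ_le_const[OF tendsto_norm[OF s]])
       (use elliptic_root(1)[OF rX] less_imp_le in blast)
  then have s0: "s \<noteq> 0" by auto
  have "(\<lambda>n. crit_poly A (B (X (r n))) (elliptic_root (X (r n)))) \<longlonglongrightarrow> crit_poly A (B q) s"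
    unfolding crit_poly_def by (intro tendsto_intros BX s)
  moreover have "(\<lambda>n. crit_poly A (B (X (r n))) (elliptic_root (X (r n)))) = (\<lambda>n. 0)"
    using elliptic_root(2)[OF rX] by auto
  ultimately have k: "crit_poly A (B q) s = 0"
    using LIMSEQ_unique[OF _ tendsto_const] by simp
  let ?V = "\<Lambda> q ^ 3 * (fib_poly A (B q) s)\<^sup>2 / s ^ 3"
  have "(\<lambda>n. crit_value (X (r n))) \<longlonglongrightarrow> ?V"
    unfolding crit_value_def fib_poly_def using s0 by (intro tendsto_intros BX \<Lambda>X s) auto
  then have "(\<lambda>n. \<bar>Im (crit_value (X (r n)))\<bar>) \<longlonglongrightarrow> \<bar>Im ?V\<bar>"
    by (intro tendsto_intros)
  then have V: "\<bar>Im ?V\<bar> \<ge> e"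
    by (rule LIMSEQ_le_const) (use X in auto)
  have "norm s \<noteq> 1"
  proof
    assume "norm s = 1"
    then have "Im (of_real (\<Lambda> q ^ 3) * ((fib_poly A (B q) s)\<^sup>2 / s ^ 3)) = 0"
      using critical_value_real[of s A "B q"] by (simp del: of_real_power times_divide_eq_right)
    then have "Im ?V = 0" by (simp only: of_real_power times_divide_eq_right)
    with V e show False by simp
  qed
  with s1 have s1: "norm s > 1" by simp
  then have ell: "q \<in> ell" using k A_ne_0 by (auto simp: ell_def mem_elliptic_coeffs_iff)
  then have "s = elliptic_root q"
    using crit_poly_root_unique[OF A_ne_0 elliptic_root(1)[OF ell] s1 elliptic_root(2)[OF ell] k] by simp
  then show "q \<in> {q \<in> ell. \<bar>Im (crit_value q)\<bar> \<ge> e}"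
    using V ell by (simp add: crit_value_def)
qed

text \<open>The plane is covered by two open sets: \<open>ell\<close>, where the chain rule applies,
  and the complement N of the closed set of \<open>closed_nonreal_crit_value\<close>, where the
  function is zero. So the extension by zero is C^1 across the boundary of
  \<open>ell\<close>.\<close>

lemma cutoff_deriv:
  fixes \<phi> :: "complex \<Rightarrow> real"
  assumes \<phi>: "\<And>z. (\<phi> has_derivative \<phi>' z) (at z)"
    and cont: "\<And>w. continuous_on ell (\<lambda>q. \<phi>' (crit_value q) (crit_value_deriv q w))"
    and e: "e > 0" and zero: "\<And>z. \<bar>Im z\<bar> \<le> e \<Longrightarrow> \<phi> z = 0" "\<And>z d. \<bar>Im z\<bar> \<le> e \<Longrightarrow> \<phi>' z d = 0"
  defines "f \<equiv> \<lambda>q. if q \<in> ell then \<phi> (crit_value q) else 0"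
    and "f' \<equiv> \<lambda>q w. if q \<in> ell then \<phi>' (crit_value q) (crit_value_deriv q w) else 0"
  shows "(f has_derivative f' q) (at q)" "continuous_on UNIV (\<lambda>q. f' q w)"
proof -
  define N where "N = - {q \<in> ell. \<bar>Im (crit_value q)\<bar> \<ge> e}"
  have N: "open N" unfolding N_def using closed_nonreal_crit_value[OF e] by (simp add: open_Compl)
  have un: "ell \<union> N = UNIV" by (auto simp: N_def)
  have f0: "f x = 0" "f' x w = 0" if "x \<in> N" for x w
    using that zero by (auto simp: N_def f_def f'_def)
  show "(f has_derivative f' q) (at q)"
  proof (cases "q \<in> ell")
    case True
    have "((\<lambda>q. \<phi> (crit_value q)) has_derivative f' q) (at q)"
      using has_derivative_compose[OF crit_value_deriv[OF True] \<phi>] True by (simp add: f'_def)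
    then show ?thesis
      by (rule has_derivative_transform_within_open[OF _ open_ell True]) (simp add: f_def)
  next
    case False
    then have q: "q \<in> N" by (simp add: N_def)
    have "f' q = (\<lambda>w. 0)" using f0(2)[OF q] by auto
    then have "((\<lambda>q. 0) has_derivative f' q) (at q)" by simp
    then show ?thesis
      by (rule has_derivative_transform_within_open[OF _ N q]) (simp add: f0)
  qed
  have "continuous_on ell (\<lambda>q. f' q w)"
    using cont[of w] by (rule continuous_on_eq) (simp add: f'_def)
  moreover have "continuous_on N (\<lambda>q. f' q w)"
    using continuous_on_const[of N 0] by (rule continuous_on_eq) (simp add: f0)
  ultimately show "continuous_on UNIV (\<lambda>q. f' q w)"
    using continuous_on_open_Un[OF open_ell N] un by auto
qed

text \<open>The Beltrami equation turns \<open>linear_jacobian\<close> into the area factor times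
  (\<bar>s\<bar>^2 - 1) times the squared norm of the \<open>dzbar\<close> coefficient, where s is
  the outer root.\<close>

lemma nonzero_jacobian:
  assumes "q \<in> ell"
  defines "J \<equiv> Re (crit_value_deriv q u) * Im (crit_value_deriv q v) - Re (crit_value_deriv q v) * Im (crit_value_deriv q u)"
  shows "J \<ge> 0" "J = 0 \<Longrightarrow> crit_value_deriv q w = 0"
proof -
  let ?D = "crit_value_deriv q"
  have n: "norm (dz ?D) = norm (elliptic_root q) * norm (dzbar ?D)"
    using crit_value_beltrami[OF assms(1)] by (simp add: norm_mult)
  have r: "(norm (elliptic_root q))\<^sup>2 > 1" using elliptic_root(1)[OF assms(1)] by (simp add: one_less_power)
  have J: "J = (u $ 1 * v $ 2 - u $ 2 * v $ 1) * (((norm (elliptic_root q))\<^sup>2 - 1) * (norm (dzbar ?D))\<^sup>2)"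
    unfolding J_def linear_jacobian[OF linear_crit_value_deriv[OF assms(1)]] n
    by (simp add: algebra_simps power_mult_distrib)
  show "J \<ge> 0" unfolding J using basis r by (intro mult_nonneg_nonneg) auto
  assume "J = 0"
  then have "norm (dzbar ?D) = 0" unfolding J using basis r by auto
  then have "?D = (\<lambda>w. 0)"
    using linear_eq_0_iff_wirtinger[OF linear_crit_value_deriv[OF assms(1)]] n by simp
  then show "?D w = 0" by metis
qed

text \<open>The map taking z to z * \<open>bump e (Im z)\<close>, applied to the critical value,
  extends by zero to a periodic C^1 map with nonnegative Jacobian, to which
  \<open>periodic_jacobian_zero\<close> applies.\<close>

lemma crit_value_deriv_0_nonreal:
  assumes q: "q \<in> ell" and Im: "Im (crit_value q) \<noteq> 0"
  shows "crit_value_deriv q w = 0"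
proof -
  \<comment> \<open>Half of the imaginary part at q, so that the cutoff is still positive at
    q.\<close>
  define e where "e = \<bar>Im (crit_value q)\<bar> / 2"
  have e: "e > 0" "e < \<bar>Im (crit_value q)\<bar>" using Im by (auto simp: e_def)
  define \<phi> where "\<phi> z = Re z * bump e (Im z)" for z
  define \<phi>' where "\<phi>' z d = Re d * bump e (Im z) + Re z * (bump_deriv e (Im z) * Im d)" for z d
  define \<psi> where "\<psi> z = Im z * bump e (Im z)" for z
  define \<psi>' where "\<psi>' z d = Im d * bump e (Im z) + Im z * (bump_deriv e (Im z) * Im d)" for z d
  have b: "((\<lambda>z. bump e (Im z)) has_derivative (\<lambda>d. bump_deriv e (Im z) * Im d)) (at z)" for z
    using has_derivative_compose[OF bounded_linear_imp_has_derivative[OF bounded_linear_Im]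
        bump_has_derivative[unfolded has_field_derivative_def]] by simp
  have d\<phi>: "(\<phi> has_derivative \<phi>' z) (at z)" and d\<psi>: "(\<psi> has_derivative \<psi>' z) (at z)" for z
    unfolding \<phi>_def \<phi>'_def \<psi>_def \<psi>'_def
    by (auto intro!: derivative_eq_intros b bounded_linear_imp_has_derivative[OF bounded_linear_Im]
        bounded_linear_imp_has_derivative[OF bounded_linear_Re])
  have cb: "continuous_on UNIV (bump e)" "continuous_on UNIV (bump_deriv e)"
    unfolding bump_def bump_deriv_def by (intro continuous_intros)+
  have cb: "continuous_on ell (\<lambda>q. bump e (Im (crit_value q)))" "continuous_on ell (\<lambda>q. bump_deriv e (Im (crit_value q)))"
    by (rule continuous_on_compose2[OF cb(1)] continuous_on_compose2[OF cb(2)],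
        intro continuous_intros cont_crit_value, simp)+
  have c\<phi>: "continuous_on ell (\<lambda>q. \<phi>' (crit_value q) (crit_value_deriv q w))"
    and c\<psi>: "continuous_on ell (\<lambda>q. \<psi>' (crit_value q) (crit_value_deriv q w))" for w
    unfolding \<phi>'_def \<psi>'_def by (intro continuous_intros cb cont_crit_value cont_crit_value_deriv)+
  define P where "P = (\<lambda>q. if q \<in> ell then \<phi> (crit_value q) else 0)"
  define P' where "P' = (\<lambda>q w. if q \<in> ell then \<phi>' (crit_value q) (crit_value_deriv q w) else 0)"
  define Q where "Q = (\<lambda>q. if q \<in> ell then \<psi> (crit_value q) else 0)"
  define Q' where "Q' = (\<lambda>q w. if q \<in> ell then \<psi>' (crit_value q) (crit_value_deriv q w) else 0)"
  have P: "(P has_derivative P' q) (at q)" "continuous_on UNIV (\<lambda>q. P' q w)" for q w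
    unfolding P_def P'_def
    by (rule cutoff_deriv[OF d\<phi> c\<phi> e(1)]; use e(1) in \<open>simp add: \<phi>_def \<phi>'_def bump_eq_0\<close>)+
  have Q: "(Q has_derivative Q' q) (at q)" "continuous_on UNIV (\<lambda>q. Q' q w)" for q w
    unfolding Q_def Q'_def
    by (rule cutoff_deriv[OF d\<psi> c\<psi> e(1)]; use e(1) in \<open>simp add: \<psi>_def \<psi>'_def bump_eq_0\<close>)+
  define J where "J q = Re (crit_value_deriv q u) * Im (crit_value_deriv q v)
    - Re (crit_value_deriv q v) * Im (crit_value_deriv q u)" for q
  define c where "c q = bump e (Im (crit_value q)) *
    (bump e (Im (crit_value q)) + Im (crit_value q) * bump_deriv e (Im (crit_value q)))" for q
  \<comment> \<open>The factor c is the Jacobian determinant of the cutoff map at the critical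
    value.\<close>
  have jac: "P' q u * Q' q v - P' q v * Q' q u = c q * J q" if "q \<in> ell" for q
    using that by (simp add: P'_def Q'_def \<phi>'_def \<psi>'_def c_def J_def algebra_simps)
  have "c q \<ge> 0" for q
    unfolding c_def by (intro mult_nonneg_nonneg add_nonneg_nonneg bump_nonneg bump_deriv_nonneg)
  then have nonneg: "P' q u * Q' q v - P' q v * Q' q u \<ge> 0" for q
    using jac[of q] nonzero_jacobian(1)[of q]
    by (cases "q \<in> ell") (auto simp: J_def, simp add: P'_def Q'_def)
  have "P' q u * Q' q v - P' q v * Q' q u = 0"
    by (rule periodic_jacobian_zero[OF P(1) Q(1) P(2) Q(2) _ _ _ _ nonneg])
       (auto simp: P_def Q_def ell_per crit_value_per)
  moreover have "bump e (Im (crit_value q)) > 0" using e by (intro bump_pos) auto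
  then have "c q > 0"
    unfolding c_def by (intro mult_pos_pos add_pos_nonneg bump_deriv_nonneg)
  ultimately have "J q = 0" using jac[OF q] by simp
  then show ?thesis by (intro nonzero_jacobian(2)[OF q]) (simp add: J_def)
qed

text \<open>Near a point with nonzero derivative the critical value would be real by the previous
  lemma; a real-valued map has zero Jacobian, which forces the derivative to vanish after
  all.\<close>

lemma crit_value_deriv_0:
  assumes q: "q \<in> ell"
  shows "crit_value_deriv q w = 0"
proof (rule ccontr)
  assume ne: "crit_value_deriv q w \<noteq> 0"
  have "open (ell \<inter> (\<lambda>q. crit_value_deriv q w) -` (- {0}))"
    by (rule continuous_open_preimage[OF cont_crit_value_deriv open_ell]) auto
  moreover have "q \<in> ell \<inter> (\<lambda>q. crit_value_deriv q w) -` (- {0})" using q ne by auto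
  moreover have "((\<lambda>q. Im (crit_value q)) has_derivative (\<lambda>w. Im (crit_value_deriv q w))) (at q)"
    using has_derivative_compose[OF crit_value_deriv[OF q]
        bounded_linear_imp_has_derivative[OF bounded_linear_Im]] by simp
  ultimately have "((\<lambda>q. 0) has_derivative (\<lambda>w. Im (crit_value_deriv q w))) (at q)"
    by (elim has_derivative_transform_within_open[rotated 1])
       (use crit_value_deriv_0_nonreal in auto)
  then have "(\<lambda>w. Im (crit_value_deriv q w)) = (\<lambda>w. 0)"
    by (rule has_derivative_unique) simp
  then have "Im (crit_value_deriv q w) = 0" for w by metis
  then have "crit_value_deriv q w = 0" by (intro nonzero_jacobian(2)[OF q]) simp
  then show False using ne by simp
qed

text \<open>Along \<open>w\<close>, the derivative of the integral restricted to the energy level is a trigonometric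
  polynomial vanishing at all three pairs of critical points.\<close>

lemma simple_wave:
  assumes q: "q \<in> ell" and w: "cnj (vec_complex w) = third_root A (elliptic_root q) * vec_complex w"
  shows "\<Lambda>' q w = 0" "B' q w = 0"
proof -
  note r = elliptic_root[OF q]
  define s where "s = elliptic_root q"
  note others = crit_poly_other_roots[OF r(2) A_ne_0 r(1)]
  have k1: "fib_deriv q s w = 0"
    using crit_value_deriv_0[OF q] crit_value_deriv_eq_0_iff[OF q] by (simp add: s_def)
  \<comment> \<open>The integral is real on real momenta, so the vanishing passes to the mirror
    root.\<close>
  have "fib_deriv q (1 / cnj s) w = cnj (fib_deriv q s w) / cnj s ^ 3"
    using r(3) fib_poly_reciprocal[OF r(3)]
    by (simp add: fib_deriv_def s_def field_simps power2_eq_square power3_eq_cube)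
  then have k2: "fib_deriv q (1 / cnj s) w = 0" using k1 by simp
  \<comment> \<open>The condition on w is made for this: along w the Wirtinger expansion is a
    multiple of the expression in \<open>fib_deriv_beltrami\<close> at the third root.\<close>
  have "fib_deriv q (third_root A s) w = vec_complex w *
      (dz (fib_deriv q (third_root A s)) + third_root A s * dzbar (fib_deriv q (third_root A s)))"
    unfolding linear_wirtinger[OF linear_fib_deriv, of q _ w] w by (simp add: s_def algebra_simps)
  then have k3: "fib_deriv q (third_root A s) w = 0"
    using fib_deriv_beltrami[OF others(2)] by (simp add: s_def)
  define c2 c1 c0 where "c2 = 2 * \<Lambda>' q w * B q + 2 * \<Lambda> q * B' q w"
    and "c1 = 4 * \<Lambda>' q w * cnj (B q) + 2 * \<Lambda> q * cnj (B' q w)" and "c0 = 6 * \<Lambda>' q w * cnj A"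
  \<comment> \<open>Subtracting a multiple of \<open>crit_poly\<close>, which is zero at all three
    roots, removes the cubic term; a quadratic with three distinct zeros is trivial.\<close>
  have e: "fib_deriv q x w - \<Lambda>' q w * crit_poly A (B q) x = c2 * x\<^sup>2 + c1 * x + c0" for x
    by (simp add: fib_deriv_def fib_poly_def crit_poly_def c2_def c1_def c0_def algebra_simps)
  have "c2 = 0" "c0 = 0"
    using quadratic_three_roots[of c2 s c1 c0 "1 / cnj s" "third_root A s"]
      e[of s] e[of "1 / cnj s"] e[of "third_root A s"] k1 k2 k3 r(2) others
    by (simp_all add: s_def)
  then show "\<Lambda>' q w = 0" "B' q w = 0"
    using A_ne_0 \<Lambda>_pos[of q] by (auto simp: c0_def c2_def)
qed

end

section \<open>Straight lines of constancy\<close>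

text \<open>Gronwall argument: on an interval of radius \<eta> with \<eta> K \<le> 1/2, the mean
  value inequality bounds the maximum of \<open>norm (f t)\<close> by half of itself.\<close>

lemma zero_of_deriv_bound:
  fixes f :: "real \<Rightarrow> 'a::real_normed_vector"
  assumes \<delta>: "\<delta> > 0"
    and deriv: "\<And>t. \<bar>t - t0\<bar> < \<delta> \<Longrightarrow> (f has_vector_derivative f' t) (at t)"
    and bound: "\<And>t. \<bar>t - t0\<bar> < \<delta> \<Longrightarrow> norm (f' t) \<le> C * norm (f t)"
    and zero: "f t0 = 0"
  shows "\<exists>\<eta>>0. \<forall>t. \<bar>t - t0\<bar> < \<eta> \<longrightarrow> f t = 0"
proof -
  define K where "K = \<bar>C\<bar> + 1"
  have K: "K > 0" "C \<le> K" by (auto simp: K_def)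
  define \<eta> where "\<eta> = min (\<delta> / 2) (1 / (2 * K))"
  have \<eta>: "\<eta> > 0" "\<eta> < \<delta>" using \<delta> K by (auto simp: \<eta>_def)
  have "\<eta> * K \<le> 1 / (2 * K) * K" using K by (intro mult_right_mono) (auto simp: \<eta>_def)
  then have \<eta>K: "\<eta> * K \<le> 1 / 2" using K by simp
  let ?I = "{t0 - \<eta>..t0 + \<eta>}"
  have I: "\<bar>t - t0\<bar> < \<delta>" "\<bar>t - t0\<bar> \<le> \<eta>" if "t \<in> ?I" for t using that \<eta> by (auto simp: abs_le_iff)
  have "continuous_on ?I f"
    using I deriv has_vector_derivative_continuous by (intro continuous_at_imp_continuous_on) blast
  then have "continuous_on ?I (\<lambda>t. norm (f t))" by (intro continuous_intros)
  then obtain m where m: "m \<in> ?I" "\<And>t. t \<in> ?I \<Longrightarrow> norm (f t) \<le> norm (f m)"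
    using continuous_attains_sup[of ?I "\<lambda>t. norm (f t)"] \<eta> by auto
  have "norm (f m - f t0) \<le> (K * norm (f m)) * norm (m - t0)"
  proof (rule differentiable_bound[where S = ?I])
    fix t assume t: "t \<in> ?I"
    show "(f has_derivative (\<lambda>x. x *\<^sub>R f' t)) (at t within ?I)"
      using deriv[OF I(1)[OF t]] by (simp add: has_vector_derivative_def has_derivative_at_withinI)
    have "norm (f' t) \<le> K * norm (f m)"
      using bound[OF I(1)[OF t]] mult_mono[OF K(2) m(2)[OF t]] K by (smt (verit) norm_ge_zero)
    then show "onorm (\<lambda>x. x *\<^sub>R f' t) \<le> K * norm (f m)"
      by (intro onorm_le) (simp add: mult.commute mult_left_mono)
  qed (use m \<eta> in auto)
  also have "\<dots> \<le> (K * norm (f m)) * \<eta>"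
    using I(2)[OF m(1)] K by (intro mult_left_mono) auto
  also have "\<dots> \<le> norm (f m) * (1 / 2)"
    using mult_left_mono[OF \<eta>K, of "norm (f m)"] by (simp add: mult_ac)
  finally have "norm (f m) \<le> 0" by (simp add: zero)
  then have "f t = 0" if "\<bar>t - t0\<bar> < \<eta>" for t
    using m(2)[of t] that by (auto simp: abs_less_iff)
  then show ?thesis using \<eta> by blast
qed

lemma constant_along_line:
  fixes F :: "'a::real_normed_vector \<Rightarrow> 'b::real_normed_vector"
  assumes F: "\<And>q. (F has_derivative F' q) (at q)" and zero: "\<And>t. F' (q + t *\<^sub>R d) d = 0"
  shows "F (q + t *\<^sub>R d) = F q"
proof -
  have "((\<lambda>t. F (q + t *\<^sub>R d)) has_derivative (\<lambda>h. 0)) (at t)" for t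
  proof -
    have g: "((\<lambda>t. q + t *\<^sub>R d) has_derivative (\<lambda>h. h *\<^sub>R d)) (at t)"
      by (auto intro!: derivative_eq_intros)
    show ?thesis
      using has_derivative_compose[OF g F] linear_cmul[OF has_derivative_linear[OF F]] zero by simp
  qed
  from has_derivative_zero_unique[OF convex_UNIV this, of t 0] show ?thesis by simp
qed

section \<open>Plane vectors as complex numbers, and unoriented directions\<close>

lemma vec_complex_vector [simp]: "vec_complex (vector [Re z, Im z]) = z"
  by (simp add: vec_complex_def vector_2)

lemma vec_complex_simps [simp]:
  "vec_complex (x + y) = vec_complex x + vec_complex y" "vec_complex (x - y) = vec_complex x - vec_complex y"
  "vec_complex (r *\<^sub>R x) = r * vec_complex x"
  by (simp_all add: vec_complex_def complex_eq_iff)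

lemma vec_complex_0 [simp]: "vec_complex 0 = 0"
  by (simp add: vec_complex_def complex_eq_iff)

lemma norm_vec_complex [simp]: "norm (vec_complex x) = norm x"
  by (simp add: vec_complex_def norm_vec_def L2_set_def sum_2 cmod_def)

lemma unimodular_direction:
  assumes "norm p = 1"
  shows "\<exists>w. w \<noteq> 0 \<and> cnj (vec_complex w) = p * vec_complex w"
proof -
  \<comment> \<open>For \<bar>d\<bar> = 1, the condition cnj d = p d amounts to d^2 = cnj p.\<close>
  define d where "d = csqrt (cnj p)"
  have d2: "d\<^sup>2 = cnj p" by (simp add: d_def)
  have "(norm d)\<^sup>2 = 1" using assms arg_cong[OF d2, of norm] by (simp add: norm_power)
  then have dd: "d * cnj d = 1" by (simp add: complex_norm_square[symmetric])
  have pp: "p * cnj p = 1" using assms by (simp add: complex_norm_square[symmetric])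
  have "cnj d = p * d\<^sup>2 * cnj d" using pp d2 by simp
  also have "\<dots> = p * d" using dd by (simp add: power2_eq_square mult_ac)
  finally have "cnj d = p * d" .
  moreover have "vector [Re d, Im d] \<noteq> (0 :: real^2)"
  proof
    assume 0: "vector [Re d, Im d] = (0 :: real^2)"
    have "d = vec_complex 0" unfolding 0[symmetric] by simp
    then show False using dd by simp
  qed
  ultimately show ?thesis by (intro exI[of _ "vector [Re d, Im d]"]) simp
qed

lemma linear_norm_bound2:
  assumes "linear (D :: real^2 \<Rightarrow> 'a::real_normed_vector)"
  shows "norm (D w) \<le> (norm (D (axis 1 1)) + norm (D (axis 2 1))) * norm w"
proof -
  have "norm (D w) = norm ((w $ 1) *\<^sub>R D (axis 1 1) + (w $ 2) *\<^sub>R D (axis 2 1))"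
    by (subst vec2_expand[of w]) (simp only: linear_add[OF assms] linear_cmul[OF assms])
  also have "\<dots> \<le> \<bar>w $ 1\<bar> * norm (D (axis 1 1)) + \<bar>w $ 2\<bar> * norm (D (axis 2 1))"
    by (metis norm_scaleR norm_triangle_ineq)
  also have "\<dots> \<le> norm w * norm (D (axis 1 1)) + norm w * norm (D (axis 2 1))"
    by (intro add_mono mult_right_mono) (auto simp: component_le_norm_cart)
  finally show ?thesis by (simp add: algebra_simps)
qed

text \<open>A holomorphic map has Jacobian \<bar>K_z\<bar>^2 \<ge> 0, so the vanishing mean of the
  Jacobian takes the place of Liouville's theorem.\<close>

lemma periodic_holomorphic_constant:
  fixes K :: "real^2 \<Rightarrow> complex" and u v :: "real^2"
  assumes K: "\<And>q. (K has_derivative K' q) (at q)" and cont: "\<And>w. continuous_on UNIV (\<lambda>q. K' q w)"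
    and per: "\<And>q. K (q + u) = K q" "\<And>q. K (q + v) = K q"
    and basis: "u $ 1 * v $ 2 - u $ 2 * v $ 1 > 0"
    and holo: "\<And>q. dzbar (K' q) = 0"
  shows "K' q = (\<lambda>w. 0)" "K q = K 0"
proof -
  have dRe: "((\<lambda>q. Re (K q)) has_derivative (\<lambda>w. Re (K' q w))) (at q)"
    and dIm: "((\<lambda>q. Im (K q)) has_derivative (\<lambda>w. Im (K' q w))) (at q)" for q
    by (rule bounded_linear.has_derivative[OF bounded_linear_Re K])
       (rule bounded_linear.has_derivative[OF bounded_linear_Im K])
  have cRe: "continuous_on UNIV (\<lambda>q. Re (K' q w))" and cIm: "continuous_on UNIV (\<lambda>q. Im (K' q w))" for w
    by (intro continuous_intros cont)+
  have jac: "Re (K' q u) * Im (K' q v) - Re (K' q v) * Im (K' q u) =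
      (u $ 1 * v $ 2 - u $ 2 * v $ 1) * (norm (dz (K' q)))\<^sup>2" for q
    unfolding linear_jacobian[OF has_derivative_linear[OF K]] holo by simp
  have "Re (K' q u) * Im (K' q v) - Re (K' q v) * Im (K' q u) = 0" for q
    by (rule periodic_jacobian_zero[OF dRe dIm cRe cIm])
       (use per basis in \<open>simp_all add: jac\<close>)
  then have "dz (K' q) = 0" for q using basis unfolding jac by simp
  then have zero: "K' q = (\<lambda>w. 0)" for q
    using linear_eq_0_iff_wirtinger[OF has_derivative_linear[OF K]] holo by simp
  then show "K' q = (\<lambda>w. 0)" .
  from constant_along_line[OF K, of 0 q 1] zero show "K q = K 0" by simp
qed

section \<open>Characteristics of the simple wave\<close>

context cubic_pde
begin

text \<open>A unit complex number p encodes the unoriented line of all w with cnj w = p w.\<close>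

definition third_direction :: "real^2 \<Rightarrow> complex" where
  "third_direction q = third_root A (elliptic_root q)"

text \<open>The distribution annihilating \<open>\<Lambda>\<close> and \<open>B\<close> depends on \<open>B\<close> only; hence its integral curves
  are straight lines.\<close>

lemma B_locally_constant:
  assumes t0: "B (q0 + t0 *\<^sub>R d) = B q0" and q0: "q0 \<in> ell"
    and d: "cnj (vec_complex d) = third_direction q0 * vec_complex d"
  shows "\<exists>\<eta>>0. \<forall>t. \<bar>t - t0\<bar> < \<eta> \<longrightarrow> B (q0 + t *\<^sub>R d) = B q0"
proof -
  define \<gamma> where "\<gamma> t = q0 + t *\<^sub>R d" for t
  have \<gamma>: "(\<gamma> has_derivative (\<lambda>h. h *\<^sub>R d)) (at t)" for t
    unfolding \<gamma>_def by (auto intro!: derivative_eq_intros)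
  have B0: "B q0 \<in> elliptic_coeffs A" and s0: "elliptic_root q0 \<noteq> 0" using q0 elliptic_root(3) by (auto simp: ell_def)
  have nz: "outer_root A (B q0) \<noteq> 0" using s0 by (simp add: elliptic_root_def)
  note \<sigma> = outer_root_has_derivative[OF A_ne_0 B0]
  have "(\<lambda>b. cnj (outer_root A b)) differentiable at (B q0)"
    by (rule differentiableI[OF bounded_linear.has_derivative[OF bounded_linear_cnj \<sigma>]])
  then have diff: "(\<lambda>b. third_root A (outer_root A b)) differentiable at (B q0)"
    unfolding third_root_def using nz A_ne_0
    by (intro differentiable_divide differentiable_mult differentiable_const differentiableI[OF \<sigma>]) auto
  \<comment> \<open>The third root is differentiable in B, so near \<open>B q0\<close> the direction
    turns at most in proportion to the change of B.\<close>
  obtain \<kappa> T where \<kappa>: "\<kappa> > 0" and L: "\<And>b. norm (b - B q0) < \<kappa> \<Longrightarrow>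
      norm (third_root A (outer_root A b) - third_direction q0) \<le> T * norm (b - B q0)"
  proof -
    obtain D where D: "((\<lambda>b. third_root A (outer_root A b)) has_derivative D) (at (B q0))"
      using diff by (auto simp: differentiable_def)
    from D obtain K where K: "\<And>x. norm (D x) \<le> norm x * K"
      using bounded_linear.bounded has_derivative_bounded_linear by blast
    from has_derivative_at_alt[THEN iffD1, OF D, THEN conjunct2, rule_format, of 1]
    obtain \<kappa> where \<kappa>: "\<kappa> > 0" and a: "\<And>b. norm (b - B q0) < \<kappa> \<Longrightarrow>
      norm (third_root A (outer_root A b) - third_root A (outer_root A (B q0)) - D (b - B q0)) \<le> 1 * norm (b - B q0)"
      by auto
    have "norm (third_root A (outer_root A b) - third_direction q0) \<le> (K + 1) * norm (b - B q0)"
      if "norm (b - B q0) < \<kappa>" for b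
      using a[OF that] K[of "b - B q0"]
        norm_triangle_ineq[of "third_root A (outer_root A b) - third_direction q0 - D (b - B q0)" "D (b - B q0)"]
      by (simp add: third_direction_def elliptic_root_def algebra_simps)
    with \<kappa> show thesis by (rule that)
  qed
  define M where "M = (\<lambda>t. norm (B' (\<gamma> t) (axis 1 1)) + norm (B' (\<gamma> t) (axis 2 1)))"
  have \<gamma>_UNIV: "continuous_on UNIV \<gamma>" unfolding \<gamma>_def by (intro continuous_intros)
  have "continuous_on UNIV (\<lambda>t. B' (\<gamma> t) w)" for w
    by (rule continuous_on_compose2[OF B'_cont \<gamma>_UNIV]) simp
  then have M_cont: "continuous_on UNIV M" unfolding M_def by (intro continuous_intros)
  have B_cont: "continuous_on UNIV (\<lambda>t. B (\<gamma> t))"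
    by (rule continuous_on_compose2[OF cont_B[of UNIV] \<gamma>_UNIV]) simp
  let ?S = "{t. M t < M t0 + 1} \<inter> {t. norm (B (\<gamma> t) - B q0) < \<kappa>} \<inter> (\<lambda>t. B (\<gamma> t)) -` elliptic_coeffs A"
  have "open ?S"
    by (intro open_Int open_Collect_less continuous_intros M_cont B_cont
        open_vimage[OF open_elliptic_coeffs[OF A_ne_0]])
  moreover have "t0 \<in> ?S" using t0 \<kappa> B0 by (simp add: \<gamma>_def)
  ultimately obtain \<delta> where \<delta>: "\<delta> > 0" and ball: "ball t0 \<delta> \<subseteq> ?S" by (rule openE)
  have near: "M t < M t0 + 1 \<and> norm (B (\<gamma> t) - B q0) < \<kappa> \<and> B (\<gamma> t) \<in> elliptic_coeffs A"
    if "\<bar>t - t0\<bar> < \<delta>" for t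
    using subsetD[OF ball, of t] that by (auto simp: dist_real_def abs_minus_commute)
  have "\<exists>\<eta>>0. \<forall>t. \<bar>t - t0\<bar> < \<eta> \<longrightarrow> B (\<gamma> t) - B q0 = 0"
  proof (rule zero_of_deriv_bound[OF \<delta>])
    fix t assume t: "\<bar>t - t0\<bar> < \<delta>"
    note n = near[OF t]
    have ell: "\<gamma> t \<in> ell" using n by (simp add: ell_def)
    show "((\<lambda>t. B (\<gamma> t) - B q0) has_vector_derivative B' (\<gamma> t) d) (at t)"
      unfolding has_vector_derivative_def
      using has_derivative_diff[OF has_derivative_compose[OF \<gamma> B_deriv] has_derivative_const[of "B q0"]]
      by (simp add: linear_cmul[OF linear_B'])
    define p where "p = third_direction (\<gamma> t)"
    \<comment> \<open>The orthogonal projection of d onto the line encoded by p: conjugation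
      followed by multiplication by \<open>cnj p\<close> is the reflection in that line.\<close>
    define z where "z = (vec_complex d + cnj (vec_complex d) * cnj p) / 2"
    define w where "w = (vector [Re z, Im z] :: real^2)"
    have vw: "vec_complex w = z" by (simp add: w_def)
    have np: "norm p = 1" using norm_third_root[OF A_ne_0 elliptic_root(3)[OF ell]] by (simp add: p_def third_direction_def)
    have pp: "p * cnj p = 1" using np by (simp add: complex_norm_square[symmetric])
    have "cnj (vec_complex w) = p * vec_complex w"
    proof -
      have "2 * (p * z) = p * vec_complex d + (p * cnj p) * cnj (vec_complex d)"
        by (simp add: z_def algebra_simps)
      also have "\<dots> = 2 * cnj z" unfolding pp by (simp add: z_def algebra_simps)
      finally show ?thesis by (simp add: vw)
    qed
    then have "B' (\<gamma> t) w = 0"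
      using simple_wave(2)[OF ell] by (simp add: p_def third_direction_def)
    \<comment> \<open>Only d - w contributes. Its length is controlled by the turn of the direction,
      hence by the change of B, which gives the Gronwall bound.\<close>
    then have eq: "B' (\<gamma> t) d = B' (\<gamma> t) (d - w)" by (simp add: linear_diff[OF linear_B'])
    have le1: "norm (d - w) \<le> norm d * norm (p - third_direction q0)"
    proof -
      have p0: "third_direction q0 * cnj (third_direction q0) = 1"
        using norm_third_root[OF A_ne_0 s0] by (simp add: third_direction_def complex_norm_square[symmetric])
      have "vec_complex d = cnj (vec_complex d) * cnj (third_direction q0)"
        using d p0 by (simp add: mult_ac)
      then have "vec_complex (d - w) = cnj (vec_complex d) * cnj (third_direction q0 - p) / 2"
        by (simp add: vw z_def field_simps)
      then have "norm (d - w) = norm d * norm (third_direction q0 - p) / 2"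
        by (metis norm_vec_complex norm_divide norm_mult complex_mod_cnj norm_numeral)
      then have "2 * norm (d - w) = norm d * norm (p - third_direction q0)"
        by (simp add: norm_minus_commute)
      moreover have "0 \<le> norm (d - w)" by simp
      ultimately show ?thesis by linarith
    qed
    have le2: "norm (p - third_direction q0) \<le> T * norm (B (\<gamma> t) - B q0)"
      using L n by (simp add: p_def third_direction_def elliptic_root_def)
    have "norm (B' (\<gamma> t) d) \<le> M t * norm (d - w)"
      unfolding eq using linear_norm_bound2[OF linear_B'] by (simp add: M_def)
    also have "\<dots> \<le> (M t0 + 1) * norm (d - w)"
      using n by (intro mult_right_mono) auto
    also have "\<dots> \<le> (M t0 + 1) * (norm d * (T * norm (B (\<gamma> t) - B q0)))"
      by (rule mult_left_mono[OF order_trans[OF le1 mult_left_mono[OF le2 norm_ge_zero]]]) (simp add: M_def)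
    finally show "norm (B' (\<gamma> t) d) \<le> ((M t0 + 1) * norm d * T) * norm (B (\<gamma> t) - B q0)"
      by (simp only: mult.assoc)
  qed (simp add: t0 \<gamma>_def)
  then show ?thesis by (simp add: \<gamma>_def)
qed

text \<open>The parameters at which B has its initial value form a closed set, open by
  \<open>B_locally_constant\<close>, hence everything. Ellipticity depends on B only, so the line
  stays in \<open>ell\<close> and \<open>simple_wave\<close> applies to \<Lambda> too.\<close>

lemma line_constant:
  assumes q0: "q0 \<in> ell" and d: "cnj (vec_complex d) = third_direction q0 * vec_complex d"
  shows "B (q0 + t *\<^sub>R d) = B q0" "\<Lambda> (q0 + t *\<^sub>R d) = \<Lambda> q0"
proof -
  let ?T = "{t. B (q0 + t *\<^sub>R d) = B q0}"
  have "closed ?T"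
    by (intro closed_Collect_eq continuous_on_compose2[OF cont_B[of UNIV]] continuous_intros) auto
  moreover have "open ?T"
    unfolding open_dist using B_locally_constant[OF _ q0 d] by (auto simp: dist_real_def)
  ultimately have "?T = {} \<or> ?T = UNIV" using clopen[of ?T] by simp
  moreover have "0 \<in> ?T" by simp
  ultimately have B: "B (q0 + t *\<^sub>R d) = B q0" for t by blast
  then show "B (q0 + t *\<^sub>R d) = B q0" .
  have "\<Lambda>' (q0 + t *\<^sub>R d) d = 0" for t
  proof -
    have e: "q0 + t *\<^sub>R d \<in> ell" using q0 B by (simp add: ell_def)
    have "third_root A (elliptic_root (q0 + t *\<^sub>R d)) = third_direction q0"
      by (simp add: third_direction_def elliptic_root_def B)
    then show ?thesis using simple_wave(1)[OF e] d by simp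
  qed
  then show "\<Lambda> (q0 + t *\<^sub>R d) = \<Lambda> q0" by (rule constant_along_line[OF \<Lambda>_deriv])
qed

text \<open>Two lines of different directions would intersect, and at the point of intersection \<open>B\<close>
  would have both directions.\<close>

lemma third_direction_unique:
  assumes q: "q \<in> ell" and q': "q' \<in> ell"
  shows "third_direction q = third_direction q'"
proof (rule ccontr)
  assume ne: "third_direction q \<noteq> third_direction q'"
  have "norm (third_direction q) = 1" "norm (third_direction q') = 1"
    using norm_third_root[OF A_ne_0] elliptic_root(3) q q' by (auto simp: third_direction_def)
  then obtain d e where d: "d \<noteq> 0" "cnj (vec_complex d) = third_direction q * vec_complex d"
    and e: "e \<noteq> 0" "cnj (vec_complex e) = third_direction q' * vec_complex e"
    using unimodular_direction by meson
  define \<Delta> where "\<Delta> = d $ 1 * e $ 2 - d $ 2 * e $ 1"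
  have "\<Delta> \<noteq> 0"
  proof
    assume "\<Delta> = 0"
    then have "cnj (vec_complex d) * vec_complex e = vec_complex d * cnj (vec_complex e)"
      by (simp add: \<Delta>_def vec_complex_def complex_eq_iff mult_ac)
    then have "(third_direction q - third_direction q') * (vec_complex d * vec_complex e) = 0"
      unfolding d(2) e(2) by (simp add: algebra_simps)
    moreover have "vec_complex d \<noteq> 0" "vec_complex e \<noteq> 0"
      using d(1) e(1) norm_vec_complex by (metis norm_eq_zero)+
    ultimately show False using ne by simp
  qed
  \<comment> \<open>Cramer's rule for q + t d = q' + t' e.\<close>
  define r where "r = q' - q"
  define t where "t = (r $ 1 * e $ 2 - r $ 2 * e $ 1) / \<Delta>"
  define t' where "t' = (r $ 1 * d $ 2 - r $ 2 * d $ 1) / \<Delta>"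
  have "\<Delta> * (t * d $ i) = \<Delta> * (r $ i + t' * e $ i)" for i
    using \<open>\<Delta> \<noteq> 0\<close> exhaust_2[of i] by (auto simp: t_def t'_def field_simps) (simp_all add: \<Delta>_def algebra_simps)
  then have "t * d $ i = r $ i + t' * e $ i" for i using \<open>\<Delta> \<noteq> 0\<close> by simp
  then have "q + t *\<^sub>R d = q' + t' *\<^sub>R e"
    by (simp add: vec_eq_iff r_def)
  then have "B q = B q'" using line_constant(1)[OF q d(2), of t] line_constant(1)[OF q' e(2), of t'] by simp
  then show False using ne by (simp add: third_direction_def elliptic_root_def)
qed

lemma invariant_direction:
  "\<exists>d. d \<noteq> 0 \<and> (\<forall>q\<in>ell. \<forall>t. \<Lambda> (q + t *\<^sub>R d) = \<Lambda> q)"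
proof (cases "ell = {}")
  case True
  have "axis 1 1 \<noteq> (0 :: real^2)" by simp
  then show ?thesis using True by blast
next
  case False
  then obtain q0 where q0: "q0 \<in> ell" by blast
  have "norm (third_direction q0) = 1"
    using norm_third_root[OF A_ne_0 elliptic_root(3)[OF q0]] by (simp add: third_direction_def)
  then obtain d where "d \<noteq> 0" "cnj (vec_complex d) = third_direction q0 * vec_complex d"
    using unimodular_direction by blast
  then show ?thesis using line_constant(2) third_direction_unique[OF _ q0] by metis
qed

end

text \<open>E is \<open>ell\<close> if A is nonzero and the whole plane if A = 0. Its openness
  serves the analytic continuation; the last clause is the form in which elliptic points are
  recognised from A and B.\<close>

theorem integral_invariant_direction:
  fixes \<Lambda> :: "real^2 \<Rightarrow> real" and A B :: "real^2 \<Rightarrow> complex" and u v :: "real^2"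
  assumes \<Lambda>: "\<And>q. (\<Lambda> has_derivative \<Lambda>' q) (at q)" "\<And>w. continuous_on UNIV (\<lambda>q. \<Lambda>' q w)"
      "\<And>q. \<Lambda> q > 0" "\<And>q. \<Lambda> (q + u) = \<Lambda> q" "\<And>q. \<Lambda> (q + v) = \<Lambda> q"
    and A: "\<And>q. (A has_derivative A' q) (at q)" "\<And>w. continuous_on UNIV (\<lambda>q. A' q w)"
      "\<And>q. A (q + u) = A q" "\<And>q. A (q + v) = A q"
    and B: "\<And>q. (B has_derivative B' q) (at q)" "\<And>w. continuous_on UNIV (\<lambda>q. B' q w)"
      "\<And>q. B (q + u) = B q" "\<And>q. B (q + v) = B q"
    and basis: "u $ 1 * v $ 2 - u $ 2 * v $ 1 > 0"
    and pde0: "\<And>q. dzbar (A' q) = 0"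
    and pde1: "\<And>q. dz (A' q) * \<Lambda> q + dzbar (B' q) * \<Lambda> q + B q * dzbar (\<lambda>w. \<Lambda>' q w) + 3 * A q * dz (\<lambda>w. \<Lambda>' q w) = 0"
    and pde2: "\<And>q. Re (\<Lambda> q * dz (B' q) + 2 * B q * dz (\<lambda>w. \<Lambda>' q w)) = 0"
    and nontrivial: "A q0 \<noteq> 0 \<or> B q0 \<noteq> 0"
  shows "\<exists>d E. d \<noteq> 0 \<and> open E \<and> (\<forall>q\<in>E. \<forall>t. \<Lambda> (q + t *\<^sub>R d) = \<Lambda> q) \<and>
    (\<forall>q. A q = 0 \<or> (\<exists>s. norm s > 1 \<and> crit_poly (A q) (B q) s = 0) \<longrightarrow> q \<in> E)"
proof -
  note Aconst = periodic_holomorphic_constant[OF A basis pde0]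
  have A': "dz (A' q) = 0" for q unfolding Aconst(1) by (simp add: dz_def)
  have pde1': "dzbar (B' q) * \<Lambda> q + B q * dzbar (\<lambda>w. \<Lambda>' q w) + 3 * A 0 * dz (\<lambda>w. \<Lambda>' q w) = 0" for q
    using pde1[of q] unfolding A' by (simp add: Aconst(2)[of q])
  show ?thesis
  proof (cases "A 0 = 0")
    case False
    interpret cubic_pde \<Lambda> \<Lambda>' "A 0" B B' u v
      by unfold_locales (fact \<Lambda> B basis pde1' pde2 False)+
    obtain d where "d \<noteq> 0" "\<forall>q\<in>ell. \<forall>t. \<Lambda> (q + t *\<^sub>R d) = \<Lambda> q" using invariant_direction by blast
    moreover have "q \<in> ell" if "A q = 0 \<or> (\<exists>s. norm s > 1 \<and> crit_poly (A q) (B q) s = 0)" for q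
      using that False unfolding Aconst(2)[of q] by (simp add: ell_def mem_elliptic_coeffs_iff)
    ultimately show ?thesis using open_ell by blast
  next
    case True
    \<comment> \<open>For A = 0 the second equation says that B \<Lambda> is holomorphic; being
      periodic, it is constant.\<close>
    define K where "K q = B q * \<Lambda> q" for q
    define K' where "K' q w = B q * \<Lambda>' q w + B' q w * \<Lambda> q" for q w
    have cB: "continuous_on UNIV B" and c\<Lambda>: "continuous_on UNIV \<Lambda>"
      by (intro continuous_at_imp_continuous_on ballI has_derivative_continuous[OF B(1)]
          has_derivative_continuous[OF \<Lambda>(1)])+
    have K: "(K has_derivative K' q) (at q)" for q
      unfolding K_def K'_def
      using has_derivative_mult[OF B(1) bounded_linear.has_derivative[OF bounded_linear_of_real \<Lambda>(1)]] by simp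
    have cont: "continuous_on UNIV (\<lambda>q. K' q w)" for w
      unfolding K'_def by (intro continuous_intros cB c\<Lambda> B(2) \<Lambda>(2))
    have "dzbar (K' q) = dzbar (B' q) * \<Lambda> q + B q * dzbar (\<lambda>w. \<Lambda>' q w)" for q
      by (simp add: dzbar_def K'_def field_simps)
    then have holo: "dzbar (K' q) = 0" for q using pde1'[of q] True by simp
    note Kconst = periodic_holomorphic_constant[OF K cont _ _ basis holo]
    have Kper: "K (q + u) = K q" "K (q + v) = K q" for q by (simp_all add: K_def B \<Lambda>)
    have K0: "K q = K 0" "K' q = (\<lambda>w. 0)" for q by (rule Kconst; rule Kper)+
    have "K q0 \<noteq> 0" using nontrivial True Aconst(2)[of q0] \<Lambda>(3)[of q0] by (simp add: K_def)
    then have Kne: "K 0 \<noteq> 0" using K0(1)[of q0] by simp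
    define d where "d = (vector [Re (K 0), Im (K 0)] :: real^2)"
    have vd: "vec_complex d = K 0" by (simp add: d_def)
    then have "d \<noteq> 0" using Kne by auto
    \<comment> \<open>Constancy of K eliminates \<open>dz (B' q)\<close> from \<open>pde2\<close>.
      What remains says that K times \<open>lz\<close> has zero real part, which is half the
      derivative of \<Lambda> along d.\<close>
    moreover have "\<Lambda>' q d = 0" for q
    proof -
      define lz where "lz = dz (\<lambda>w. \<Lambda>' q w)"
      have "dz (K' q) = B q * lz + dz (B' q) * \<Lambda> q"
        by (simp add: dz_def K'_def lz_def field_simps)
      then have "\<Lambda> q * dz (B' q) = - (B q * lz)"
        unfolding K0(2) by (simp add: dz_def eq_neg_iff_add_eq_0 mult.commute add.commute)
      then have "Re (B q * lz) = 0" using pde2[of q] by (simp add: lz_def)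
      moreover have "Re (K 0 * lz) = \<Lambda> q * Re (B q * lz)"
        unfolding K0(1)[of q, symmetric] by (simp add: K_def algebra_simps)
      ultimately have re: "Re (K 0 * lz) = 0" by simp
      have lin: "linear (\<lambda>w. complex_of_real (\<Lambda>' q w))"
        using has_derivative_linear[OF bounded_linear.has_derivative[OF bounded_linear_of_real \<Lambda>(1)]] .
      have "cnj lz = dzbar (\<lambda>w. \<Lambda>' q w)" by (simp add: lz_def dz_def dzbar_def)
      then have "complex_of_real (\<Lambda>' q d) = K 0 * lz + cnj (K 0 * lz)"
        using linear_wirtinger[OF lin, of d] by (simp add: vd lz_def)
      also have "\<dots> = 0" unfolding complex_add_cnj re by simp
      finally show ?thesis by simp
    qed
    then have "\<Lambda> (q + t *\<^sub>R d) = \<Lambda> q" for q t by (rule constant_along_line[OF \<Lambda>(1)])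
    ultimately show ?thesis by (intro exI[of _ d] exI[of _ UNIV]) auto
  qed
qed

section \<open>The equations of a cubic integral\<close>

lemma smooth_has_derivative: "smooth f \<Longrightarrow> (f has_derivative frechet_derivative f (at x)) (at x)"
  unfolding smooth_def using Ck.simps(2)[of 0 f] frechet_derivative_works[of f "at x"] by auto

lemma smooth_continuous_frechet: "smooth f \<Longrightarrow> continuous_on UNIV (\<lambda>x. frechet_derivative f (at x) v)"
  unfolding smooth_def using Ck.simps(2)[of 0 f] by auto

lemma matrix_inv_scaleR_mat:
  assumes "(c :: real) \<noteq> 0"
  shows "matrix_inv (c *\<^sub>R mat 1 :: real^'n^'n) = (1 / c) *\<^sub>R mat 1"
proof -
  let ?M = "c *\<^sub>R mat 1 :: real^'n^'n" and ?N = "(1 / c) *\<^sub>R mat 1 :: real^'n^'n"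
  have 1: "?M ** ?N = mat 1" "?N ** ?M = mat 1"
    using assms by (simp_all add: scalar_matrix_assoc[symmetric] matrix_scalar_ac)
  then have "?M ** matrix_inv ?M = mat 1"
    unfolding matrix_inv_def
    using someI_ex[of "\<lambda>X. ?M ** X = mat 1 \<and> X ** ?M = mat 1"] by blast
  then have "(?N ** ?M) ** matrix_inv ?M = ?N"
    by (simp only: matrix_mul_assoc[symmetric] matrix_mul_rid)
  then show ?thesis unfolding 1 matrix_mul_lid .
qed

lemma hamiltonian_conformal:
  assumes "\<And>q. \<rho> q = \<Lambda> q *\<^sub>R mat 1" "\<And>q. \<Lambda> q > 0"
  shows "hamiltonian \<rho> = (\<lambda>(q, p). (p \<bullet> p) / (2 * \<Lambda> q))"
proof -
  have "matrix_inv (\<rho> q) *v p = (1 / \<Lambda> q) *\<^sub>R p" for q p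
    unfolding assms(1) using assms(2)[of q]
    by (simp add: matrix_inv_scaleR_mat scaleR_matrix_vector_assoc[symmetric])
  then show ?thesis by (auto simp: hamiltonian_def fun_eq_iff)
qed

lemma hamiltonian_frechet:
  assumes "\<And>q. \<rho> q = \<Lambda> q *\<^sub>R mat 1" "\<And>q. \<Lambda> q > 0" "\<And>q. (\<Lambda> has_derivative \<Lambda>' q) (at q)"
  shows "frechet_derivative (hamiltonian \<rho>) (at (q, p)) (w, y) =
    (p \<bullet> y) / \<Lambda> q - (p \<bullet> p) * \<Lambda>' q w / (2 * (\<Lambda> q)\<^sup>2)"
proof -
  have L: "((\<lambda>z. \<Lambda> (fst z)) has_derivative (\<lambda>h. \<Lambda>' q (fst h))) (at (q, p))"
    using has_derivative_compose[OF has_derivative_fst[OF has_derivative_ident] assms(3)[of "fst (q, p)"]] by simp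
  have pos: "\<Lambda> q \<noteq> 0" using assms(2)[of q] by simp
  have "((\<lambda>z. (snd z \<bullet> snd z) / (2 * \<Lambda> (fst z))) has_derivative
      (\<lambda>h. (p \<bullet> snd h) / \<Lambda> q - (p \<bullet> p) * \<Lambda>' q (fst h) / (2 * (\<Lambda> q)\<^sup>2))) (at (q, p))"
    using pos
    by (auto intro!: derivative_eq_intros L ext simp: inner_commute field_simps power2_eq_square)
  then have "(hamiltonian \<rho> has_derivative
      (\<lambda>h. (p \<bullet> snd h) / \<Lambda> q - (p \<bullet> p) * \<Lambda>' q (fst h) / (2 * (\<Lambda> q)\<^sup>2))) (at (q, p))"
    by (simp add: hamiltonian_conformal[OF assms(1,2)] case_prod_unfold)
  from frechet_derivative_at[OF this, symmetric] show ?thesis by simp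
qed

lemma quartic_coefficients_zero:
  fixes c0 c1 c2 c3 c4 :: real
  assumes "\<And>x y. c0 * x^4 + c1 * x^3 * y + c2 * x^2 * y^2 + c3 * x * y^3 + c4 * y^4 = 0"
  shows "c0 = 0" "c1 = 0" "c2 = 0" "c3 = 0" "c4 = 0"
  using assms[of 1 0] assms[of 0 1] assms[of 1 1] assms[of 1 "-1"] assms[of 1 2] by simp_all

locale cubic_integral =
  fixes \<Gamma> :: "(real^2) set" and \<rho> :: "real^2 \<Rightarrow> real^2^2" and \<Lambda> :: "real^2 \<Rightarrow> real"
    and F :: "phase \<Rightarrow> real" and b :: "nat \<Rightarrow> real^2 \<Rightarrow> real"
  assumes conf: "conformal_coordinates \<Gamma> \<rho> \<Lambda>" and F: "first_integral \<Gamma> \<rho> F"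
    and b: "\<And>q p. F (q, p) = (\<Sum>k\<le>3. b k q * (p $ 1) ^ (3 - k) * (p $ 2) ^ k)"
begin

lemma pos: "\<Lambda> q > 0" and metric: "\<rho> q = \<Lambda> q *\<^sub>R mat 1" and smooth_\<Lambda>: "smooth \<Lambda>"
  and \<Lambda>_per: "\<gamma> \<in> \<Gamma> \<Longrightarrow> \<Lambda> (q + \<gamma>) = \<Lambda> q"
  using conf by (auto simp: conformal_coordinates_def lattice_periodic_def)

lemma smooth_F: "smooth F"
  using F by (simp add: first_integral_def)

lemma F_per: "\<gamma> \<in> \<Gamma> \<Longrightarrow> F (q + \<gamma>, p) = F (q, p)"
  using F unfolding first_integral_def lattice_periodic_def by blast

lemma poisson_zero: "poisson F (hamiltonian \<rho>) z = 0"
  using F unfolding first_integral_def by blast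

lemma F_eq: "F (q, p) = b 0 q * (p $ 1)^3 + b 1 q * (p $ 1)^2 * p $ 2 + b 2 q * p $ 1 * (p $ 2)^2 + b 3 q * (p $ 2)^3"
  unfolding b by (simp add: numeral_3_eq_3 numeral_2_eq_2)

definition \<Lambda>' where "\<Lambda>' q = frechet_derivative \<Lambda> (at q)"

definition Fq where "Fq p q w = frechet_derivative F (at (q, p)) (w, 0)"

lemma \<Lambda>_deriv: "(\<Lambda> has_derivative \<Lambda>' q) (at q)" and cont_\<Lambda>': "continuous_on UNIV (\<lambda>q. \<Lambda>' q w)"
  using smooth_has_derivative[OF smooth_\<Lambda>] smooth_continuous_frechet[OF smooth_\<Lambda>] by (simp_all add: \<Lambda>'_def)

lemma Fq: "((\<lambda>q. F (q, p)) has_derivative Fq p q) (at q)"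
  using has_derivative_compose[OF has_derivative_Pair[OF has_derivative_ident has_derivative_const[of p]]
      smooth_has_derivative[OF smooth_F]]
  by (simp add: Fq_def[abs_def])

lemma cont_Fq: "continuous_on UNIV (\<lambda>q. Fq p q w)"
  unfolding Fq_def
  by (rule continuous_on_compose2[OF smooth_continuous_frechet[OF smooth_F]]) (auto intro: continuous_intros)

text \<open>Recovers the coefficients of a cubic form from its values at (1, 0), (0, 1), (1, 1), (1,
  -1), so that \<open>b\<close> inherits differentiability and periodicity from F.\<close>

definition coeff_rep :: "(real^2 \<Rightarrow> real) \<Rightarrow> nat \<Rightarrow> real" where
  "coeff_rep \<phi> k = (if k = 0 then \<phi> (vector [1, 0])
    else if k = 1 then (\<phi> (vector [1, 1]) - \<phi> (vector [1, -1])) / 2 - \<phi> (vector [0, 1])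
    else if k = 2 then (\<phi> (vector [1, 1]) + \<phi> (vector [1, -1])) / 2 - \<phi> (vector [1, 0])
    else \<phi> (vector [0, 1]))"

definition b' where "b' k q w = coeff_rep (\<lambda>p. Fq p q w) k"

lemma b_rep: "k \<le> 3 \<Longrightarrow> b k q = coeff_rep (\<lambda>p. F (q, p)) k"
  by (cases "k = 3") (auto simp: coeff_rep_def F_eq vector_2 le_Suc_eq numeral_3_eq_3 numeral_2_eq_2 add_divide_distrib)

lemma b_deriv: "k \<le> 3 \<Longrightarrow> (b k has_derivative b' k q) (at q)"
proof -
  assume k: "k \<le> 3"
  have "((\<lambda>q. coeff_rep (\<lambda>p. F (q, p)) k) has_derivative b' k q) (at q)"
    unfolding b'_def coeff_rep_def
    by (cases "k = 0"; cases "k = 1"; cases "k = 2")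
       (auto intro!: derivative_eq_intros Fq)
  moreover have "b k = (\<lambda>q. coeff_rep (\<lambda>p. F (q, p)) k)" using b_rep[OF k] by blast
  ultimately show ?thesis by simp
qed

lemma cont_b': "continuous_on UNIV (\<lambda>q. b' k q w)"
  unfolding b'_def coeff_rep_def
  by (cases "k = 0"; cases "k = 1"; cases "k = 2") (auto intro!: continuous_intros cont_Fq)

lemma b_per: "k \<le> 3 \<Longrightarrow> \<gamma> \<in> \<Gamma> \<Longrightarrow> b k (q + \<gamma>) = b k q"
  by (simp add: b_rep F_per)

lemma Fq_eq: "Fq p q w = b' 0 q w * (p $ 1)^3 + b' 1 q w * (p $ 1)^2 * p $ 2 + b' 2 q w * p $ 1 * (p $ 2)^2 + b' 3 q w * (p $ 2)^3"
proof -
  have "((\<lambda>q. F (q, p)) has_derivative (\<lambda>w. b' 0 q w * (p $ 1)^3 + b' 1 q w * (p $ 1)^2 * p $ 2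
      + b' 2 q w * p $ 1 * (p $ 2)^2 + b' 3 q w * (p $ 2)^3)) (at q)"
    unfolding F_eq by (auto intro!: derivative_eq_intros b_deriv simp: algebra_simps)
  from fun_cong[OF has_derivative_unique[OF Fq this], of w] show ?thesis .
qed

lemma Fp_eq: "frechet_derivative F (at (q, p)) (0, w) =
    b 0 q * (3 * (p $ 1)^2 * w $ 1) + b 1 q * (2 * p $ 1 * w $ 1 * p $ 2 + (p $ 1)^2 * w $ 2)
    + b 2 q * (w $ 1 * (p $ 2)^2 + p $ 1 * (2 * p $ 2 * w $ 2)) + b 3 q * (3 * (p $ 2)^2 * w $ 2)"
proof -
  have "((\<lambda>p. F (q, p)) has_derivative (\<lambda>w. frechet_derivative F (at (q, p)) (0, w))) (at p)"
    using has_derivative_compose[OF has_derivative_Pair[OF has_derivative_const[of q] has_derivative_ident]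
      smooth_has_derivative[OF smooth_F]] by simp
  moreover have "((\<lambda>p. F (q, p)) has_derivative (\<lambda>w. b 0 q * (3 * (p $ 1)^2 * w $ 1)
    + b 1 q * (2 * p $ 1 * w $ 1 * p $ 2 + (p $ 1)^2 * w $ 2)
    + b 2 q * (w $ 1 * (p $ 2)^2 + p $ 1 * (2 * p $ 2 * w $ 2)) + b 3 q * (3 * (p $ 2)^2 * w $ 2))) (at p)"
    unfolding F_eq
    by (auto intro!: derivative_eq_intros bounded_linear_imp_has_derivative[OF bounded_linear_vec_nth]
        simp: algebra_simps)
  ultimately show ?thesis by (rule fun_cong[OF has_derivative_unique])
qed

section \<open>The Poisson bracket as a quartic form in the momenta\<close>

lemma bracket:
  "(2 * \<Lambda> q * (p $ 1 * Fq p q (axis 1 1) + p $ 2 * Fq p q (axis 2 1))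
   + (p \<bullet> p) * (\<Lambda>' q (axis 1 1) * frechet_derivative F (at (q, p)) (0, axis 1 1)
     + \<Lambda>' q (axis 2 1) * frechet_derivative F (at (q, p)) (0, axis 2 1))) = 0"
proof -
  have nz: "\<Lambda> q \<noteq> 0" using pos[of q] by simp
  have lin: "\<Lambda>' q 0 = 0" using linear_0[OF has_derivative_linear[OF \<Lambda>_deriv]] .
  have "(\<Sum>i\<in>UNIV. Fq p q (axis i 1) * (p \<bullet> axis i 1 / \<Lambda> q)
     + frechet_derivative F (at (q, p)) (0, axis i 1) * ((p \<bullet> p) * \<Lambda>' q (axis i 1) / (2 * (\<Lambda> q)\<^sup>2))) = 0"
    using poisson_zero[of "(q, p)"]
    by (simp add: poisson_def hamiltonian_frechet[OF metric pos \<Lambda>_deriv] Fq_def lin)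
  moreover have "2 * (\<Lambda> q)\<^sup>2 * (\<Sum>i\<in>UNIV. Fq p q (axis i 1) * (p \<bullet> axis i 1 / \<Lambda> q)
     + frechet_derivative F (at (q, p)) (0, axis i 1) * ((p \<bullet> p) * \<Lambda>' q (axis i 1) / (2 * (\<Lambda> q)\<^sup>2)))
    = 2 * \<Lambda> q * (p $ 1 * Fq p q (axis 1 1) + p $ 2 * Fq p q (axis 2 1))
   + (p \<bullet> p) * (\<Lambda>' q (axis 1 1) * frechet_derivative F (at (q, p)) (0, axis 1 1)
     + \<Lambda>' q (axis 2 1) * frechet_derivative F (at (q, p)) (0, axis 2 1))"
    using nz by (simp add: sum_2 inner_axis field_simps power2_eq_square)
  ultimately show ?thesis by (simp only: mult_zero_right)
qed

text \<open>\<open>g0\<close>, \<open>g1\<close>, \<open>g2\<close> are the coefficients of the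
  quadratic form pairing the derivatives of \<Lambda> with the momentum derivatives of F; its
  product with p1^2 + p2^2 explains the sum \<open>g0 + g2\<close> in the middle equation.\<close>

lemma real_equations:
  fixes q
  defines "b1 k \<equiv> b' k q (axis 1 1)" and "b2 k \<equiv> b' k q (axis 2 1)"
    and "l1 \<equiv> \<Lambda>' q (axis 1 1)" and "l2 \<equiv> \<Lambda>' q (axis 2 1)"
  defines "g0 \<equiv> 3 * l1 * b 0 q + l2 * b 1 q" and "g1 \<equiv> 2 * l1 * b 1 q + 2 * l2 * b 2 q"
    and "g2 \<equiv> l1 * b 2 q + 3 * l2 * b 3 q"
  shows "2 * \<Lambda> q * b1 0 + g0 = 0" "2 * \<Lambda> q * (b1 1 + b2 0) + g1 = 0"
    "2 * \<Lambda> q * (b1 2 + b2 1) + g0 + g2 = 0" "2 * \<Lambda> q * (b1 3 + b2 2) + g1 = 0"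
    "2 * \<Lambda> q * b2 3 + g2 = 0"
proof -
  have "(2 * \<Lambda> q * b1 0 + g0) * x^4 + (2 * \<Lambda> q * (b1 1 + b2 0) + g1) * x^3 * y
    + (2 * \<Lambda> q * (b1 2 + b2 1) + g0 + g2) * x^2 * y^2 + (2 * \<Lambda> q * (b1 3 + b2 2) + g1) * x * y^3
    + (2 * \<Lambda> q * b2 3 + g2) * y^4 = 0" for x y
    using bracket[of q "vector [x, y]"]
    unfolding Fq_eq Fp_eq b1_def[symmetric] b2_def[symmetric] l1_def[symmetric] l2_def[symmetric]
    by (simp add: vector_2 axis_def inner_vec_def sum_2 g0_def g1_def g2_def)
       (simp add: algebra_simps power2_eq_square power3_eq_cube power4_eq_xxxx)
  from quartic_coefficients_zero[OF this]
  show "2 * \<Lambda> q * b1 0 + g0 = 0" "2 * \<Lambda> q * (b1 1 + b2 0) + g1 = 0"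
    "2 * \<Lambda> q * (b1 2 + b2 1) + g0 + g2 = 0" "2 * \<Lambda> q * (b1 3 + b2 2) + g1 = 0"
    "2 * \<Lambda> q * b2 3 + g2 = 0" by blast+
qed

text \<open>With \<open>x = p\<^sub>1 - i p\<^sub>2\<close> the integral is twice the real part of
  \<open>A x\<^sup>3 + B x\<^sup>2 (cnj x)\<close>.\<close>

definition A where "A q = Complex (b 0 q - b 2 q) (b 1 q - b 3 q) / 8"
definition B where "B q = Complex (3 * b 0 q + b 2 q) (b 1 q + 3 * b 3 q) / 8"
definition A' where "A' q w = Complex (b' 0 q w - b' 2 q w) (b' 1 q w - b' 3 q w) / 8"
definition B' where "B' q w = Complex (3 * b' 0 q w + b' 2 q w) (b' 1 q w + 3 * b' 3 q w) / 8"

lemma F_complex: "F (q, p) = 2 * Re (A q * cnj (vec_complex p) ^ 3 + B q * cnj (vec_complex p) ^ 2 * vec_complex p)"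
  unfolding F_eq
  by (simp add: A_def B_def vec_complex_def power2_eq_square power3_eq_cube field_simps)

lemma A_deriv: "(A has_derivative A' q) (at q)" and B_deriv: "(B has_derivative B' q) (at q)"
  unfolding A_def A'_def B_def B'_def Complex_eq
  by (auto intro!: derivative_eq_intros b_deriv bounded_linear.has_derivative[OF bounded_linear_of_real])

lemma cont_A': "continuous_on UNIV (\<lambda>q. A' q w)" and cont_B': "continuous_on UNIV (\<lambda>q. B' q w)"
  unfolding A'_def B'_def Complex_eq by (intro continuous_intros cont_b'; simp)+

lemma A_per: "\<gamma> \<in> \<Gamma> \<Longrightarrow> A (q + \<gamma>) = A q" and B_per: "\<gamma> \<in> \<Gamma> \<Longrightarrow> B (q + \<gamma>) = B q"
  by (simp_all add: A_def B_def b_per)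

text \<open>Combinations of \<open>real_equations\<close>: up to factors, the coefficients of x^4,
  x^3 (cnj x) and x^2 (cnj x)^2 in the bracket.\<close>

lemma pde:
  "dzbar (A' q) = 0"
  "dz (A' q) * \<Lambda> q + dzbar (B' q) * \<Lambda> q + B q * dzbar (\<lambda>w. \<Lambda>' q w) + 3 * A q * dz (\<lambda>w. \<Lambda>' q w) = 0"
  "Re (\<Lambda> q * dz (B' q) + 2 * B q * dz (\<lambda>w. \<Lambda>' q w)) = 0"
proof -
  note r = real_equations[of q]
  \<comment> \<open>In these alternating sums the terms \<open>g0\<close>, \<open>g1\<close>,
    \<open>g2\<close> cancel, so no derivative of \<Lambda> survives.\<close>
  have "2 * \<Lambda> q * (b' 0 q (axis 1 1) - b' 2 q (axis 1 1) - b' 1 q (axis 2 1) + b' 3 q (axis 2 1)) = 0"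
    using r(1,3,5) by (simp add: algebra_simps)
  moreover have "2 * \<Lambda> q * (b' 1 q (axis 1 1) + b' 0 q (axis 2 1) - b' 3 q (axis 1 1) - b' 2 q (axis 2 1)) = 0"
    using r(2,4) by (simp add: algebra_simps)
  ultimately show "dzbar (A' q) = 0"
    using pos[of q] by (simp add: dzbar_def A'_def complex_eq_iff add_divide_distrib[symmetric])
  define b1 b2 l1 l2 where "b1 k = b' k q (axis 1 1)" and "b2 k = b' k q (axis 2 1)"
    and "l1 = \<Lambda>' q (axis 1 1)" and "l2 = \<Lambda>' q (axis 2 1)" for k
  note folds = b1_def[symmetric] b2_def[symmetric] l1_def[symmetric] l2_def[symmetric]
  define g0 g1 g2 where "g0 = 3 * l1 * b 0 q + l2 * b 1 q" and "g1 = 2 * l1 * b 1 q + 2 * l2 * b 2 q"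
    and "g2 = l1 * b 2 q + 3 * l2 * b 3 q"
  note r = r[unfolded folds, folded g0_def g1_def g2_def]
  let ?E = "dz (A' q) * \<Lambda> q + dzbar (B' q) * \<Lambda> q + B q * dzbar (\<lambda>w. \<Lambda>' q w) + 3 * A q * dz (\<lambda>w. \<Lambda>' q w)"
  have "16 * Re ?E = 2 * (2 * \<Lambda> q * b1 0 + g0) - 2 * (2 * \<Lambda> q * b2 3 + g2)"
    by (simp add: dzbar_def dz_def A'_def B'_def A_def B_def folds g0_def g2_def) (simp add: field_simps)
  moreover have "16 * Im ?E = (2 * \<Lambda> q * (b1 1 + b2 0) + g1) + (2 * \<Lambda> q * (b1 3 + b2 2) + g1)"
    by (simp add: dzbar_def dz_def A'_def B'_def A_def B_def folds g1_def) (simp add: field_simps)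
  ultimately show "?E = 0" unfolding r by (simp add: complex_eq_iff)
  have "16 * Re (\<Lambda> q * dz (B' q) + 2 * B q * dz (\<lambda>w. \<Lambda>' q w)) =
      3 / 2 * (2 * \<Lambda> q * b1 0 + g0) + 3 / 2 * (2 * \<Lambda> q * b2 3 + g2) + 1 / 2 * (2 * \<Lambda> q * (b1 2 + b2 1) + g0 + g2)"
    by (simp add: dz_def B'_def B_def folds g0_def g2_def) (simp add: field_simps)
  then show "Re (\<Lambda> q * dz (B' q) + 2 * B q * dz (\<lambda>w. \<Lambda>' q w)) = 0" unfolding r by simp
qed

end

section \<open>Real analytic functions and lattices\<close>

text \<open>After division by the lowest power with nonzero coefficient the limit at 0 is nonzero,
  so there are no zeros near 0 other than possibly 0.\<close>

lemma powser_frequently_zero: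
  fixes a :: "nat \<Rightarrow> 'a::{real_normed_field,banach}"
  assumes r: "r > 0" and sums: "\<And>h. norm h < r \<Longrightarrow> (\<lambda>n. a n * h ^ n) sums f h"
    and zero: "\<exists>\<^sub>F h in at 0. f h = 0"
  shows "a n = 0"
proof (rule ccontr)
  assume "a n \<noteq> 0"
  define m where "m = (LEAST n. a n \<noteq> 0)"
  have m: "a m \<noteq> 0" and less: "\<And>k. k < m \<Longrightarrow> a k = 0"
    unfolding m_def using \<open>a n \<noteq> 0\<close> by (rule LeastI) (use not_less_Least in blast)
  have "((\<lambda>h. f h / h ^ m) \<longlongrightarrow> a (0 + m)) (at 0)"
  proof (rule powser_limit_0_strong[OF r, where a = "\<lambda>n. a (n + m)"])
    fix h :: 'a assume h: "h \<noteq> 0" "norm h < r"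
    have "(\<lambda>n. a (n + m) * h ^ (n + m)) sums (f h - (\<Sum>i<m. a i * h ^ i))"
      using sums[OF h(2)] by (rule sums_split_initial_segment)
    then have "(\<lambda>n. a (n + m) * h ^ (n + m) / h ^ m) sums (f h / h ^ m)"
      using less by (intro sums_divide) simp
    then show "(\<lambda>n. a (n + m) * h ^ n) sums (f h / h ^ m)"
      using h(1) by (simp add: power_add)
  qed
  then have "\<forall>\<^sub>F h in at 0. f h / h ^ m \<noteq> 0"
    using m by (intro tendsto_imp_eventually_ne) auto
  then have "\<forall>\<^sub>F h in at 0. f h \<noteq> 0" by eventually_elim auto
  then show False using zero by (simp add: frequently_def)
qed

text \<open>The double series is regrouped by total degree n = i + j.\<close>

lemma powser_on_line:
  assumes sum: "((\<lambda>(i, j). c i j * (t * e1) ^ i * (t * e2) ^ j) has_sum s) UNIV"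
  shows "(\<lambda>n. (\<Sum>i\<le>n. c i (n - i) * e1 ^ i * e2 ^ (n - i)) * t ^ n) sums (s :: real)"
proof -
  have bij: "bij_betw (\<lambda>(n, i). (i, n - i)) (SIGMA n:UNIV. {..n}) (UNIV :: (nat \<times> nat) set)"
    by (rule bij_betwI[where g = "\<lambda>(i, j). (i + j, i)"]) auto
  have "((\<lambda>x. case (case x of (n, i) \<Rightarrow> (i, n - i)) of (i, j) \<Rightarrow> c i j * (t * e1) ^ i * (t * e2) ^ j) has_sum s)
      (SIGMA n:UNIV. {..n})"
    using has_sum_reindex_bij_betw[OF bij] sum by blast
  then have "((\<lambda>n. \<Sum>i\<le>n. c i (n - i) * (t * e1) ^ i * (t * e2) ^ (n - i)) has_sum s) UNIV"
    by (rule has_sum_SigmaD) (auto intro: has_sum_finite)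
  moreover have "(\<Sum>i\<le>n. c i (n - i) * (t * e1) ^ i * (t * e2) ^ (n - i)) =
      (\<Sum>i\<le>n. c i (n - i) * e1 ^ i * e2 ^ (n - i)) * t ^ n" for n
    unfolding sum_distrib_right
  proof (rule sum.cong[OF refl])
    fix i assume "i \<in> {..n}"
    then have "t ^ n = t ^ i * t ^ (n - i)" by (simp flip: power_add)
    then show "c i (n - i) * (t * e1) ^ i * (t * e2) ^ (n - i) = c i (n - i) * e1 ^ i * e2 ^ (n - i) * t ^ n"
      by (simp add: power_mult_distrib mult_ac)
  qed
  ultimately show ?thesis by (simp add: has_sum_imp_sums)
qed

lemma real_analytic_line:
  assumes "real_analytic f"
  shows "\<exists>a r. r > 0 \<and> (\<forall>h. \<bar>h\<bar> < r \<longrightarrow> (\<lambda>n. a n * h ^ n) sums f (p + h *\<^sub>R e))"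
proof -
  obtain c r where r: "r > 0" and c: "\<And>h::real^2. norm h < r \<Longrightarrow>
      ((\<lambda>(i, j). c i j * (h $ 1) ^ i * (h $ 2) ^ j) has_sum f (p + h)) UNIV"
    using assms unfolding real_analytic_def by meson
  \<comment> \<open>Adding 1 keeps the radius positive even for e = 0.\<close>
  define r' where "r' = r / (norm e + 1)"
  have r': "r' > 0" using r by (simp add: r'_def add_nonneg_pos)
  have "(\<lambda>n. (\<Sum>i\<le>n. c i (n - i) * (e $ 1) ^ i * (e $ 2) ^ (n - i)) * h ^ n) sums f (p + h *\<^sub>R e)"
    if "\<bar>h\<bar> < r'" for h
  proof (rule powser_on_line)
    have "norm (h *\<^sub>R e) \<le> \<bar>h\<bar> * (norm e + 1)" by (simp add: mult_left_mono)
    also have "\<dots> < r' * (norm e + 1)"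
      using that by (intro mult_strict_right_mono) (auto simp: add_nonneg_pos)
    also have "\<dots> = r" by (simp add: r'_def add_nonneg_eq_0_iff)
    finally show "((\<lambda>(i, j). c i j * (h * e $ 1) ^ i * (h * e $ 2) ^ j) has_sum f (p + h *\<^sub>R e)) UNIV"
      using c[of "h *\<^sub>R e"] by simp
  qed
  then show ?thesis using r' by meson
qed

text \<open>Identity theorem on the line through q0 and q: the set Z of parameters near which the
  difference g vanishes is open, closed and contains 0.\<close>

lemma real_analytic_translation_invariant:
  assumes f: "real_analytic f" and E: "open E" "q0 \<in> E" and inv: "\<And>q. q \<in> E \<Longrightarrow> f (q + v) = f q"
  shows "f (q + v) = f q"
proof -
  define e where "e = q - q0"
  define g where "g t = f (q0 + t *\<^sub>R e + v) - f (q0 + t *\<^sub>R e)" for t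
  define Z where "Z = {t. \<forall>\<^sub>F s in nhds t. g s = 0}"
  have "open Z"
    unfolding Z_def open_subopen[of "{t. \<forall>\<^sub>F s in nhds t. g s = 0}"]
    by (auto simp: eventually_nhds)
  moreover have "t \<in> Z" if t: "t \<in> closure Z" for t
  proof -
    obtain a r where r: "r > 0" and a: "\<And>h. \<bar>h\<bar> < r \<Longrightarrow> (\<lambda>n. a n * h ^ n) sums f (q0 + t *\<^sub>R e + v + h *\<^sub>R e)"
      using real_analytic_line[OF f] by meson
    obtain a' r' where r': "r' > 0" and a': "\<And>h. \<bar>h\<bar> < r' \<Longrightarrow> (\<lambda>n. a' n * h ^ n) sums f (q0 + t *\<^sub>R e + h *\<^sub>R e)"
      using real_analytic_line[OF f] by meson
    have sums: "(\<lambda>n. (a n - a' n) * h ^ n) sums g (t + h)" if "norm h < min r r'" for h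
      using sums_diff[OF a a', of h h] that
      by (simp add: g_def algebra_simps)
    have "\<exists>\<^sub>F h in at 0. g (t + h) = 0"
      unfolding frequently_at
    proof (intro allI impI)
      fix d :: real assume d: "d > 0"
      then obtain z where z: "z \<in> Z" "dist z t < d / 2"
        using t unfolding closure_approachable by (meson half_gt_zero)
      then obtain \<epsilon> where \<epsilon>: "\<epsilon> > 0" "\<And>s. dist s z < \<epsilon> \<Longrightarrow> g s = 0"
        unfolding Z_def eventually_nhds_metric by auto
      \<comment> \<open>A frequent zero has to differ from the centre t, so for z = t a neighbouring
        zero is taken.\<close>
      define s where "s = (if z = t then t + min \<epsilon> d / 2 else z)"
      have "g s = 0" "s \<noteq> t" "dist s t < d"
        using z \<epsilon> d by (auto simp: s_def dist_real_def)
      then show "\<exists>h\<in>UNIV. h \<noteq> 0 \<and> dist h 0 < d \<and> g (t + h) = 0"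
        by (intro bexI[of _ "s - t"]) (auto simp: dist_real_def)
    qed
    then have zero: "a n - a' n = 0" for n
      using powser_frequently_zero[of "min r r'" "\<lambda>n. a n - a' n" "\<lambda>h. g (t + h)"] r r' sums by simp
    have "g s = 0" if "dist s t < min r r'" for s
    proof -
      have "(\<lambda>n. 0) sums g (t + (s - t))"
        using sums[of "s - t"] that unfolding zero by (simp add: dist_real_def)
      then show ?thesis using sums_unique2[OF sums_zero] by simp
    qed
    then show "t \<in> Z" unfolding Z_def eventually_nhds_metric using r r' by (auto intro!: exI[of _ "min r r'"])
  qed
  then have "closed Z" unfolding closure_subset_eq[symmetric] by (rule subsetI)
  ultimately have "Z = {} \<or> Z = UNIV" using clopen[of Z] by simp
  moreover have "0 \<in> Z"
  proof -
    have "continuous_on UNIV (\<lambda>t. q0 + t *\<^sub>R e)" by (intro continuous_intros)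
    then have "open ((\<lambda>t. q0 + t *\<^sub>R e) -` E)" using E(1) by (intro open_vimage)
    then show ?thesis
      unfolding Z_def eventually_nhds using E(2) inv
      by (auto simp: g_def intro!: exI[of _ "(\<lambda>t. q0 + t *\<^sub>R e) -` E"])
  qed
  ultimately have "1 \<in> Z" by blast
  then have "g 1 = 0" unfolding Z_def using eventually_nhds_x_imp_x by fastforce
  then show ?thesis by (simp add: g_def e_def)
qed

text \<open>Independent generators have nonzero determinant, and exchanging them changes its
  sign.\<close>

lemma lattice_basis:
  assumes "lattice \<Gamma>"
  shows "\<exists>u v. u \<in> \<Gamma> \<and> v \<in> \<Gamma> \<and> u $ 1 * v $ 2 - u $ 2 * v $ 1 > 0"
proof -
  obtain u v where uv: "u \<noteq> v" "independent {u, v}" and \<Gamma>: "\<Gamma> = {of_int i *\<^sub>R u + of_int j *\<^sub>R v | i j. True}"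
    using assms unfolding lattice_def by blast
  have "u = of_int 1 *\<^sub>R u + of_int 0 *\<^sub>R v" "v = of_int 0 *\<^sub>R u + of_int 1 *\<^sub>R v" by simp_all
  then have mem: "u \<in> \<Gamma>" "v \<in> \<Gamma>" unfolding \<Gamma> by blast+
  have "u $ 1 * v $ 2 - u $ 2 * v $ 1 \<noteq> 0"
  proof
    assume det: "u $ 1 * v $ 2 - u $ 2 * v $ 1 = 0"
    have u: "u \<noteq> 0" using uv(2) dependent_zero[of "{u, v}"] by auto
    then obtain i where i: "u $ i \<noteq> 0" by (auto simp: vec_eq_iff)
    have "v $ i * u $ j = u $ i * v $ j" for j
      using det exhaust_2[of i] exhaust_2[of j] by (auto simp: mult_ac)
    then have "v = (v $ i / u $ i) *\<^sub>R u" using i by (simp add: vec_eq_iff field_simps)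
    then have "v \<in> span {u}" by (metis span_base span_scale singletonI)
    then have "v \<in> span ({u, v} - {v})" using uv(1) by (simp add: insert_Diff_if)
    then show False using uv(2) unfolding dependent_def by blast
  qed
  then have "u $ 1 * v $ 2 - u $ 2 * v $ 1 > 0 \<or> v $ 1 * u $ 2 - v $ 2 * u $ 1 > 0" by (auto simp: mult_ac)
  then show ?thesis using mem by blast
qed

section \<open>Elliptic points\<close>

text \<open>Substituting \<mu> = a2 w turns the characteristic equation into x f_y - y f_x = 0 at
  (1, w) for f = a0 x^3 + a1 x^2 y + a2 x y^2 + y^3: eigenvalues correspond to critical points of f
  on the circle.\<close>

lemma elliptic_matrix_nonreal_root:
  assumes ell: "elliptic_matrix (A_matrix (vector [a0, a1, a2]))" and a2: "a2 \<noteq> 0"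
  shows "\<exists>w::complex. Im w \<noteq> 0 \<and> - a2 * w^3 + (3 - 2 * a1) * w^2 + (2 * a2 - 3 * a0) * w + a1 = 0"
proof -
  obtain \<mu> v where \<mu>: "\<mu> \<notin> \<real>" and v: "v \<noteq> 0"
    and eig: "map_matrix complex_of_real (A_matrix (vector [a0, a1, a2])) *v v = \<mu> *s v"
    using ell unfolding elliptic_matrix_def complex_eigenvalues_def by blast
  have e1: "a1 * v $ 3 = \<mu> * v $ 1"
    and e2: "a2 * v $ 1 + (2 * a2 - 3 * a0) * v $ 3 = \<mu> * v $ 2"
    and e3: "a2 * v $ 2 + (3 - 2 * a1) * v $ 3 = \<mu> * v $ 3"
    using arg_cong[OF eig, of "\<lambda>x. x $ 1"] arg_cong[OF eig, of "\<lambda>x. x $ 2"] arg_cong[OF eig, of "\<lambda>x. x $ 3"]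
    by (simp_all add: A_matrix_def Let_def matrix_vector_mult_def sum_3 vector_3 map_matrix_def)
  define x0 x1 x2 where "x0 = complex_of_real a0" and "x1 = complex_of_real a1" and "x2 = complex_of_real a2"
  note folds = of_real_diff of_real_mult of_real_numeral of_real_minus x0_def[symmetric] x1_def[symmetric] x2_def[symmetric]
  note e1 = e1[unfolded folds] and e2 = e2[unfolded folds] and e3 = e3[unfolded folds]
  have \<mu>0: "\<mu> \<noteq> 0" using \<mu> by auto
  have "v $ 3 \<noteq> 0"
  proof
    assume "v $ 3 = 0"
    then have "v $ 1 = 0" using e1 \<mu>0 by simp
    moreover then have "v $ 2 = 0" using e2 \<mu>0 \<open>v $ 3 = 0\<close> by simp
    ultimately show False using v \<open>v $ 3 = 0\<close> by (simp add: vec_eq_iff forall_3)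
  qed
  \<comment> \<open>Eliminating the first two components of the eigenvector yields the
    characteristic polynomial.\<close>
  moreover have "v $ 3 * (\<mu>^3 - (3 - 2 * x1) * \<mu>^2 - x2 * (2 * x2 - 3 * x0) * \<mu> - x1 * x2^2) = 0"
    using e1 e2 e3 by algebra
  ultimately have char: "\<mu>^3 - (3 - 2 * x1) * \<mu>^2 - x2 * (2 * x2 - 3 * x0) * \<mu> - x1 * x2^2 = 0" by simp
  define w where "w = \<mu> / x2"
  have x2: "x2 \<noteq> 0" using a2 by (simp add: x2_def)
  then have w: "\<mu> = x2 * w" by (simp add: w_def)
  have "x2^2 * (- x2 * w^3 + (3 - 2 * x1) * w^2 + (2 * x2 - 3 * x0) * w + x1) = 0"
    using char unfolding w by algebra
  then have "- x2 * w^3 + (3 - 2 * x1) * w^2 + (2 * x2 - 3 * x0) * w + x1 = 0" using x2 by simp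
  moreover have "Im w \<noteq> 0" using \<mu> a2 by (simp add: w_def x2_def complex_is_Real_iff)
  ultimately show ?thesis by (intro exI[of _ w]) (simp add: x0_def x1_def x2_def)
qed

text \<open>Here \<mu> (x + \<epsilon> y) is the complex momentum in an orthonormal frame,
  \<epsilon> being i or -i by orientation. The complex point (1, w) corresponds to s = X / Y, off
  the unit circle because w is not real.\<close>

lemma nonreal_critical_point:
  fixes A B \<mu> \<epsilon> w :: complex and c a0 a1 a2 a3 :: real
  assumes \<epsilon>: "\<epsilon>\<^sup>2 = -1" and \<mu>: "\<mu> \<noteq> 0" and c: "c \<noteq> 0"
    and form: "\<And>x y::real. c * (2 * Re (A * (\<mu> * (x + \<epsilon> * y))^3 + B * (\<mu> * (x + \<epsilon> * y))^2 * cnj (\<mu> * (x + \<epsilon> * y))))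
      = a0 * x^3 + a1 * x^2 * y + a2 * x * y^2 + a3 * y^3"
    and w: "Im w \<noteq> 0" "- a2 * w^3 + (3 * a3 - 2 * a1) * w^2 + (2 * a2 - 3 * a0) * w + a1 = 0"
  shows "A = 0 \<or> (\<exists>s. norm s > 1 \<and> crit_poly A B s = 0)"
proof -
  have "(\<epsilon> - \<i>) * (\<epsilon> + \<i>) = 0" using \<epsilon> by (simp add: algebra_simps power2_eq_square)
  then have "\<epsilon> = \<i> \<or> \<epsilon> = - \<i>" by (auto simp: eq_neg_iff_add_eq_0)
  then have c\<epsilon>: "cnj \<epsilon> = - \<epsilon>" and re: "Re (\<epsilon> * z) = Im z \<or> Re (\<epsilon> * z) = - Im z" for z by auto
  define A1 B1 where "A1 = c * A * \<mu>^3" and "B1 = c * B * \<mu>^2 * cnj \<mu>"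
  \<comment> \<open>Writing the conjugate factor as x - \<epsilon> y makes f a polynomial whose
    coefficients can be compared with \<open>a0\<close> to \<open>a3\<close>.\<close>
  define f where "f x y = A1 * (x + \<epsilon> * y)^3 + B1 * (x + \<epsilon> * y)^2 * (x - \<epsilon> * y)
      + cnj B1 * (x + \<epsilon> * y) * (x - \<epsilon> * y)^2 + cnj A1 * (x - \<epsilon> * y)^3" for x y :: complex
  have f: "f x y = a0 * x^3 + a1 * x^2 * y + a2 * x * y^2 + a3 * y^3" for x y :: real
  proof -
    define X Z where "X = x + \<epsilon> * y" and "Z = x - \<epsilon> * y"
    have cX: "cnj X = Z" by (simp add: X_def Z_def c\<epsilon>)
    define V where "V = A * (\<mu> * X)^3 + B * (\<mu> * X)^2 * cnj (\<mu> * X)"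
    have "f x y = c * V + cnj (c * V)"
      unfolding f_def X_def[symmetric] Z_def[symmetric] V_def
      by (simp add: A1_def B1_def cX power_mult_distrib ring_distribs mult_ac)
        (simp flip: cX)
    also have "\<dots> = of_real (c * (2 * Re V))"
      unfolding complex_add_cnj by simp
    finally show ?thesis unfolding V_def X_def form by simp
  qed
  define b1 b2 where "b1 = cnj A1" and "b2 = cnj B1"
  define x0 x1 x2 x3 where "x0 = complex_of_real a0" and "x1 = complex_of_real a1"
    and "x2 = complex_of_real a2" and "x3 = complex_of_real a3"
  note f = f[unfolded f_def of_real_add of_real_mult of_real_power, folded b1_def b2_def x0_def x1_def x2_def x3_def]
  \<comment> \<open>Values at (1, 0), (0, 1), (1, 1), (1, -1) determine the four
    coefficients.\<close>
  have f10: "A1 + B1 + b2 + b1 = x0" using f[of 1 0] by simp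
  have f01: "A1 * \<epsilon>^3 - B1 * \<epsilon>^3 + b2 * \<epsilon>^3 - b1 * \<epsilon>^3 = x3"
    using f[of 0 1] by (simp add: power2_eq_square power3_eq_cube mult_ac)
  have f11: "A1 * (1 + \<epsilon>)^3 + B1 * (1 + \<epsilon>)^2 * (1 - \<epsilon>) + b2 * (1 + \<epsilon>) * (1 - \<epsilon>)^2 + b1 * (1 - \<epsilon>)^3 = x0 + x1 + x2 + x3"
    using f[of 1 1] by simp
  have f1m: "A1 * (1 - \<epsilon>)^3 + B1 * (1 - \<epsilon>)^2 * (1 + \<epsilon>) + b2 * (1 - \<epsilon>) * (1 + \<epsilon>)^2 + b1 * (1 + \<epsilon>)^3 = x0 - x1 + x2 - x3"
    using f[of 1 "-1"] by simp
  have e2: "\<epsilon> * \<epsilon> + 1 = 0" using \<epsilon> by (simp add: power2_eq_square)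
  have cube: "(1 + \<epsilon> * w)^3 = 1 + 3 * \<epsilon> * w - 3 * w^2 - \<epsilon> * w^3"
    and cube': "(1 - \<epsilon> * w)^3 = 1 - 3 * \<epsilon> * w - 3 * w^2 + \<epsilon> * w^3"
    and square: "(1 + \<epsilon> * w)^2 * (1 - \<epsilon> * w) = (1 + w^2) * (1 + \<epsilon> * w)"
    and square': "(1 + \<epsilon> * w) * (1 - \<epsilon> * w)^2 = (1 + w^2) * (1 - \<epsilon> * w)" for w
  proof -
    have "(1 + \<epsilon> * w)^3 - (1 + 3 * \<epsilon> * w - 3 * w^2 - \<epsilon> * w^3) = (\<epsilon> * \<epsilon> + 1) * (3 * w^2 + \<epsilon> * w^3)"
      "(1 - \<epsilon> * w)^3 - (1 - 3 * \<epsilon> * w - 3 * w^2 + \<epsilon> * w^3) = (\<epsilon> * \<epsilon> + 1) * (3 * w^2 - \<epsilon> * w^3)"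
      "(1 + \<epsilon> * w)^2 * (1 - \<epsilon> * w) - (1 + w^2) * (1 + \<epsilon> * w) = (\<epsilon> * \<epsilon> + 1) * (w^2 * (- 1 - \<epsilon> * w))"
      "(1 + \<epsilon> * w) * (1 - \<epsilon> * w)^2 - (1 + w^2) * (1 - \<epsilon> * w) = (\<epsilon> * \<epsilon> + 1) * (w^2 * (\<epsilon> * w - 1))"
      by algebra+
    then show "(1 + \<epsilon> * w)^3 = 1 + 3 * \<epsilon> * w - 3 * w^2 - \<epsilon> * w^3"
      "(1 - \<epsilon> * w)^3 = 1 - 3 * \<epsilon> * w - 3 * w^2 + \<epsilon> * w^3"
      "(1 + \<epsilon> * w)^2 * (1 - \<epsilon> * w) = (1 + w^2) * (1 + \<epsilon> * w)"
      "(1 + \<epsilon> * w) * (1 - \<epsilon> * w)^2 = (1 + w^2) * (1 - \<epsilon> * w)"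
      unfolding e2 by simp_all
  qed
  have "\<epsilon>^3 + \<epsilon> = \<epsilon> * (\<epsilon> * \<epsilon> + 1)" by algebra
  then have e3: "\<epsilon>^3 = - \<epsilon>" unfolding e2 by (simp add: eq_neg_iff_add_eq_0)
  have a3: "x3 = - \<epsilon> * (A1 - B1 + b2 - b1)" unfolding f01[symmetric] e3 by (simp add: algebra_simps)
  have one: "(1 + \<epsilon>)^3 = 2 * \<epsilon> - 2" "(1 - \<epsilon>)^3 = - 2 - 2 * \<epsilon>"
    "(1 + \<epsilon>)^2 * (1 - \<epsilon>) = 2 + 2 * \<epsilon>" "(1 + \<epsilon>) * (1 - \<epsilon>)^2 = 2 - 2 * \<epsilon>"
    "(1 - \<epsilon>)^2 * (1 + \<epsilon>) = 2 - 2 * \<epsilon>" "(1 - \<epsilon>) * (1 + \<epsilon>)^2 = 2 + 2 * \<epsilon>"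
    using cube[of 1] cube'[of 1] square[of 1] square'[of 1] by (simp_all add: mult.commute)
  have f11: "A1 * (2 * \<epsilon> - 2) + B1 * (2 * \<epsilon> + 2) + b2 * (2 - 2 * \<epsilon>) + b1 * (- 2 - 2 * \<epsilon>) = x0 + x1 + x2 + x3"
    using f11 unfolding mult.assoc one by (simp add: algebra_simps)
  have f1m: "A1 * (- 2 - 2 * \<epsilon>) + B1 * (2 - 2 * \<epsilon>) + b2 * (2 + 2 * \<epsilon>) + b1 * (2 * \<epsilon> - 2) = x0 - x1 + x2 - x3"
    using f1m unfolding mult.assoc one by (simp add: algebra_simps)
  have "2 * x1 = (x0 + x1 + x2 + x3) - (x0 - x1 + x2 - x3) - 2 * x3" by simp
  also have "\<dots> = 2 * (\<epsilon> * (3 * A1 + B1 - b2 - 3 * b1))"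
    unfolding f11[symmetric] f1m[symmetric] unfolding a3 by (simp add: algebra_simps)
  finally have a1: "x1 = \<epsilon> * (3 * A1 + B1 - b2 - 3 * b1)" by (rule mult_left_cancel[THEN iffD1, rotated]) simp
  have "2 * x2 = (x0 + x1 + x2 + x3) + (x0 - x1 + x2 - x3) - 2 * x0" by simp
  also have "\<dots> = 2 * (- 3 * A1 + B1 + b2 - 3 * b1)"
    unfolding f11[symmetric] f1m[symmetric] unfolding f10[symmetric] by (simp add: algebra_simps)
  finally have a2: "x2 = - 3 * A1 + B1 + b2 - 3 * b1" by (rule mult_left_cancel[THEN iffD1, rotated]) simp
  \<comment> \<open>Both sides are x f_y - y f_x at (1, w), on the left in the variables x +
    \<epsilon> y and x - \<epsilon> y, on which the rotation acts by \<epsilon> and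
    -\<epsilon>.\<close>
  have "\<epsilon> * (3 * A1 * (1 + \<epsilon> * w)^3 + B1 * ((1 + \<epsilon> * w)^2 * (1 - \<epsilon> * w))
      - b2 * ((1 + \<epsilon> * w) * (1 - \<epsilon> * w)^2) - 3 * b1 * (1 - \<epsilon> * w)^3)
      = - x2 * w^3 + (3 * x3 - 2 * x1) * w^2 + (2 * x2 - 3 * x0) * w + x1
        + (\<epsilon> * \<epsilon> + 1) * ((9 * A1 + B1 + b2 + 9 * b1) * w + (- 3 * A1 + B1 + b2 - 3 * b1) * w^3)"
    unfolding a1 a2 a3 f10[symmetric] cube cube' square square' by algebra
  also have "\<dots> = - x2 * w^3 + (3 * x3 - 2 * x1) * w^2 + (2 * x2 - 3 * x0) * w + x1"
    unfolding e2 by simp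
  also have "\<dots> = 0" using w(2) by (simp add: x0_def x1_def x2_def x3_def)
  finally have "3 * A1 * (1 + \<epsilon> * w)^3 + B1 * ((1 + \<epsilon> * w)^2 * (1 - \<epsilon> * w))
      - b2 * ((1 + \<epsilon> * w) * (1 - \<epsilon> * w)^2) - 3 * b1 * (1 - \<epsilon> * w)^3 = 0"
    using \<epsilon> by auto
  then have k: "3 * A1 * (1 + \<epsilon> * w)^3 + B1 * (1 + \<epsilon> * w)^2 * (1 - \<epsilon> * w)
      - b2 * (1 + \<epsilon> * w) * (1 - \<epsilon> * w)^2 - 3 * b1 * (1 - \<epsilon> * w)^3 = 0"
    by (simp only: mult.assoc)
  define X Y where "X = \<mu> * (1 + \<epsilon> * w)" and "Y = cnj \<mu> * (1 - \<epsilon> * w)"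
  have "c * (3 * A * X^3 + B * X^2 * Y - cnj B * X * Y^2 - 3 * cnj A * Y^3) =
      3 * A1 * (1 + \<epsilon> * w)^3 + B1 * (1 + \<epsilon> * w)^2 * (1 - \<epsilon> * w)
      - b2 * (1 + \<epsilon> * w) * (1 - \<epsilon> * w)^2 - 3 * b1 * (1 - \<epsilon> * w)^3"
    unfolding X_def Y_def A1_def B1_def b1_def b2_def complex_cnj_mult complex_cnj_power complex_cnj_cnj
      complex_cnj_complex_of_real
    by algebra
  then have "c * (3 * A * X^3 + B * X^2 * Y - cnj B * X * Y^2 - 3 * cnj A * Y^3) = 0"
    unfolding k .
  then have k: "3 * A * X^3 + B * X^2 * Y - cnj B * X * Y^2 - 3 * cnj A * Y^3 = 0" using c by simp
  show ?thesis
  proof (cases "Y = 0")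
    case True
    \<comment> \<open>The root lies at infinity: only the leading term survives, so A = 0.\<close>
    then have "\<epsilon> * w = 1" using \<mu> by (simp add: Y_def)
    then have "X \<noteq> 0" using \<mu> by (simp add: X_def)
    then show ?thesis using k True by simp
  next
    case False
    define s where "s = X / Y"
    have X: "X = s * Y" using False by (simp add: s_def)
    have "Y^3 * crit_poly A B s = 0"
      using k unfolding X crit_poly_def by (simp add: algebra_simps power2_eq_square power3_eq_cube)
    then have root: "crit_poly A B s = 0" using False by simp
    \<comment> \<open>Equal norms of X and Y would need Re (\<epsilon> w) = 0, but this is Im w up
      to sign.\<close>
    have "(norm (1 + \<epsilon> * w))\<^sup>2 - (norm (1 - \<epsilon> * w))\<^sup>2 = 4 * Re (\<epsilon> * w)"
      unfolding cmod_power2 by (simp add: power2_eq_square algebra_simps)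
    moreover have "Re (\<epsilon> * w) \<noteq> 0" using re[of w] w(1) by auto
    ultimately have "norm (1 + \<epsilon> * w) \<noteq> norm (1 - \<epsilon> * w)" by auto
    then have s1: "norm s \<noteq> 1"
      using False \<mu> by (auto simp: s_def X_def Y_def norm_divide norm_mult)
    show ?thesis
    proof (cases "s = 0")
      case True
      then show ?thesis using root by (simp add: crit_poly_def)
    next
      case nz: False
      show ?thesis
      proof (cases "norm s > 1")
        case True then show ?thesis using root by blast
      next
        case False
        then have "norm (1 / cnj s) > 1" using s1 nz by (simp add: norm_divide)
        moreover have "crit_poly A B (1 / cnj s) = 0" using crit_poly_reciprocal[OF nz, of A B] root by simp
        ultimately show ?thesis by blast
      qed
    qed
  qed
qed

lemma transpose_mult_vec2: "transpose (M :: real^2^2) *v P = (P $ 1) *\<^sub>R M $ 1 + (P $ 2) *\<^sub>R M $ 2"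
  by (simp add: vec_eq_iff matrix_vector_mult_def transpose_def sum_2 mult.commute)

context cubic_integral
begin

lemma elliptic_point:
  assumes S: "semigeodesic_coordinates \<rho> L S g" and norm: "normalized_cubic F S g a"
    and ell: "elliptic_matrix (A_matrix (vector [a 0 (S q), a 1 (S q), a 2 (S q)]))"
  shows "A q = 0 \<or> (\<exists>s. norm s > 1 \<and> crit_poly (A q) (B q) s = 0)"
proof -
  define J where "J = jacobian S (at q)"
  define G where "G = g (S q)"
  define m11 m12 m21 m22 where "m11 = G * J $ 1 $ 1" and "m12 = G * J $ 1 $ 2" and "m21 = J $ 2 $ 1" and "m22 = J $ 2 $ 2"
  have G: "G > 0" using S by (simp add: semigeodesic_coordinates_def G_def)
  have m: "v \<bullet> (\<rho> q *v v) = G\<^sup>2 * ((J *v v) $ 1)\<^sup>2 + ((J *v v) $ 2)\<^sup>2" for v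
    using S unfolding semigeodesic_coordinates_def J_def G_def by blast
  have iso: "\<Lambda> q * (x\<^sup>2 + y\<^sup>2) = (m11 * x + m12 * y)\<^sup>2 + (m21 * x + m22 * y)\<^sup>2" for x y
    using m[of "vector [x, y]"]
    by (simp add: metric mat_def matrix_vector_mult_def inner_vec_def sum_2 vector_2 m11_def m12_def m21_def m22_def)
      (simp add: power2_eq_square algebra_simps)
  have i: "m11\<^sup>2 + m21\<^sup>2 = \<Lambda> q" "m12\<^sup>2 + m22\<^sup>2 = \<Lambda> q" "m11 * m12 + m21 * m22 = 0"
    using iso[of 1 0] iso[of 0 1] iso[of 1 1] by (auto simp: power2_eq_square algebra_simps)
  \<comment> \<open>The coframe (g dt, dx) in complex notation, conjugated to match x = p1 - i p2.
    Conformality to the coordinates q amounts to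
    \<open>\<nu>\<^sup>2 = - (\<mu>\<^sup>2)\<close>.\<close>
  define \<mu> \<nu> where "\<mu> = Complex m11 (- m12)" and "\<nu> = Complex m21 (- m22)"
  have sq: "\<nu>\<^sup>2 = - (\<mu>\<^sup>2)"
    using i by (simp add: \<mu>_def \<nu>_def complex_eq_iff power2_eq_square)
  have \<mu>: "\<mu> \<noteq> 0"
  proof
    assume 0: "\<mu> = 0"
    then have "\<nu> = 0" using sq by simp
    with 0 have "\<Lambda> q = 0" using i by (simp add: \<mu>_def \<nu>_def complex_eq_iff)
    then show False using pos[of q] by simp
  qed
  define \<epsilon> where "\<epsilon> = \<nu> / \<mu>"
  have \<epsilon>: "\<epsilon>\<^sup>2 = - 1" using sq \<mu> by (simp add: \<epsilon>_def power_divide)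
  have \<nu>: "\<nu> = \<mu> * \<epsilon>" using \<mu> by (simp add: \<epsilon>_def)
  obtain c where c: "c \<noteq> 0" and id: "\<And>P. c * F (q, transpose J *v P) =
        (\<Sum>k\<le>3. a k (S q) * ((P $ 1) ^ (3 - k) / G ^ (3 - k)) * (P $ 2) ^ k)"
    using norm unfolding normalized_cubic_def J_def G_def by blast
  have a: "a 2 (S q) = G" "a 3 (S q) = 1" using norm by (simp_all add: normalized_cubic_def G_def)
  have form: "c * (2 * Re (A q * (\<mu> * (x + \<epsilon> * y))^3 + B q * (\<mu> * (x + \<epsilon> * y))^2 * cnj (\<mu> * (x + \<epsilon> * y))))
      = a 0 (S q) * x^3 + a 1 (S q) * x^2 * y + a 2 (S q) * x * y^2 + a 3 (S q) * y^3" for x y :: real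
  proof -
    \<comment> \<open>Momenta of the form (G x, y) cancel the powers of g in the normalized
      integral.\<close>
    have "vec_complex (transpose J *v vector [G * x, y]) = cnj (x * \<mu> + y * \<nu>)"
      unfolding transpose_mult_vec2
      by (simp add: vector_2 vec_complex_def complex_eq_iff \<mu>_def \<nu>_def
          m11_def m12_def m21_def m22_def)
    then have v: "cnj (vec_complex (transpose J *v vector [G * x, y])) = \<mu> * (x + \<epsilon> * y)"
      by (simp add: \<nu> algebra_simps)
    have "c * (2 * Re (A q * (\<mu> * (x + \<epsilon> * y))^3 + B q * (\<mu> * (x + \<epsilon> * y))^2 * cnj (\<mu> * (x + \<epsilon> * y))))
        = c * F (q, transpose J *v vector [G * x, y])"
      unfolding F_complex v[symmetric] complex_cnj_cnj ..
    also have "\<dots> = a 0 (S q) * x^3 + a 1 (S q) * x^2 * y + a 2 (S q) * x * y^2 + a 3 (S q) * y^3"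
      unfolding id using G by (simp add: vector_2 numeral_3_eq_3 numeral_2_eq_2 power_mult_distrib)
    finally show ?thesis .
  qed
  obtain w :: complex where w: "Im w \<noteq> 0"
    "- a 2 (S q) * w^3 + (3 - 2 * a 1 (S q)) * w^2 + (2 * a 2 (S q) - 3 * a 0 (S q)) * w + a 1 (S q) = 0"
    using elliptic_matrix_nonreal_root[OF ell] a(1) G by auto
  show ?thesis
    by (rule nonreal_critical_point[OF \<epsilon> \<mu> c form w(1)]) (use w(2) a(2) in simp)
qed

text \<open>At the momentum (0, 1) only the coefficient \<open>a 3\<close> survives, and it is
  normalized to 1.\<close>

lemma integral_not_zero:
  assumes "normalized_cubic F S g a"
  shows "A q \<noteq> 0 \<or> B q \<noteq> 0"
proof (rule ccontr)
  assume "\<not> (A q \<noteq> 0 \<or> B q \<noteq> 0)"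
  then have F0: "F (q, p) = 0" for p by (simp add: F_complex)
  obtain c where "\<And>P. c * F (q, transpose (jacobian S (at q)) *v P) =
        (\<Sum>k\<le>3. a k (S q) * ((P $ 1) ^ (3 - k) / g (S q) ^ (3 - k)) * (P $ 2) ^ k)"
    using assms unfolding normalized_cubic_def by blast
  from this[of "vector [0, 1]"] show False
    using assms by (simp add: F0 vector_2 numeral_3_eq_3 numeral_2_eq_2 normalized_cubic_def)
qed

lemma invariant_direction_exists:
  assumes "lattice \<Gamma>" and "A q0 \<noteq> 0 \<or> B q0 \<noteq> 0"
  shows "\<exists>d E. d \<noteq> 0 \<and> open E \<and> (\<forall>q\<in>E. \<forall>t. \<Lambda> (q + t *\<^sub>R d) = \<Lambda> q) \<and>
    (\<forall>q. A q = 0 \<or> (\<exists>s. norm s > 1 \<and> crit_poly (A q) (B q) s = 0) \<longrightarrow> q \<in> E)"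
proof -
  obtain u v where uv: "u \<in> \<Gamma>" "v \<in> \<Gamma>" and basis: "u $ 1 * v $ 2 - u $ 2 * v $ 1 > 0"
    using lattice_basis[OF assms(1)] by blast
  show ?thesis
    by (rule integral_invariant_direction[OF \<Lambda>_deriv cont_\<Lambda>' pos _ _ A_deriv cont_A' _ _ B_deriv cont_B' _ _
          basis pde assms(2)])
       (use uv in \<open>simp_all add: \<Lambda>_per A_per B_per\<close>)
qed

end

section \<open>The linear integral\<close>

text \<open>The level sets of the linear form annihilating d are the lines parallel to d.\<close>

lemma function_of_linear_form_invariant:
  assumes d: "d \<noteq> 0" and inv: "\<And>q t. q \<in> W \<Longrightarrow> \<Lambda> (q + t *\<^sub>R d) = \<Lambda> q"
  shows "function_of_linear_form \<Lambda> (- d $ 2) (d $ 1) W"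
proof -
  define \<phi> :: "real^2 \<Rightarrow> real" where "\<phi> q = - d $ 2 * q $ 1 + d $ 1 * q $ 2" for q
  have eq: "\<Lambda> q = \<Lambda> q'" if "q \<in> W" "q' \<in> W" "\<phi> q = \<phi> q'" for q q'
  proof -
    obtain i where i: "d $ i \<noteq> 0" using d by (auto simp: vec_eq_iff)
    have "(q' - q) $ i * d $ j = d $ i * (q' - q) $ j" for j
      using that(3) exhaust_2[of i] exhaust_2[of j] by (auto simp: \<phi>_def algebra_simps)
    then have "q' = q + ((q' - q) $ i / d $ i) *\<^sub>R d" using i by (simp add: vec_eq_iff field_simps)
    then show ?thesis using inv[OF that(1)] by metis
  qed
  \<comment> \<open>A representative in W of each level; on levels that miss W its value is
    arbitrary.\<close>
  define r where "r x = (SOME q. q \<in> W \<and> \<phi> q = x)" for x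
  have "\<Lambda> q = \<Lambda> (r (\<phi> q))" if "q \<in> W" for q
  proof -
    have "r (\<phi> q) \<in> W \<and> \<phi> (r (\<phi> q)) = \<phi> q"
      unfolding r_def by (rule someI[of "\<lambda>p. p \<in> W \<and> \<phi> p = \<phi> q" q]) (simp add: that)
    then show ?thesis by (intro eq that) simp_all
  qed
  then show ?thesis
    unfolding function_of_linear_form_def \<phi>_def by (intro exI[of _ "\<lambda>x. \<Lambda> (r x)"]) simp
qed

lemma Ck_const: "Ck k (\<lambda>x. c)"
  by (induction k arbitrary: c) (simp_all add: frechet_derivative_const)

lemma smooth_bounded_linear:
  assumes "bounded_linear f"
  shows "smooth f"
  unfolding smooth_def
proof
  fix k
  have d: "(f has_derivative f) (at x)" for x using assms by (rule bounded_linear_imp_has_derivative)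
  then have "frechet_derivative f (at x) = f" for x using frechet_derivative_at by metis
  moreover have "f differentiable (at x)" for x using d differentiableI by blast
  ultimately show "Ck k f"
    using linear_continuous_on[OF assms] by (cases k) (simp_all add: Ck_const)
qed

text \<open>Noether: translation along d preserves H, so the conjugate momentum, the inner product
  of d and p, is conserved.\<close>

lemma linear_first_integral:
  assumes conf: "conformal_coordinates \<Gamma> \<rho> \<Lambda>" and d: "d \<noteq> 0" and inv: "\<And>q t. \<Lambda> (q + t *\<^sub>R d) = \<Lambda> q"
  shows "\<exists>F\<^sub>1. first_integral \<Gamma> \<rho> F\<^sub>1 \<and> homogeneous_in_momenta 1 F\<^sub>1 \<and> (\<exists>z. F\<^sub>1 z \<noteq> 0)"
proof -
  have pos: "\<Lambda> q > 0" and metric: "\<rho> q = \<Lambda> q *\<^sub>R mat 1" and \<Lambda>: "(\<Lambda> has_derivative frechet_derivative \<Lambda> (at q)) (at q)" for q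
    using conf smooth_has_derivative by (auto simp: conformal_coordinates_def)
  define F\<^sub>1 :: "phase \<Rightarrow> real" where "F\<^sub>1 z = d \<bullet> snd z" for z
  have bl: "bounded_linear F\<^sub>1" unfolding F\<^sub>1_def by (intro bounded_linear_intros)
  have fr: "frechet_derivative F\<^sub>1 (at z) = F\<^sub>1" for z
    using frechet_derivative_at[OF bounded_linear_imp_has_derivative[OF bl]] by metis
  have zero: "frechet_derivative \<Lambda> (at q) d = 0" for q
  proof -
    have "((\<lambda>t. q + t *\<^sub>R d) has_derivative (\<lambda>h. h *\<^sub>R d)) (at 0)"
      by (auto intro!: derivative_eq_intros)
    from has_derivative_compose[OF this \<Lambda>] have "((\<lambda>t. \<Lambda> q) has_derivative (\<lambda>h. frechet_derivative \<Lambda> (at q) (h *\<^sub>R d))) (at 0)"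
      by (simp add: inv)
    from has_derivative_unique[OF this has_derivative_const]
    have "frechet_derivative \<Lambda> (at q) (1 *\<^sub>R d) = 0" by metis
    then show ?thesis by simp
  qed
  have "poisson F\<^sub>1 (hamiltonian \<rho>) z = 0" for z
  proof (cases z)
    case (Pair q p)
    have lin: "linear (frechet_derivative \<Lambda> (at q))" using has_derivative_linear[OF \<Lambda>] .
    have "frechet_derivative \<Lambda> (at q) d = (\<Sum>i\<in>UNIV. d $ i * frechet_derivative \<Lambda> (at q) (axis i 1))"
      by (subst vec2_expand[of d]) (simp only: linear_add[OF lin] linear_cmul[OF lin] sum_2 real_scaleR_def)
    then have s: "(\<Sum>i\<in>UNIV. d $ i * frechet_derivative \<Lambda> (at q) (axis i 1)) = 0" using zero by simp
    have "poisson F\<^sub>1 (hamiltonian \<rho>) z =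
        (\<Sum>i\<in>UNIV. d $ i * frechet_derivative \<Lambda> (at q) (axis i 1)) * ((p \<bullet> p) / (2 * (\<Lambda> q)\<^sup>2))"
      unfolding poisson_def Pair fr hamiltonian_frechet[OF metric pos \<Lambda>] sum_distrib_right
      by (simp add: F\<^sub>1_def inner_axis mult_ac)
    then show ?thesis unfolding s by simp
  qed
  then have "first_integral \<Gamma> \<rho> F\<^sub>1"
    using smooth_bounded_linear[OF bl] by (simp add: first_integral_def lattice_periodic_def F\<^sub>1_def)
  moreover have "homogeneous_in_momenta 1 F\<^sub>1"
    unfolding homogeneous_in_momenta_def
    by (intro exI[of _ "\<lambda>k q. if k = 0 then d $ 1 else d $ 2"]) (simp add: F\<^sub>1_def inner_vec_def sum_2)
  moreover have "F\<^sub>1 (0, d) \<noteq> 0" using d by (simp add: F\<^sub>1_def)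
  ultimately show ?thesis by blast
qed

theorem corollary1:
  fixes \<Gamma> :: "(real^2) set"
    and \<rho> :: "real^2 \<Rightarrow> real^2^2" and \<Lambda> :: "real^2 \<Rightarrow> real"
    and F\<^sub>3 :: "phase \<Rightarrow> real" and L :: "phase set"
    and S :: "real^2 \<Rightarrow> real^2" and g :: "real^2 \<Rightarrow> real" and a :: "nat \<Rightarrow> real^2 \<Rightarrow> real"
    and \<Omega>\<^sub>e :: "(real^2) set set"
  assumes "lattice \<Gamma>"
    and "riemannian_metric \<Gamma> \<rho>"
    and "conformal_coordinates \<Gamma> \<rho> \<Lambda>"
    and "first_integral \<Gamma> \<rho> F\<^sub>3" and "homogeneous_in_momenta 3 F\<^sub>3"
    and "regular_liouville_torus \<Gamma> \<rho> F\<^sub>3 L"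
    and "semigeodesic_coordinates \<rho> L S g"
    and "normalized_cubic F\<^sub>3 S g a"
    and "elliptic_region \<Gamma> S a \<Omega>\<^sub>e"
  shows "(flat_on \<rho> (\<Union>\<Omega>\<^sub>e) \<or> (\<exists>m n. function_of_linear_form \<Lambda> m n (\<Union>\<Omega>\<^sub>e))) \<and>
         (analytic_metric \<rho> \<longrightarrow>
            (\<exists>m n. function_of_linear_form \<Lambda> m n UNIV) \<and>
            (\<exists>F\<^sub>1. first_integral \<Gamma> \<rho> F\<^sub>1 \<and> homogeneous_in_momenta 1 F\<^sub>1 \<and> (\<exists>z. F\<^sub>1 z \<noteq> 0)))"
proof -
  obtain b :: "nat \<Rightarrow> real^2 \<Rightarrow> real" where
    b: "\<And>q p. F\<^sub>3 (q, p) = (\<Sum>k\<le>3. b k q * (p $ 1) ^ (3 - k) * (p $ 2) ^ k)"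
    using assms(5) unfolding homogeneous_in_momenta_def by blast
  interpret cubic_integral \<Gamma> \<rho> \<Lambda> F\<^sub>3 b
    using assms(3,4) b by unfold_locales
  obtain d E where d: "d \<noteq> 0" and E: "open E" "\<And>q t. q \<in> E \<Longrightarrow> \<Lambda> (q + t *\<^sub>R d) = \<Lambda> q"
    "\<And>q. A q = 0 \<or> (\<exists>s. norm s > 1 \<and> crit_poly (A q) (B q) s = 0) \<Longrightarrow> q \<in> E"
    using invariant_direction_exists[OF assms(1) integral_not_zero[OF assms(8)]] by blast
  have \<Omega>: "\<Omega>\<^sub>e \<subseteq> elliptic_set \<Gamma> S a" "\<Omega>\<^sub>e \<noteq> {}"
    using assms(9) connected_components_of_subset[of \<Omega>\<^sub>e] nonempty_connected_components_of
    unfolding elliptic_region_def by fastforce+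
  \<comment> \<open>Ellipticity is known for one lift \<open>q'\<close> of each torus point;
    periodicity of A and B carries the root condition to all lifts.\<close>
  have sub: "\<Union>\<Omega>\<^sub>e \<subseteq> E"
  proof
    fix q assume "q \<in> \<Union>\<Omega>\<^sub>e"
    then obtain q' \<gamma> where q: "q = q' + \<gamma>" "\<gamma> \<in> \<Gamma>"
      and ell: "elliptic_matrix (A_matrix (vector [a 0 (S q'), a 1 (S q'), a 2 (S q')]))"
      using \<Omega>(1) unfolding elliptic_set_def torus_proj_def by blast
    show "q \<in> E"
      using elliptic_point[OF assms(7,8) ell] q by (intro E(3)) (simp add: A_per B_per)
  qed
  \<comment> \<open>Provides a point of E from which the analytic continuation starts.\<close>
  have ne: "\<Union>\<Omega>\<^sub>e \<noteq> {}"
  proof -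
    obtain V where V: "V \<in> \<Omega>\<^sub>e" using \<Omega>(2) by blast
    then obtain q where "V = torus_proj \<Gamma> q" using \<Omega>(1) unfolding elliptic_set_def by blast
    moreover obtain \<gamma> where "\<gamma> \<in> \<Gamma>" using lattice_basis[OF assms(1)] by blast
    ultimately have "q + \<gamma> \<in> V" by (simp add: torus_proj_def)
    then show ?thesis using V by blast
  qed
  have part1: "function_of_linear_form \<Lambda> (- d $ 2) (d $ 1) (\<Union>\<Omega>\<^sub>e)"
    by (rule function_of_linear_form_invariant[OF d]) (use sub E(2) in blast)
  have part2: "(\<exists>m n. function_of_linear_form \<Lambda> m n UNIV) \<and>
      (\<exists>F\<^sub>1. first_integral \<Gamma> \<rho> F\<^sub>1 \<and> homogeneous_in_momenta 1 F\<^sub>1 \<and> (\<exists>z. F\<^sub>1 z \<noteq> 0))"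
    if an: "analytic_metric \<rho>"
  proof -
    have "real_analytic (\<lambda>q. \<rho> q $ 1 $ 1)" using an by (simp add: analytic_metric_def)
    then have an: "real_analytic \<Lambda>" by (simp add: metric mat_def)
    obtain q0 where "q0 \<in> E" using ne sub by blast
    then have inv: "\<Lambda> (q + t *\<^sub>R d) = \<Lambda> q" for q t
      by (rule real_analytic_translation_invariant[OF an E(1)]) (rule E(2))
    have "function_of_linear_form \<Lambda> (- d $ 2) (d $ 1) UNIV"
      by (rule function_of_linear_form_invariant[OF d inv])
    then show ?thesis using linear_first_integral[OF assms(3) d inv] by blast
  qed
  show ?thesis using part1 part2 by blast
qed

end
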